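(* Assume the setting and conditions $\mathscr R_1$–$\mathscr R_4$ of the context and let $\vartheta_0\in\Theta$ be the true position, $\tau_0=(\tau_1(\vartheta_0),\dots,\tau_k(\vartheta_0))$. Let $\hat\tau_n=(\hat\tau_{1,n},\dots,\hat\tau_{k,n})$, where $\hat\tau_{j,n}$ maximizes $\tau\mapsto L_j(\tau,X_j)$ over $[\alpha_j,\beta_j]$. Then $\hat\tau_n$ is consistent and asymptotically normal, $$\sqrt n(\hat\tau_n-\tau_0)\Rightarrow\xi\sim\mathcal N\big(0,\mathbb I_\tau(\vartheta_0)^{-1}\big),$$ all polynomial moments of $\sqrt n(\hat\tau_n-\tau_0)$ converge to those of $\xi$, and $\hat\tau_n$ is asymptotically efficient (in the minimax Hájek–Le Cam sense: $\lim_{\delta\to0}\lim_{n\to\infty}\sup_{\|\tau-\tau_0\|\le\delta}n\mathbf E_\tau\|\hat\tau_n-\tau\|^2=\mathbf E\|\xi\|^2$).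
   Context: Setting. $\Theta\subset\mathbb R^2$ is a bounded open convex set; $T>0$, $\nu>0$, $\lambda_0>0$ are known; $k\ge3$ detectors at known points $\vartheta_j=(x_j,y_j)$. $\tau_j(\vartheta)=\nu^{-1}\|\vartheta_j-\vartheta\|$, $\alpha_j=\inf_\Theta\tau_j$, $\beta_j=\sup_\Theta\tau_j$, with $0<\alpha_j$, $\beta_j<T$; $\lambda_j$ is defined on $[-\beta_j,T-\alpha_j]$. The observations $X_j=(X_j(t),0\le t\le T)$, $j=1,\dots,k$, are independent inhomogeneous Poisson processes with intensities $n\lambda_j(t-\tau_j)+n\lambda_0$, where $\tau_j=\tau_j(\vartheta_0)$. For each $j$, the likelihood ratio in the delay $\tau$ is $$L_j(\tau,X_j)=\exp\Big\{\int_\tau^T\ln\Big(1+\frac{\lambda_j(t-\tau)}{\lambda_0}\Big)dX_j(t)-n\int_\tau^T\lambda_j(t-\tau)dt\Big\}.$$ $\mathbb I_\tau(\vartheta_0)$ is the $k\times k$ diagonal matrix with entries $\mathbb I_\tau(\vartheta_0)_{jj}=\int_{\tau_j(\vartheta_0)}^T\frac{\lambda_j'(t-\tau_j(\vartheta_0))^2}{\lambda_j(t-\tau_j(\vartheta_0))+\lambda_0}dt$. Fisher information for the position: $J_j(\vartheta)=\frac{1}{\nu^2\|\vartheta_j-\vartheta\|^2}\mathbb I_\tau(\vartheta)_{jj}$ and $\mathbb I(\vartheta)=\sum_jJ_j(\vartheta)(\vartheta_j-\vartheta)(\vartheta_j-\vartheta)^\top$. Conditions: ($\mathscr R_1$)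 $\lambda_j(t)=0$ on $[-\beta_j,0]$ and $\lambda_j(t)>0$ on $(0,T-\alpha_j]$; ($\mathscr R_2$) each $\lambda_j$ has two continuous derivatives; ($\mathscr R_3$) $\inf_{\vartheta\in\Theta}\inf_{|e|=1}e^\top\mathbb I(\vartheta)e>0$; ($\mathscr R_4$) at least three detector points are not collinear. *)

theory Defs
  imports "HOL-Probability.Probability"
begin

text \<open>A realisation of a point process on [0,T] is encoded as a pair (N, Y):
  N is the number of events and Y 0, ..., Y (N-1) are the event times.
  The counting process is X(t) = #{i < N. Y i \<le> t}.\<close>

type_synonym path = "nat \<times> (nat \<Rightarrow> real)"

definition poisson_count :: "real \<Rightarrow> nat measure" where
  "poisson_count Lam = density (count_space UNIV) (\<lambda>m. ennreal (Lam ^ m / fact m * exp (- Lam)))"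

text \<open>Law of an inhomogeneous Poisson process on [0,T] with intensity mu:
  the number of events is Poisson with mean the integral of mu over [0,T], and given it the
  event times are i.i.d. with density mu / (integral of mu) on [0,T].\<close>
definition poisson_process :: "real \<Rightarrow> (real \<Rightarrow> real) \<Rightarrow> path measure" where
  "poisson_process T mu =
     (let Lam = integral {0..T} mu in
      poisson_count Lam \<Otimes>\<^sub>M
      (\<Pi>\<^sub>M i\<in>(UNIV::nat set). density lborel (\<lambda>t. ennreal (indicator {0..T} t * mu t / Lam))))"

definition path_integral :: "(real \<Rightarrow> real) \<Rightarrow> real \<Rightarrow> real \<Rightarrow> path \<Rightarrow> real" where
  "path_integral f a b X = (\<Sum>i<fst X. indicator {a..b} (snd X i) * f (snd X i))"

definition delay :: "real \<Rightarrow> real^2 \<Rightarrow> real^2 \<Rightarrow> real" where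
  "delay nu thj th = norm (thj - th) / nu"

definition lik :: "nat \<Rightarrow> real \<Rightarrow> real \<Rightarrow> (real \<Rightarrow> real) \<Rightarrow> real \<Rightarrow> path \<Rightarrow> real" where
  "lik n T lam0 lam tau X =
     exp (path_integral (\<lambda>t. ln (1 + lam (t - tau) / lam0)) tau T X
          - real n * integral {tau..T} (\<lambda>t. lam (t - tau)))"

definition obs_law ::
  "nat \<Rightarrow> real \<Rightarrow> real \<Rightarrow> ('k::finite \<Rightarrow> real \<Rightarrow> real) \<Rightarrow> real^'k \<Rightarrow> ('k \<Rightarrow> path) measure" where
  "obs_law n T lam0 lam tau =
     (\<Pi>\<^sub>M j\<in>UNIV. poisson_process T (\<lambda>t. real n * lam j (t - tau $ j) + real n * lam0))"

definition fisher_delay :: "real \<Rightarrow> real \<Rightarrow> (real \<Rightarrow> real) \<Rightarrow> (real \<Rightarrow> real) \<Rightarrow> real \<Rightarrow> real" where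
  "fisher_delay T lam0 lam lam' tau =
     integral {tau..T} (\<lambda>t. (lam' (t - tau))\<^sup>2 / (lam (t - tau) + lam0))"

definition fisher_pos ::
  "real \<Rightarrow> real \<Rightarrow> real \<Rightarrow> ('k::finite \<Rightarrow> real^2) \<Rightarrow> ('k \<Rightarrow> real \<Rightarrow> real) \<Rightarrow> ('k \<Rightarrow> real \<Rightarrow> real)
     \<Rightarrow> real^2 \<Rightarrow> real^2^2" where
  "fisher_pos T nu lam0 dpos lam lam' th =
     (\<Sum>j\<in>UNIV. (fisher_delay T lam0 (lam j) (lam' j) (delay nu (dpos j) th)
                   / (nu\<^sup>2 * (norm (dpos j - th))\<^sup>2))
                *\<^sub>R (\<chi> a b. (dpos j - th) $ a * (dpos j - th) $ b))"

definition gaussian_diag :: "('k::finite \<Rightarrow> real) \<Rightarrow> (real^'k) measure" where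
  "gaussian_diag v = density lborel (\<lambda>x. ennreal (\<Prod>j\<in>UNIV. normal_density 0 (sqrt (v j)) (x $ j)))"

definition weak_conv :: "(nat \<Rightarrow> 'a::metric_space measure) \<Rightarrow> 'a measure \<Rightarrow> bool" where
  "weak_conv M M0 \<longleftrightarrow>
     (\<forall>f :: 'a \<Rightarrow> real. continuous_on UNIV f \<and> bounded (range f) \<longrightarrow>
        (\<lambda>n. \<integral>x. f x \<partial>M n) \<longlonglongrightarrow> (\<integral>x. f x \<partial>M0))"

end

theory Submission
  imports Defs
begin

text \<open>
  For one detector let \<open>\<ell>\<close> be the log-likelihood, \<open>Z\<close> its centred version and \<open>d\<close> the error of the
  maximiser. The Kullback contrast dominates \<open>c d^2\<close>: by Cauchy-Schwarz with weight one it is at least a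
  multiple of the squared difference of the total intensities, and that difference is the integral
  of the signal over an interval of length \<open>\<bar>d\<bar>\<close> on which the signal is bounded below. Hence
  \<open>c n \<bar>d\<bar> \<le> sup \<bar>Z'\<bar> \<le> \<bar>Z'(\<tau>\<^sub>0)\<bar> + \<integral> \<bar>Z''\<bar>\<close>, and exponential moments of Poisson integrals bound all
  moments of \<open>\<surd>n d\<close> uniformly in the true delay. Expanding the likelihood equation,
  \<open>\<I> \<surd>n d\<close> differs from the normalised score by a remainder with second moment of order \<open>n\<close> to the
  power \<open>-1/2\<close>, again uniformly. The score has variance exactly \<open>\<I>\<close>, which gives the uniform limit
  of the quadratic risk, and its characteristic function converges to the Gaussian one. A coordinate
  of the estimator may depend on all observations (ties), so joint convergence is proved for the
  independent scores, by Skorohod's theorem on a product space, and transferred to the estimator.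
\<close>

section \<open>Inhomogeneous Poisson processes\<close>

text \<open>The supremum of the risk over a ball of delays forces every stochastic constant to be
  free of the true delay \<open>ts\<close> and of \<open>n\<close> for \<open>n >= 1\<close>. Since
  a maximiser may be chosen with the help of the other detectors, its own law is never computed:
  each inequality is proved for every path and every maximiser of that path, with a majorant that
  depends on one path only, and it is this majorant that is integrated. The supremum of the score
  fluctuation over delays is dominated through an integral of powers of \<open>z2\<close> over the
  delay interval, so that Tonelli reduces everything to moments at a fixed delay.

  The likelihood equation is available only for a maximiser inside the interval. The true delay is
  therefore kept at a distance \<open>rho\<close> from the endpoints; a maximiser at an endpoint is
  then off by at least \<open>rho\<close>, and one more power of the normalised error pays for that
  case. The remainder is of squared size \<open>1 / sqrt n\<close> because the squared increment of
  the score over a distance \<open>d\<close> is at most \<open>d\<close> times the integral of the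
  squared derivative, and \<open>d\<close> is of order \<open>1 / sqrt n\<close>.\<close>

definition intensity :: "real \<Rightarrow> (real \<Rightarrow> real) \<Rightarrow> real measure" where
  "intensity T mu = density lborel (\<lambda>t. ennreal (indicator {0..T} t * mu t))"

definition path_sum :: "(real \<Rightarrow> real) \<Rightarrow> path \<Rightarrow> real" where
  "path_sum f X = (\<Sum>i<fst X. f (snd X i))"

text \<open>A common sigma-algebra for all intensities and horizons: measurability proved once, or
  assumed under one law, transfers to every other law of the family.\<close>

abbreviation path_space :: "path measure" where
  "path_space \<equiv> count_space UNIV \<Otimes>\<^sub>M (\<Pi>\<^sub>M i\<in>UNIV. borel)"

lemma sets_intensity [simp, measurable_cong]: "sets (intensity T mu) = sets borel"
  by (simp add: intensity_def)

lemma space_intensity [simp]: "space (intensity T mu) = UNIV"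
  by (simp add: intensity_def)

lemma sets_poisson_process [measurable_cong]:
  "sets (poisson_process T mu) = sets path_space"
  unfolding poisson_process_def poisson_count_def Let_def
  by (intro sets_pair_measure_cong sets_PiM_cong) simp_all

lemma space_poisson_process [simp]: "space (poisson_process T mu) = UNIV"
  using sets_eq_imp_space_eq[OF sets_poisson_process] by (simp add: space_pair_measure space_PiM)

lemma borel_measurable_path_sum [measurable]:
  assumes [measurable]: "f \<in> borel_measurable borel"
  shows "path_sum f \<in> borel_measurable path_space"
proof -
  have "(\<lambda>X. \<Sum>i<fst X. f (snd X i)) \<in> borel_measurable path_space"
    by (rule measurable_compose_countable[where g=fst and f="\<lambda>m X. \<Sum>i<m. f (snd X i)"]) measurable
  then show ?thesis by (simp add: path_sum_def[abs_def])
qed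

section \<open>Series over the Poisson number of events\<close>

lemma poisson_count_eq_pmf:
  assumes "0 < Lam" shows "poisson_count Lam = measure_pmf (poisson_pmf Lam)"
  unfolding poisson_count_def by (subst measure_pmf_eq_density) (simp add: assms pmf_poisson less_imp_le)

lemma has_bochner_integral_poisson_count:
  fixes k :: "nat \<Rightarrow> 'a::{banach, second_countable_topology}"
  assumes "0 < Lam" and "summable (\<lambda>m. Lam ^ m / fact m * norm (k m))"
  shows "integrable (poisson_count Lam) k"
    and "(\<integral>m. k m \<partial>poisson_count Lam) = (\<Sum>m. (Lam ^ m / fact m * exp (- Lam)) *\<^sub>R k m)" (is ?th1)
proof -
  have s: "summable (\<lambda>m. norm ((Lam ^ m / fact m * exp (- Lam)) *\<^sub>R k m))"
    using summable_mult[OF assms(2), of "exp (-Lam)"] assms(1) by (simp add: mult_ac)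
  have i: "integrable (count_space UNIV) (\<lambda>m. (Lam ^ m / fact m * exp (- Lam)) *\<^sub>R k m)"
    using s by (simp add: integrable_count_space_nat_iff)
  show "integrable (poisson_count Lam) k"
    unfolding poisson_count_def using i assms(1) by (subst integrable_density) auto
  show ?th1
    unfolding poisson_count_def using i assms(1)
    by (subst integral_density) (auto simp: integral_count_space_nat)
qed

text \<open>Each moment follows from the preceding one by shifting the index, since
  \<open>m / fact m\<close> cancels one factor. Order two is what the variance formula
  needs.\<close>

lemma sums_poisson_moments:
  fixes Lam :: real
  shows "(\<lambda>m. Lam ^ m / fact m) sums exp Lam" (is ?th1)
    and "(\<lambda>m. Lam ^ m / fact m * real m) sums (Lam * exp Lam)" (is ?th2)
    and "(\<lambda>m. Lam ^ m / fact m * (real m)^2) sums ((Lam + Lam^2) * exp Lam)" (is ?th3)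
proof -
  show 0: ?th1
    using exp_converges[of Lam] by (simp add: divide_inverse mult.commute)
  have "(\<lambda>m. Lam ^ Suc m / fact (Suc m) * real (Suc m)) sums (Lam * exp Lam)"
  proof -
    have "Lam ^ Suc m / fact (Suc m) * real (Suc m) = Lam * (Lam ^ m / fact m)" for m
      by (simp add: field_simps fact_Suc del: of_nat_Suc)
    then show ?thesis using sums_mult[OF 0, of Lam] by simp
  qed
  from sums_Suc[OF this] show 1: ?th2
    by simp
  have "(\<lambda>m. Lam ^ Suc m / fact (Suc m) * (real (Suc m))^2) sums ((Lam + Lam^2) * exp Lam)"
  proof -
    have "Lam ^ Suc m / fact (Suc m) * (real (Suc m))^2 = Lam * (Lam ^ m / fact m * real m) + Lam * (Lam ^ m / fact m)" for m
    proof -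
      have "Lam ^ Suc m / fact (Suc m) * (real (Suc m))^2 = Lam * (Lam ^ m / fact m) * real (Suc m)"
        by (simp add: power2_eq_square fact_Suc del: of_nat_Suc)
      also have "\<dots> = Lam * (Lam ^ m / fact m * real m) + Lam * (Lam ^ m / fact m)"
        unfolding of_nat_Suc by (simp only: distrib_left mult_1_right mult.assoc)
      finally show ?thesis .
    qed
    then show ?thesis using sums_add[OF sums_mult[OF 1, of Lam] sums_mult[OF 0, of Lam]]
      by (simp add: algebra_simps power2_eq_square)
  qed
  from sums_Suc[OF this] show ?th3
    by simp
qed

text \<open>One term of a series of nonnegative terms is at most its sum. This is how exponential
  moments yield all polynomial ones.\<close>

lemma power_div_fact_le_exp:
  fixes x :: real
  assumes "0 \<le> x"
  shows "x ^ p / fact p \<le> exp x"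
  using sum_le_suminf[of "\<lambda>m. x ^ m / fact m" "{p}"] sums_poisson_moments(1)[of x] assms
  by (simp add: sums_iff)

text \<open>Continuity and strict positivity on the compact window give \<open>Lam > 0\<close>, so
  that division by \<open>Lam\<close> really normalises the law of an event time. In this locale
  \<open>nu\<close> is the mean measure, not a propagation speed.\<close>

locale poisson_intensity =
  fixes T :: real and mu :: "real \<Rightarrow> real"
  assumes T_pos: "0 < T" and cont_mu: "continuous_on {0..T} mu"
    and mu_pos: "\<And>t. t \<in> {0..T} \<Longrightarrow> 0 < mu t"
begin

abbreviation "Lam \<equiv> integral {0..T} mu"
abbreviation "event \<equiv> density lborel (\<lambda>t. ennreal (indicator {0..T} t * mu t / Lam))"
abbreviation "evtimes \<equiv> \<Pi>\<^sub>M i\<in>(UNIV::nat set). event"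
abbreviation "PP \<equiv> poisson_process T mu"
abbreviation "nu \<equiv> intensity T mu"

lemma mu_int: "integrable lborel (\<lambda>t. indicator {0..T} t * mu t)"
  using borel_integrable_atLeastAtMost'[OF cont_mu] by (simp add: set_integrable_def)

lemma mu_meas [measurable]: "(\<lambda>t. indicator {0..T} t * mu t) \<in> borel_measurable borel"
  using borel_measurable_integrable[OF mu_int] by simp

lemma mu_nonneg: "0 \<le> indicator {0..T} t * mu t"
  using mu_pos[of t] by (auto simp: indicator_def intro: less_imp_le)

lemma Lam_eq: "Lam = (\<integral>t. indicator {0..T} t * mu t \<partial>lborel)"
  using set_borel_integral_eq_integral(2)[OF borel_integrable_atLeastAtMost'[OF cont_mu]]
  by (simp add: set_lebesgue_integral_def)

lemma Lam_pos: "0 < Lam"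
proof -
  obtain x where x: "x \<in> {0..T}" "\<And>y. y \<in> {0..T} \<Longrightarrow> mu x \<le> mu y"
    using continuous_attains_inf[OF _ _ cont_mu] T_pos by auto
  have "0 < mu x * T" using mu_pos[OF x(1)] T_pos by simp
  also have "\<dots> = integral {0..T} (\<lambda>_. mu x)" using T_pos by simp
  also have "\<dots> \<le> Lam"
    by (intro integral_le integrable_continuous_real cont_mu x(2)) auto
  finally show ?thesis .
qed

lemma integral_nu:
  fixes g :: "real \<Rightarrow> 'b::{banach, second_countable_topology}"
  assumes [measurable]: "g \<in> borel_measurable borel"
  shows "(\<integral>t. g t \<partial>nu) = (\<integral>t. (indicator {0..T} t * mu t) *\<^sub>R g t \<partial>lborel)"
  unfolding intensity_def by (subst integral_density) (auto simp: mu_nonneg)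

lemma integral_event:
  fixes g :: "real \<Rightarrow> 'b::{banach, second_countable_topology}"
  assumes [measurable]: "g \<in> borel_measurable borel"
  shows "(\<integral>t. g t \<partial>event) = (1 / Lam) *\<^sub>R (\<integral>t. g t \<partial>nu)"
proof -
  have "(\<integral>t. g t \<partial>event) = (\<integral>t. (indicator {0..T} t * mu t / Lam) *\<^sub>R g t \<partial>lborel)"
    by (subst integral_density) (use Lam_pos in \<open>auto simp: mu_nonneg\<close>)
  also have "\<dots> = (\<integral>t. (1 / Lam) *\<^sub>R ((indicator {0..T} t * mu t) *\<^sub>R g t) \<partial>lborel)"
    by (intro Bochner_Integration.integral_cong) auto
  also have "\<dots> = (1 / Lam) *\<^sub>R (\<integral>t. g t \<partial>nu)"
    by (subst integral_scaleR_right) (auto simp: integral_nu)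
  finally show ?thesis .
qed

lemma finite_measure_nu: "finite_measure nu" and measure_nu: "measure nu UNIV = Lam"
proof -
  have "emeasure nu UNIV = ennreal Lam"
    unfolding intensity_def Lam_eq
    by (simp add: emeasure_density nn_integral_eq_integral[OF mu_int] mu_nonneg)
  then show "finite_measure nu" "measure nu UNIV = Lam"
    using Lam_pos by (auto intro!: finite_measureI simp: measure_def)
qed

sublocale nu: finite_measure nu by (rule finite_measure_nu)

lemma prob_space_event: "prob_space event"
proof (rule prob_spaceI)
  have "emeasure event (space event) = (\<integral>\<^sup>+t. ennreal (indicator {0..T} t * mu t / Lam) \<partial>lborel)"
    by (simp add: emeasure_density)
  also have "\<dots> = ennreal (\<integral>t. indicator {0..T} t * mu t / Lam \<partial>lborel)"
    using Lam_pos mu_int by (intro nn_integral_eq_integral) (auto simp: mu_nonneg)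
  also have "\<dots> = 1" using Lam_pos by (simp add: Lam_eq[symmetric])
  finally show "emeasure event (space event) = 1" .
qed

sublocale event: prob_space event by (rule prob_space_event)

lemma measure_event_UNIV [simp]: "measure event UNIV = 1"
  using event.prob_space by simp

sublocale events: product_prob_space "\<lambda>_. event" "UNIV :: nat set" ..

lemma prob_space_poisson_count: "prob_space (poisson_count Lam)"
  by (simp add: poisson_count_eq_pmf[OF Lam_pos] measure_pmf.prob_space_axioms)

sublocale count: prob_space "poisson_count Lam" by (rule prob_space_poisson_count)

sublocale proc: pair_prob_space "poisson_count Lam" "\<Pi>\<^sub>M i\<in>(UNIV::nat set). event" ..

lemma PP_eq: "PP = poisson_count Lam \<Otimes>\<^sub>M evtimes"
  by (simp add: poisson_process_def Let_def)

lemma prob_space_PP: "prob_space PP"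
  unfolding PP_eq by (rule proc.prob_space_axioms)

sublocale PP: prob_space PP by (rule prob_space_PP)

text \<open>All integrands below are bounded once the number of events is fixed, so integrability is
  a question about a numerical series only.\<close>

lemma integrable_PP_by_count:
  fixes F :: "path \<Rightarrow> 'b::{banach, second_countable_topology}"
  assumes "F \<in> borel_measurable PP" and "\<And>X. norm (F X) \<le> k (fst X)"
    and "summable (\<lambda>m. Lam ^ m / fact m * norm (k m :: real))"
  shows "integrable PP F"
proof (rule Bochner_Integration.integrable_bound)
  have "integrable (poisson_count Lam) k"
    by (rule has_bochner_integral_poisson_count(1)[OF Lam_pos assms(3)])
  then have "integrable (distr PP (poisson_count Lam) fst) k"
    unfolding PP_eq using prob_space.distr_pair_fst[OF events.P.prob_space_axioms]
    by (metis)
  then show "integrable PP (\<lambda>X. k (fst X))"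
    by (subst (asm) integrable_distr_eq) (auto simp: PP_eq poisson_count_def)
  show "AE X in PP. norm (F X) \<le> norm (k (fst X))"
    using assms(2) by (intro AE_I2) (smt (verit) norm_ge_zero real_norm_def)
qed fact

lemma integral_PP:
  fixes F :: "path \<Rightarrow> 'b::{banach, second_countable_topology}"
  assumes "integrable PP F"
  shows "(\<integral>X. F X \<partial>PP) = (\<integral>m. \<integral>Y. F (m, Y) \<partial>evtimes \<partial>poisson_count Lam)"
  using proc.integral_fst'[of F] assms unfolding PP_eq by simp

text \<open>Independence of the event times. The sequence is infinite but the product involves
  finitely many of them, so the law is first restricted to the indices in \<open>J\<close>.\<close>

lemma integral_events_prod:
  fixes g :: "nat \<Rightarrow> real \<Rightarrow> 'b::{real_normed_field, banach, second_countable_topology}"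
  assumes J: "finite J" and g: "\<And>i. i \<in> J \<Longrightarrow> integrable event (g i)"
  shows "(\<integral>Y. (\<Prod>i\<in>J. g i (Y i)) \<partial>evtimes) = (\<Prod>i\<in>J. \<integral>t. g i t \<partial>event)"
proof -
  have m: "(\<lambda>Y. \<Prod>i\<in>J. g i (Y i)) \<in> borel_measurable (\<Pi>\<^sub>M i\<in>J. event)"
  proof (rule borel_measurable_prod)
    fix i assume "i \<in> J"
    then show "(\<lambda>Y. g i (Y i)) \<in> borel_measurable (\<Pi>\<^sub>M i\<in>J. event)"
      using g by (intro measurable_compose[of "\<lambda>Y. Y i" _ event "g i", OF _ borel_measurable_integrable]) auto
  qed
  have "(\<integral>Y. (\<Prod>i\<in>J. g i (Y i)) \<partial>evtimes)
     = (\<integral>Y. (\<Prod>i\<in>J. g i (restrict Y J i)) \<partial>evtimes)"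
    by simp
  also have "\<dots> = (\<integral>Y. (\<Prod>i\<in>J. g i (Y i)) \<partial>distr evtimes (\<Pi>\<^sub>M i\<in>J. event) (\<lambda>x. restrict x J))"
    by (subst integral_distr) (use m in \<open>auto intro: measurable_restrict_subset\<close>)
  also have "\<dots> = (\<integral>Y. (\<Prod>i\<in>J. g i (Y i)) \<partial>(\<Pi>\<^sub>M i\<in>J. event))"
    by (subst events.distr_PiM_restrict_finite[OF J]) auto
  also have "\<dots> = (\<Prod>i\<in>J. \<integral>t. g i t \<partial>event)"
    by (rule events.product_integral_prod) (use J g in auto)
  finally show ?thesis .
qed

lemma integrable_event_bounded:
  fixes g :: "real \<Rightarrow> 'b::{banach, second_countable_topology}"
  assumes "g \<in> borel_measurable borel" "\<And>t. norm (g t) \<le> B"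
  shows "integrable event g"
  by (rule event.integrable_const_bound[of _ B]) (use assms in auto)

lemma integrable_nu_bounded:
  fixes g :: "real \<Rightarrow> 'b::{banach, second_countable_topology}"
  assumes "g \<in> borel_measurable borel" "\<And>t. norm (g t) \<le> B"
  shows "integrable nu g"
  by (rule nu.integrable_const_bound[of _ B]) (use assms in auto)

text \<open>Given \<open>m\<close> events, independence turns the product into the
  \<open>m\<close>-th power of the mean of \<open>g\<close> at one event, and the Poisson weights
  sum these powers to an exponential. Complex values allow the Laplace and the characteristic
  functional to be read off from the same formula.\<close>

lemma poisson_product_functional:
  fixes g :: "real \<Rightarrow> complex"
  assumes g [measurable]: "g \<in> borel_measurable borel" and B: "\<And>t. norm (g t) \<le> B"
  shows "integrable PP (\<lambda>X. \<Prod>i<fst X. g (snd X i))" (is ?th1)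
    and "(\<integral>X. (\<Prod>i<fst X. g (snd X i)) \<partial>PP) = exp (\<integral>t. (g t - 1) \<partial>nu)" (is ?th2)
proof -
  have B0: "0 \<le> B" using B[of 0] norm_ge_zero order_trans by blast
  have m: "(\<lambda>X. \<Prod>i<fst X. g (snd X i)) \<in> borel_measurable path_space"
    by (rule measurable_compose_countable[where g=fst and f="\<lambda>m X. \<Prod>i<m. g (snd X i)"]) measurable
  have s: "summable (\<lambda>m. Lam ^ m / fact m * norm (c ^ m))" for c :: "'x::real_normed_field"
    using sums_poisson_moments(1)[of "Lam * norm c"]
    by (simp add: sums_iff power_mult_distrib norm_power)
  show int: ?th1
  proof (rule integrable_PP_by_count[of _ "\<lambda>m. B ^ m"])
    show "(\<lambda>X. \<Prod>i<fst X. g (snd X i)) \<in> borel_measurable PP"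
      using m by (simp add: measurable_cong_sets[OF sets_poisson_process refl])
    show "norm (\<Prod>i<fst X. g (snd X i)) \<le> B ^ fst X" for X
    proof -
      have "norm (\<Prod>i<fst X. g (snd X i)) \<le> (\<Prod>i<fst X. B)"
        unfolding prod_norm[symmetric] by (intro prod_mono) (use B in auto)
      then show ?thesis by simp
    qed
  qed (rule s)
  define \<gamma> where "\<gamma> = (\<integral>t. g t \<partial>event)"
  have "(\<integral>X. (\<Prod>i<fst X. g (snd X i)) \<partial>PP) = (\<integral>m. \<gamma> ^ m \<partial>poisson_count Lam)"
  proof -
    have "(\<integral>Y. (\<Prod>i<m. g (Y i)) \<partial>evtimes) = \<gamma> ^ m" for m
      using integral_events_prod[of "{..<m}" "\<lambda>_. g", OF _ integrable_event_bounded[OF g B]] by (simp add: \<gamma>_def)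
    then show ?thesis unfolding integral_PP[OF int] by simp
  qed
  also have "\<dots> = (\<Sum>m. (Lam ^ m / fact m * exp (- Lam)) *\<^sub>R \<gamma> ^ m)"
    by (rule has_bochner_integral_poisson_count(2)[OF Lam_pos s])
  also have "\<dots> = (\<Sum>m. exp (- complex_of_real Lam) * ((Lam * \<gamma>) ^ m /\<^sub>R fact m))"
    by (simp add: scaleR_conv_of_real power_mult_distrib divide_simps exp_of_real[symmetric] mult_ac)
  also have "\<dots> = exp (- complex_of_real Lam) * exp (Lam * \<gamma>)"
    using exp_converges[of "Lam * \<gamma>"]
    by (subst suminf_mult) (auto simp only: sums_iff)
  also have "\<dots> = exp (Lam * \<gamma> - Lam)"
    by (simp add: exp_add[symmetric])
  also have "Lam * \<gamma> - Lam = (\<integral>t. (g t - 1) \<partial>nu)"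
  proof -
    have "(\<integral>t. (g t - 1) \<partial>nu) = (\<integral>t. g t \<partial>nu) - of_real Lam"
      by (subst Bochner_Integration.integral_diff)
         (auto intro!: integrable_nu_bounded[OF g B] simp: measure_nu scaleR_conv_of_real)
    moreover have "\<gamma> = (1 / Lam) *\<^sub>R (\<integral>t. g t \<partial>nu)"
      unfolding \<gamma>_def by (rule integral_event[OF g])
    ultimately show ?thesis using Lam_pos by (simp add: scaleR_conv_of_real)
  qed
  finally show ?th2 .
qed

lemma path_sum_measurable_PP [measurable]:
  "f \<in> borel_measurable borel \<Longrightarrow> path_sum f \<in> borel_measurable PP"
  using borel_measurable_path_sum[of f] by (simp add: measurable_cong_sets[OF sets_poisson_process refl])

lemma poisson_laplace:
  fixes f :: "real \<Rightarrow> real"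
  assumes f [measurable]: "f \<in> borel_measurable borel" and B: "\<And>t. \<bar>f t\<bar> \<le> B"
  shows "integrable PP (\<lambda>X. exp (path_sum f X))" (is ?th1)
    and "(\<integral>X. exp (path_sum f X) \<partial>PP) = exp (\<integral>t. (exp (f t) - 1) \<partial>nu)" (is ?th2)
proof -
  let ?g = "\<lambda>t. complex_of_real (exp (f t))"
  have g: "?g \<in> borel_measurable borel" and b: "norm (?g t) \<le> exp B" for t
    using B[of t] by (auto simp del: of_real_exp)
  have e: "(\<Prod>i<fst X. ?g (snd X i)) = complex_of_real (exp (path_sum f X))" for X :: path
    by (simp add: path_sum_def exp_sum flip: of_real_prod of_real_exp)
  note L = poisson_product_functional[OF g b, unfolded e]
  show ?th1
    using L(1) unfolding complex_of_real_integrable_eq .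
  have "(\<integral>t. (?g t - 1) \<partial>nu) = complex_of_real (\<integral>t. (exp (f t) - 1) \<partial>nu)"
    unfolding integral_complex_of_real[symmetric] by (intro Bochner_Integration.integral_cong) auto
  with L(2) have "complex_of_real (\<integral>X. exp (path_sum f X) \<partial>PP) = complex_of_real (exp (\<integral>t. (exp (f t) - 1) \<partial>nu))"
    unfolding integral_complex_of_real by (simp only: exp_of_real)
  then show ?th2
    by (simp only: of_real_eq_iff)
qed

lemma poisson_char:
  fixes f :: "real \<Rightarrow> real"
  assumes f [measurable]: "f \<in> borel_measurable borel"
  shows "(\<integral>X. iexp (path_sum f X) \<partial>PP) = exp (\<integral>t. (iexp (f t) - 1) \<partial>nu)"
proof -
  have e: "(\<Prod>i<fst X. iexp (f (snd X i))) = iexp (path_sum f X)" for X :: path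
    by (simp add: path_sum_def exp_sum sum_distrib_left)
  show ?thesis
    using poisson_product_functional(2)[of "\<lambda>t. iexp (f t)" 1] unfolding e by simp
qed

text \<open>Campbell's formula, by conditioning on the number of events: the variance splits into
  the spread of the event times and the spread of the count, \<open>Lam * b\<close> and
  \<open>Lam * a^2\<close>, which add up to \<open>Lam\<close> times the second moment of
  \<open>f\<close> at one event.\<close>

lemma poisson_variance:
  fixes f :: "real \<Rightarrow> real"
  assumes f [measurable]: "f \<in> borel_measurable borel" and B: "\<And>t. \<bar>f t\<bar> \<le> B"
  shows "(\<integral>X. (path_sum f X - (\<integral>t. f t \<partial>nu))^2 \<partial>PP) = (\<integral>t. (f t)^2 \<partial>nu)"
proof -
  define a where "a = (\<integral>t. f t \<partial>event)"
  define b where "b = (\<integral>t. (f t - a)^2 \<partial>event)"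
  have fi: "integrable event f" by (rule integrable_event_bounded[OF f]) (use B in auto)
  have B0: "0 \<le> B" using B[of 0] by simp
  have f2i: "integrable event (\<lambda>t. (f t)^2)"
    by (rule integrable_event_bounded[of _ "B^2"]) (use B in \<open>auto intro: power2_le_iff_abs_le[THEN iffD2] simp: B0\<close>)
  have a_nu: "(\<integral>t. f t \<partial>nu) = Lam * a"
    using integral_event[OF f] Lam_pos by (simp add: a_def)
  have b_eq: "b = (\<integral>t. (f t)^2 \<partial>event) - a^2"
    using event.variance_eq[OF fi f2i] by (simp add: b_def a_def)
  have ci: "integrable event (\<lambda>t. f t - a)" using fi by simp
  have c2i: "integrable event (\<lambda>t. (f t - a)^2)"
    by (simp add: power2_diff fi f2i)
  have c0: "(\<integral>t. f t - a \<partial>event) = 0"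
    using fi by (simp add: a_def event.prob_space)
  have cm [measurable]: "(\<lambda>t. f t - a) \<in> borel_measurable borel" by simp
  have ab: "\<bar>a\<bar> \<le> B"
  proof -
    have "\<bar>a\<bar> \<le> (\<integral>t. \<bar>f t\<bar> \<partial>event)" unfolding a_def by (rule integral_abs_bound)
    also have "\<dots> \<le> (\<integral>t. B \<partial>event)" using fi B by (intro integral_mono) auto
    finally show ?thesis by (simp add: event.prob_space)
  qed
  let ?c = "\<lambda>Y i. f (Y i) - a"
  have cb: "\<bar>f t - a\<bar> \<le> 2 * B" for t using B[of t] ab by linarith
  have pint: "integrable evtimes (\<lambda>Y. ?c Y i * ?c Y j)" and sint: "integrable evtimes (\<lambda>Y. ?c Y i)" for i j
  proof -
    have m: "(\<lambda>Y. ?c Y i) \<in> borel_measurable evtimes" for i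
      by (rule measurable_compose[of "\<lambda>Y. Y i" _ event "\<lambda>t. f t - a"]) auto
    show "integrable evtimes (\<lambda>Y. ?c Y i * ?c Y j)"
    proof (rule events.P.integrable_const_bound[of _ "(2*B)*(2*B)"])
      show "AE Y in evtimes. norm (?c Y i * ?c Y j) \<le> (2*B)*(2*B)"
        using B0 cb by (intro AE_I2) (simp only: real_norm_def abs_mult, intro mult_mono, auto)
    qed (intro borel_measurable_times m)
    show "integrable evtimes (\<lambda>Y. ?c Y i)"
      by (rule events.P.integrable_const_bound[of _ "2*B"]) (use m cb in \<open>auto\<close>)
  qed
  have pval: "(\<integral>Y. ?c Y i * ?c Y j \<partial>evtimes) = (if i = j then b else 0)" for i j
  proof (cases "i = j")
    case True
    then show ?thesis
      using integral_events_prod[of "{i}" "\<lambda>_ t. (f t - a)^2"] c2i by (simp add: b_def power2_eq_square)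
  next
    case False
    then show ?thesis
      using integral_events_prod[of "{i,j}" "\<lambda>_ t. f t - a"] ci c0 by simp
  qed
  have sval: "(\<integral>Y. ?c Y i \<partial>evtimes) = 0" for i
    using integral_events_prod[of "{i}" "\<lambda>_ t. f t - a"] ci c0 by simp
  have inner: "(\<integral>Y. (path_sum f (m, Y) - Lam * a)^2 \<partial>evtimes) = real m * b + (real m - Lam)^2 * a^2" for m
  proof -
    \<comment> \<open>Centring each event value at \<open>a\<close> makes the cross terms vanish
      under independence; what is left of the mean is the deviation of the count from
      \<open>Lam\<close>.\<close>
    have "(path_sum f (m, Y) - Lam * a)^2
       = (\<Sum>i<m. \<Sum>j<m. ?c Y i * ?c Y j) + (\<Sum>i<m. ?c Y i) * (2 * (real m - Lam) * a) + (real m - Lam)^2 * a^2" for Y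
    proof -
      have "path_sum f (m, Y) - Lam * a = (\<Sum>i<m. ?c Y i) + (real m - Lam) * a"
        by (simp add: path_sum_def sum_subtractf algebra_simps)
      moreover have "(\<Sum>i<m. \<Sum>j<m. ?c Y i * ?c Y j) = (\<Sum>i<m. ?c Y i)^2"
        by (simp add: power2_eq_square sum_product)
      ultimately show ?thesis by (simp add: power2_eq_square algebra_simps)
    qed
    then have "(\<integral>Y. (path_sum f (m, Y) - Lam * a)^2 \<partial>evtimes)
      = (\<integral>Y. (\<Sum>i<m. \<Sum>j<m. ?c Y i * ?c Y j) + (\<Sum>i<m. ?c Y i) * (2 * (real m - Lam) * a) + (real m - Lam)^2 * a^2 \<partial>evtimes)"
      by simp
    also have "\<dots> = (\<Sum>i<m. \<Sum>j<m. \<integral>Y. ?c Y i * ?c Y j \<partial>evtimes) + (\<Sum>i<m. \<integral>Y. ?c Y i \<partial>evtimes) * (2 * (real m - Lam) * a) + (real m - Lam)^2 * a^2"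
    proof -
      have 1: "integrable evtimes (\<lambda>Y. \<Sum>i<m. \<Sum>j<m. ?c Y i * ?c Y j)"
        by (intro Bochner_Integration.integrable_sum pint)
      have 2: "integrable evtimes (\<lambda>Y. (\<Sum>i<m. ?c Y i) * (2 * (real m - Lam) * a))"
        by (intro integrable_mult_left Bochner_Integration.integrable_sum sint)
      have 3: "(\<integral>Y. (\<Sum>i<m. \<Sum>j<m. ?c Y i * ?c Y j) \<partial>evtimes) = (\<Sum>i<m. \<Sum>j<m. \<integral>Y. ?c Y i * ?c Y j \<partial>evtimes)"
        by (subst Bochner_Integration.integral_sum, intro Bochner_Integration.integrable_sum pint)
           (intro sum.cong refl Bochner_Integration.integral_sum pint)
      have 4: "(\<integral>Y. (\<Sum>i<m. ?c Y i) \<partial>evtimes) = (\<Sum>i<m. \<integral>Y. ?c Y i \<partial>evtimes)"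
        by (intro Bochner_Integration.integral_sum sint)
      show ?thesis
        using 1 2 by (simp add: 3 4 events.P.prob_space)
    qed
    also have "\<dots> = real m * b + (real m - Lam)^2 * a^2"
      unfolding pval sval by (simp add: sum.delta)
    finally show ?thesis .
  qed
  \<comment> \<open>A majorant that depends on the count only, from
    \<open>(x - y)^2 <= 2 x^2 + 2 y^2\<close> and the crude bound \<open>B * m\<close> for a sum of
    \<open>m\<close> values.\<close>
  let ?k = "\<lambda>m. (2 * B^2) * (real m)^2 + 2 * (Lam * a)^2"
  let ?w = "\<lambda>m. Lam ^ m / fact m"
  have sumk: "(\<lambda>m. ?w m * ?k m) sums ((2 * B^2) * ((Lam + Lam^2) * exp Lam) + 2 * (Lam * a)^2 * exp Lam)"
    using sums_add[OF sums_mult[OF sums_poisson_moments(3)[of Lam], of "2 * B^2"] sums_mult[OF sums_poisson_moments(1)[of Lam], of "2 * (Lam * a)^2"]]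
    by (simp add: algebra_simps)
  have int: "integrable PP (\<lambda>X. (path_sum f X - Lam * a)^2)"
  proof (rule integrable_PP_by_count[of _ ?k])
    show "norm ((path_sum f X - Lam * a)^2) \<le> ?k (fst X)" for X
    proof -
      have "\<bar>path_sum f X\<bar> \<le> (\<Sum>i<fst X. \<bar>f (snd X i)\<bar>)"
        unfolding path_sum_def by (rule sum_abs)
      also have "\<dots> \<le> (\<Sum>i<fst X. B)" by (intro sum_mono B)
      finally have 1: "\<bar>path_sum f X\<bar> \<le> B * real (fst X)" by (simp add: mult.commute)
      have "(path_sum f X - Lam * a)^2 \<le> 2 * (path_sum f X)^2 + 2 * (Lam * a)^2"
        using zero_le_power2[of "path_sum f X + Lam * a"] by (simp add: power2_eq_square algebra_simps)
      moreover have "(path_sum f X)^2 \<le> (B * real (fst X))^2"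
        using 1 by (rule power2_le_iff_abs_le[THEN iffD2, rotated]) (simp add: B0)
      ultimately show ?thesis by (simp add: power_mult_distrib)
    qed
    show "summable (\<lambda>m. ?w m * norm (?k m))"
    proof -
      have "norm (?k m) = ?k m" for m by simp
      then show ?thesis using sumk by (simp add: sums_iff)
    qed
  qed measurable
  have sq: "(\<lambda>m. ?w m * (real m * b + (real m - Lam)^2 * a^2)) sums (Lam * b * exp Lam + Lam * a^2 * exp Lam)"
  proof -
    have 1: "(\<lambda>m. ?w m * real m * b) sums (Lam * exp Lam * b)"
      by (intro sums_mult2 sums_poisson_moments)
    have 2: "(\<lambda>m. (?w m * (real m)^2 - ?w m * real m * (2 * Lam) + ?w m * Lam^2) * a^2) sums
       (((Lam + Lam^2) * exp Lam - Lam * exp Lam * (2 * Lam) + exp Lam * Lam^2) * a^2)"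
      by (intro sums_mult2 sums_add sums_diff sums_poisson_moments)
    have e1: "(\<lambda>m. ?w m * (real m * b + (real m - Lam)^2 * a^2))
       = (\<lambda>m. ?w m * real m * b + (?w m * (real m)^2 - ?w m * real m * (2 * Lam) + ?w m * Lam^2) * a^2)"
      by (simp only: power2_diff algebra_simps)
    have e2: "Lam * b * exp Lam + Lam * a^2 * exp Lam = Lam * exp Lam * b
       + ((Lam + Lam^2) * exp Lam - Lam * exp Lam * (2 * Lam) + exp Lam * Lam^2) * a^2"
      by (simp add: power2_eq_square algebra_simps)
    show ?thesis unfolding e1 e2 by (rule sums_add[OF 1 2])
  qed
  have b0: "0 \<le> b" unfolding b_def by simp
  have "(\<integral>X. (path_sum f X - Lam * a)^2 \<partial>PP) = (\<integral>m. real m * b + (real m - Lam)^2 * a^2 \<partial>poisson_count Lam)"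
    unfolding integral_PP[OF int] inner ..
  also have "\<dots> = (\<Sum>m. (?w m * exp (- Lam)) *\<^sub>R (real m * b + (real m - Lam)^2 * a^2))"
    by (rule has_bochner_integral_poisson_count(2)[OF Lam_pos])
       (use sq b0 in \<open>simp add: sums_iff\<close>)
  also have "\<dots> = (\<Sum>m. exp (- Lam) * (?w m * (real m * b + (real m - Lam)^2 * a^2)))"
    by (simp add: mult_ac)
  also have "\<dots> = exp (- Lam) * (Lam * b * exp Lam + Lam * a^2 * exp Lam)"
    using sums_mult[OF sq, of "exp (-Lam)"] by (simp add: sums_iff)
  also have "\<dots> = Lam * (b + a^2)"
    by (simp add: algebra_simps exp_minus field_simps)
  also have "\<dots> = (\<integral>t. (f t)^2 \<partial>nu)"
    using integral_event[of "\<lambda>t. (f t)^2"] Lam_pos by (simp add: b_eq)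
  finally show ?thesis by (simp add: a_nu)
qed


text \<open>Centring removes the linear term of \<open>exp (s f) - 1\<close>, and the Lagrange
  remainder is quadratic in \<open>s\<close>. The restriction to \<open>s\<close> of modulus at most
  one keeps the factor \<open>exp B\<close> free of \<open>s\<close>; the intended values are plus
  and minus \<open>1 / sqrt n\<close>, for which \<open>s^2 * Lam\<close> stays bounded while
  \<open>Lam\<close> grows like \<open>n\<close>.\<close>

lemma poisson_exp_moment:
  fixes f :: "real \<Rightarrow> real"
  assumes f [measurable]: "f \<in> borel_measurable borel" and B: "\<And>t. \<bar>f t\<bar> \<le> B"
    and s: "\<bar>s\<bar> \<le> 1"
  shows "integrable PP (\<lambda>X. exp (s * (path_sum f X - (\<integral>t. f t \<partial>nu))))" (is ?th1)
    and "(\<integral>X. exp (s * (path_sum f X - (\<integral>t. f t \<partial>nu))) \<partial>PP) \<le> exp (s^2 * (B^2 * exp B) * Lam)" (is ?th2)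
proof -
  have B0: "0 \<le> B" using B[of 0] by simp
  have sB: "\<bar>s * f t\<bar> \<le> B" for t
    using mult_mono[OF s B[of t]] by (simp add: abs_mult)
  have sm: "(\<lambda>t. s * f t) \<in> borel_measurable borel" by measurable
  note L = poisson_laplace[OF sm sB]
  have ps: "path_sum (\<lambda>t. s * f t) X = s * path_sum f X" for X
    by (simp add: path_sum_def sum_distrib_left)
  have eq: "exp (s * (path_sum f X - (\<integral>t. f t \<partial>nu)))
     = exp (path_sum (\<lambda>t. s * f t) X) * exp (- s * (\<integral>t. f t \<partial>nu))" for X
    unfolding ps by (simp add: algebra_simps flip: exp_add)
  show ?th1
    unfolding eq using L(1) by (rule integrable_mult_left)
  have fi: "integrable nu f" by (rule integrable_nu_bounded[OF f]) (use B in auto)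
  have ei: "integrable nu (\<lambda>t. exp (s * f t))"
    by (rule integrable_nu_bounded[of _ "exp B"]) (use sB in \<open>auto intro: order_trans[OF abs_ge_self]\<close>)
  have "(\<integral>X. exp (s * (path_sum f X - (\<integral>t. f t \<partial>nu))) \<partial>PP)
      = exp ((\<integral>t. (exp (s * f t) - 1) \<partial>nu) - s * (\<integral>t. f t \<partial>nu))"
    unfolding eq integral_mult_left_zero L(2) exp_diff by (simp add: exp_minus divide_inverse)
  also have "(\<integral>t. (exp (s * f t) - 1) \<partial>nu) - s * (\<integral>t. f t \<partial>nu) = (\<integral>t. (exp (s * f t) - 1 - s * f t) \<partial>nu)"
    using fi ei by simp
  also have "exp \<dots> \<le> exp (\<integral>t. s^2 * (B^2 * exp B) \<partial>nu)"
    unfolding exp_le_cancel_iff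
  proof (rule integral_mono)
    show "integrable nu (\<lambda>t. exp (s * f t) - 1 - s * f t)" using fi ei by simp
    fix t
    obtain x where x: "\<bar>x\<bar> \<le> \<bar>s * f t\<bar>" "exp (s * f t) = (\<Sum>m<2. (s * f t) ^ m / fact m) + exp x / fact 2 * (s * f t) ^ 2"
      using Maclaurin_exp_le[of "s * f t" 2] by blast
    have "exp (s * f t) - 1 - s * f t = exp x / 2 * (s^2 * (f t)^2)"
      using x(2) by (simp add: numeral_2_eq_2 power_mult_distrib)
    also have "\<dots> \<le> exp B * (s^2 * B^2)"
    proof (intro mult_mono)
      have "exp x \<le> exp B" using x(1) sB[of t] by simp
      then show "exp x / 2 \<le> exp B" using exp_gt_zero[of x] by linarith
      show "(f t)^2 \<le> B^2" using B[of t] by (simp add: abs_le_square_iff[symmetric])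
    qed auto
    finally show "exp (s * f t) - 1 - s * f t \<le> s^2 * (B^2 * exp B)" by (simp add: mult_ac)
  qed auto
  also have "(\<integral>t. s^2 * (B^2 * exp B) \<partial>nu) = s^2 * (B^2 * exp B) * Lam"
    by (simp add: measure_nu)
  finally show ?th2 .
qed

text \<open>Combines \<open>x^p / p! <= exp x\<close> for the absolute value with
  \<open>exp |x| <= exp x + exp (- x)\<close>; the two signs account for the factor 2.\<close>

lemma poisson_scaled_moment:
  fixes f :: "real \<Rightarrow> real"
  assumes f [measurable]: "f \<in> borel_measurable borel" and B: "\<And>t. \<bar>f t\<bar> \<le> B"
    and n: "1 \<le> n" and H: "Lam \<le> n * H"
  shows "integrable PP (\<lambda>X. \<bar>(path_sum f X - (\<integral>t. f t \<partial>nu)) / sqrt n\<bar> ^ p)"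
    and "(\<integral>X. \<bar>(path_sum f X - (\<integral>t. f t \<partial>nu)) / sqrt n\<bar> ^ p \<partial>PP) \<le> fact p * (2 * exp (B^2 * exp B * H))"
proof -
  let ?Z = "\<lambda>X. path_sum f X - (\<integral>t. f t \<partial>nu)"
  let ?E = "\<lambda>X. exp ((1 / sqrt n) * ?Z X) + exp ((- 1 / sqrt n) * ?Z X)"
  have s: "\<bar>1 / sqrt n\<bar> \<le> 1" "\<bar>- 1 / sqrt n\<bar> \<le> 1" using n by auto
  note e1 = poisson_exp_moment[OF f B s(1)] and e2 = poisson_exp_moment[OF f B s(2)]
  have bound: "\<bar>?Z X / sqrt n\<bar> ^ p \<le> fact p * ?E X" for X
  proof -
    have "\<bar>?Z X / sqrt n\<bar> ^ p / fact p \<le> exp \<bar>?Z X / sqrt n\<bar>"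
      by (rule power_div_fact_le_exp) simp
    also have "\<dots> \<le> ?E X"
      by (auto simp: abs_if)
    finally show ?thesis by (simp only: divide_le_eq fact_gt_zero mult.commute if_True)
  qed
  have Ei: "integrable PP (\<lambda>X. fact p * ?E X)"
    by (intro integrable_mult_right Bochner_Integration.integrable_add e1(1) e2(1))
  show 1: "integrable PP (\<lambda>X. \<bar>?Z X / sqrt n\<bar> ^ p)"
    by (rule Bochner_Integration.integrable_bound[OF Ei]) (use bound in \<open>auto intro!: order_trans[OF bound]\<close>)
  have "B^2 * exp B * Lam / n \<le> B^2 * exp B * H"
  proof -
    have "B^2 * exp B * Lam \<le> B^2 * exp B * (n * H)"
      using H by (intro mult_left_mono) auto
    then show ?thesis using n by (simp add: field_simps)
  qed
  then have c: "exp ((1 / sqrt n)^2 * (B^2 * exp B) * Lam) \<le> exp (B^2 * exp B * H)"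
      "exp ((- 1 / sqrt n)^2 * (B^2 * exp B) * Lam) \<le> exp (B^2 * exp B * H)"
    using n by (auto simp: power_divide)
  have "(\<integral>X. \<bar>?Z X / sqrt n\<bar> ^ p \<partial>PP) \<le> (\<integral>X. fact p * ?E X \<partial>PP)"
    by (rule integral_mono[OF 1 Ei bound])
  also have "\<dots> = fact p * ((\<integral>X. exp ((1 / sqrt n) * ?Z X) \<partial>PP) + (\<integral>X. exp ((- 1 / sqrt n) * ?Z X) \<partial>PP))"
    by (subst integral_mult_right_zero, subst Bochner_Integration.integral_add[OF e1(1) e2(1)]) simp
  also have "\<dots> \<le> fact p * (exp (B^2 * exp B * H) + exp (B^2 * exp B * H))"
    using e1(2) e2(2) c by (intro mult_left_mono add_mono) (auto simp only: intro: order_trans fact_ge_zero)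
  finally show "(\<integral>X. \<bar>?Z X / sqrt n\<bar> ^ p \<partial>PP) \<le> fact p * (2 * exp (B^2 * exp B * H))"
    by simp
qed

end

text \<open>The logarithm of the characteristic function is an integral over a finite measure, and
  its integrand converges uniformly because \<open>f\<close> is bounded. Hence no truncation of
  Lindeberg type is involved.\<close>

lemma poisson_char_limit:
  fixes f mu :: "real \<Rightarrow> real"
  assumes I: "poisson_intensity T mu"
    and f [measurable]: "f \<in> borel_measurable borel" and B: "\<And>t. \<bar>f t\<bar> \<le> B"
  shows "(\<lambda>n. \<integral>X. iexp (s * ((path_sum f X - real n * (\<integral>t. f t \<partial>intensity T mu)) / sqrt (real n)))
            \<partial>poisson_process T (\<lambda>t. real n * mu t))
         \<longlonglongrightarrow> exp (- (s^2 / 2) * (\<integral>t. (f t)^2 \<partial>intensity T mu))"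
proof -
  interpret poisson_intensity T mu by (rule I)
  have B0: "0 \<le> B" using B[of 0] by simp
  have fi: "integrable nu f" by (rule integrable_nu_bounded[OF f]) (use B in auto)
  have f2i: "integrable nu (\<lambda>t. (f t)^2)"
    by (rule integrable_nu_bounded[of _ "B^2"]) (use B in \<open>auto simp: abs_le_square_iff[symmetric] B0\<close>)
  \<comment> \<open>The exponent contributed by time \<open>t\<close>: the factor \<open>n\<close>
    comes from the intensity, and the subtracted linear term is the centring.\<close>
  define psi where "psi n t = of_nat n * (iexp (s / sqrt (real n) * f t) - 1 - \<i> * of_real (s / sqrt (real n) * f t))" for n t
  have char: "(\<integral>X. iexp (s * ((path_sum f X - real n * (\<integral>t. f t \<partial>nu)) / sqrt (real n)))
            \<partial>poisson_process T (\<lambda>t. real n * mu t)) = exp (\<integral>t. psi n t \<partial>nu)" if n: "1 \<le> n" for n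
  proof -
    interpret N: poisson_intensity T "\<lambda>t. real n * mu t"
      using T_pos cont_mu mu_pos n by unfold_locales (auto intro!: continuous_intros)
    let ?c = "s / sqrt (real n)"
    have gm: "(\<lambda>t. ?c * f t) \<in> borel_measurable borel" by simp
    have nun: "(\<integral>t. g t \<partial>N.nu) = of_nat n * (\<integral>t. g t \<partial>nu)" if [measurable]: "g \<in> borel_measurable borel" for g :: "real \<Rightarrow> complex"
    proof -
      have "(\<integral>t. g t \<partial>N.nu) = (\<integral>t. of_nat n * ((indicator {0..T} t * mu t) *\<^sub>R g t) \<partial>lborel)"
        by (subst N.integral_nu[OF that])
           (rule Bochner_Integration.integral_cong[OF refl], simp add: scaleR_conv_of_real mult_ac)
      also have "\<dots> = of_nat n * (\<integral>t. g t \<partial>nu)"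
        by (subst integral_mult_right_zero) (simp add: integral_nu)
      finally show ?thesis .
    qed
    have ci: "integrable nu (\<lambda>t. iexp (?c * f t) - 1)"
      by (rule integrable_nu_bounded[of _ 2]) (auto intro!: order_trans[OF norm_triangle_ineq4])
    have "(\<integral>X. iexp (s * ((path_sum f X - real n * (\<integral>t. f t \<partial>nu)) / sqrt (real n))) \<partial>N.PP)
       = (\<integral>X. iexp (path_sum (\<lambda>t. ?c * f t) X) * exp (- \<i> * of_real (real n * (?c * (\<integral>t. f t \<partial>nu)))) \<partial>N.PP)"
    proof (rule Bochner_Integration.integral_cong[OF refl])
      fix X :: path
      have "s * ((path_sum f X - real n * (\<integral>t. f t \<partial>nu)) / sqrt (real n))
         = path_sum (\<lambda>t. ?c * f t) X - real n * (?c * (\<integral>t. f t \<partial>nu))"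
        by (simp only: path_sum_def sum_distrib_left[symmetric]) (simp add: field_simps diff_divide_distrib)
      then show "iexp (s * ((path_sum f X - real n * (\<integral>t. f t \<partial>nu)) / sqrt (real n)))
         = iexp (path_sum (\<lambda>t. ?c * f t) X) * exp (- \<i> * of_real (real n * (?c * (\<integral>t. f t \<partial>nu))))"
        by (simp only: of_real_diff right_diff_distrib exp_diff) (simp add: exp_minus divide_inverse)
    qed
    also have "\<dots> = exp ((\<integral>t. (iexp (?c * f t) - 1) \<partial>N.nu) - \<i> * of_real (real n * (?c * (\<integral>t. f t \<partial>nu))))"
      by (subst integral_mult_left_zero, subst N.poisson_char[OF gm]) (simp add: exp_diff exp_minus divide_inverse)
    also have "(\<integral>t. (iexp (?c * f t) - 1) \<partial>N.nu) = of_nat n * (\<integral>t. (iexp (?c * f t) - 1) \<partial>nu)"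
      by (rule nun) measurable
    also have "of_nat n * (\<integral>t. (iexp (?c * f t) - 1) \<partial>nu) - \<i> * of_real (real n * (?c * (\<integral>t. f t \<partial>nu)))
       = (\<integral>t. psi n t \<partial>nu)"
    proof -
      have fci: "integrable nu (\<lambda>t. \<i> * of_real (?c * f t))"
        using fi by (intro integrable_mult_right integrable_of_real) auto
      have "(\<integral>t. \<i> * of_real (?c * f t) \<partial>nu) = \<i> * of_real (?c * (\<integral>t. f t \<partial>nu))"
        by (subst integral_mult_right_zero, subst integral_complex_of_real) simp
      then show ?thesis
        unfolding psi_def
        by (subst integral_mult_right_zero, subst Bochner_Integration.integral_diff[OF ci fci])
           (simp add: algebra_simps)
    qed
    finally show ?thesis .
  qed
  have approx: "norm (psi n t - of_real (- (s^2 / 2) * (f t)^2)) \<le> \<bar>s\<bar> ^ 3 * B ^ 3 / sqrt (real n)" if n: "1 \<le> n" for n t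
  proof -
    let ?x = "s / sqrt (real n) * f t"
    \<comment> \<open>Third-order remainder: \<open>n\<close> times the cube of
      \<open>s f / sqrt n\<close> is of order \<open>1 / sqrt n\<close>. The denominator
      \<open>fact 3\<close> is given away.\<close>
    have "norm (iexp ?x - (\<Sum>k\<le>2. (\<i> * ?x) ^ k / fact k)) \<le> \<bar>?x\<bar> ^ Suc 2 / fact (Suc 2)"
      by (rule iexp_approx1)
    also have "\<dots> \<le> \<bar>?x\<bar> ^ Suc 2 / 1" by (intro divide_left_mono fact_ge_1) auto
    also have "\<dots> = \<bar>?x\<bar> ^ 3" unfolding div_by_1 by (simp only: numeral_3_eq_3 numeral_2_eq_2)
    finally have 1: "norm (iexp ?x - (\<Sum>k\<le>2. (\<i> * ?x) ^ k / fact k)) \<le> \<bar>?x\<bar> ^ 3" .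
    have "psi n t - of_real (- (s^2 / 2) * (f t)^2) = of_nat n * (iexp ?x - (\<Sum>k\<le>2. (\<i> * ?x) ^ k / fact k))"
    proof -
      have sq: "of_nat n * (\<i> * complex_of_real x) ^ 2 = - of_real (real n * x^2)" for x
        by (simp add: power_mult_distrib)
      have expand: "of_nat n * (iexp x - (\<Sum>k\<le>2. (\<i> * x) ^ k / fact k))
         = of_nat n * (iexp x - 1 - \<i> * of_real x) - (of_nat n * (\<i> * of_real x) ^ 2) / 2" for x
        by (simp add: numeral_2_eq_2 algebra_simps)
      have "real n * ?x^2 = s^2 * (f t)^2"
        using n by (simp add: power_mult_distrib power_divide)
      then show ?thesis
        unfolding expand[of ?x] sq[of ?x] psi_def by simp
    qed
    then have "norm (psi n t - of_real (- (s^2 / 2) * (f t)^2)) \<le> real n * \<bar>?x\<bar> ^ 3"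
      using 1 by (simp add: norm_mult mult_left_mono del: of_real_mult of_real_divide)
    also have "\<dots> \<le> real n * (\<bar>s\<bar> / sqrt (real n) * B) ^ 3"
      using B[of t] by (intro mult_left_mono power_mono) (auto simp: abs_mult intro!: mult_left_mono divide_right_mono)
    also have "\<dots> = \<bar>s\<bar> ^ 3 * B ^ 3 / sqrt (real n)"
    proof -
      have "real n = sqrt (real n) ^ 2" by simp
      then have "real n / sqrt (real n) ^ 3 = 1 / sqrt (real n)"
        using n by (simp add: power3_eq_cube field_simps)
      moreover have "real n * (\<bar>s\<bar> / sqrt (real n) * B) ^ 3 = real n / sqrt (real n) ^ 3 * (\<bar>s\<bar> ^ 3 * B ^ 3)"
        by (simp add: power_mult_distrib power_divide)
      ultimately show ?thesis by simp
    qed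
    finally show ?thesis .
  qed
  have psii: "integrable nu (psi n)" for n
    unfolding psi_def
    by (intro integrable_mult_right Bochner_Integration.integrable_diff integrable_of_real)
       (auto intro!: integrable_nu_bounded[of _ 1] fi)
  have "(\<lambda>n. \<integral>t. psi n t \<partial>nu) \<longlonglongrightarrow> of_real (- (s^2 / 2) * (\<integral>t. (f t)^2 \<partial>nu))"
  proof (rule Lim_null[THEN iffD2], rule Lim_null_comparison)
    show "(\<lambda>n. \<bar>s\<bar> ^ 3 * B ^ 3 / sqrt (real n) * Lam) \<longlonglongrightarrow> 0"
      by (intro tendsto_mult_left_zero tendsto_divide_0[OF tendsto_const] filterlim_at_top_imp_at_infinity)
         (intro filterlim_compose[OF sqrt_at_top] filterlim_real_sequentially)
    show "\<forall>\<^sub>F n in sequentially. norm ((\<integral>t. psi n t \<partial>nu) - of_real (- (s^2 / 2) * (\<integral>t. (f t)^2 \<partial>nu)))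
         \<le> \<bar>s\<bar> ^ 3 * B ^ 3 / sqrt (real n) * Lam"
      using eventually_ge_at_top[of 1]
    proof eventually_elim
      case (elim n)
      have i2: "integrable nu (\<lambda>t. complex_of_real (- (s^2 / 2) * (f t)^2))"
        using f2i by (intro integrable_of_real) auto
      have "complex_of_real (- (s^2 / 2) * (\<integral>t. (f t)^2 \<partial>nu)) = (\<integral>t. complex_of_real (- (s^2 / 2) * (f t)^2) \<partial>nu)"
        by (subst integral_complex_of_real) simp
      then have "norm ((\<integral>t. psi n t \<partial>nu) - of_real (- (s^2 / 2) * (\<integral>t. (f t)^2 \<partial>nu)))
         = norm (\<integral>t. psi n t - of_real (- (s^2 / 2) * (f t)^2) \<partial>nu)"
        by (simp only: Bochner_Integration.integral_diff[OF psii i2])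
      also have "\<dots> \<le> (\<integral>t. norm (psi n t - of_real (- (s^2 / 2) * (f t)^2)) \<partial>nu)"
        by (rule integral_norm_bound)
      also have "\<dots> \<le> (\<integral>t. \<bar>s\<bar> ^ 3 * B ^ 3 / sqrt (real n) \<partial>nu)"
        by (intro integral_mono integrable_norm Bochner_Integration.integrable_diff psii i2 approx elim) auto
      finally show ?case by (simp add: measure_nu mult_ac)
    qed
  qed
  then have "(\<lambda>n. exp (\<integral>t. psi n t \<partial>nu)) \<longlonglongrightarrow> exp (of_real (- (s^2 / 2) * (\<integral>t. (f t)^2 \<partial>nu)))"
    by (intro tendsto_exp)
  then show ?thesis
    unfolding exp_of_real
    by (rule Lim_transform_eventually)
       (rule eventually_mono[OF eventually_ge_at_top[of 1]], rule char[symmetric])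
qed

section \<open>Deterministic analysis of one detector\<close>

text \<open>Only derivatives relative to the closed interval are available for the signal, one-sided
  at the ends, and the two points come in no particular order. That the intermediate point lies
  between them is what later makes an error quadratic.\<close>

lemma mvt_within_interval:
  fixes f :: "real \<Rightarrow> real"
  assumes d: "\<And>x. x \<in> {a..b} \<Longrightarrow> (f has_real_derivative f' x) (at x within {a..b})"
    and x: "x \<in> {a..b}" and y: "y \<in> {a..b}"
  shows "\<exists>z\<in>{a..b}. z \<in> {min x y..max x y} \<and> f y - f x = f' z * (y - x)"
proof -
  have *: "\<exists>z\<in>{u..v}. f v - f u = f' z * (v - u)" if "u \<le> v" "u \<in> {a..b}" "v \<in> {a..b}" for u v
  proof (rule mvt_very_simple[of u v f "\<lambda>z. (*) (f' z)"])
    fix z assume "u \<le> z" "z \<le> v"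
    then show "(f has_derivative (*) (f' z)) (at z within {u..v})"
      using d[of z] that unfolding has_field_derivative_def
      by (auto intro: has_derivative_subset)
  qed fact
  show ?thesis
  proof (cases "x \<le> y")
    case True
    from *[OF True x y] obtain z where "z \<in> {x..y}" "f y - f x = f' z * (y - x)" by blast
    then show ?thesis using x y by (intro bexI[of _ z]) auto
  next
    case False
    with *[of y x] x y obtain z where z: "z \<in> {y..x}" "f x - f y = f' z * (x - y)" by auto
    then have "f y - f x = f' z * (y - x)" by (simp add: algebra_simps)
    then show ?thesis using x y z(1) by (intro bexI[of _ z]) auto
  qed
qed

section \<open>Convexity and entropy inequalities\<close>

lemma power_ge_tangent:
  fixes u k :: real
  assumes "0 \<le> u" "0 \<le> k" "1 \<le> p"
  shows "k ^ p + real p * k ^ (p - 1) * (u - k) \<le> u ^ p"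
proof (cases "k = 0")
  case True
  show ?thesis
  proof (cases "p = 1")
    case False
    with \<open>1 \<le> p\<close> have "0 < p - 1" "0 < p" by auto
    then have "(0::real) ^ (p - 1) = 0" "(0::real) ^ p = 0" by (metis zero_power)+
    then show ?thesis using True assms(1) by (simp only: mult_zero_left mult_zero_right add_0_left zero_le_power)
  qed (use True in simp)
next
  case False
  with assms have k: "0 < k" by simp
  have kp: "k ^ p = k * k ^ (p - 1)" using assms(3) by (cases p) auto
  \<comment> \<open>Bernoulli's inequality for the ratio \<open>u / k\<close> is the tangent
    inequality after multiplication by \<open>k ^ p\<close>; this is why \<open>k = 0\<close> is
    treated apart.\<close>
  have "-1 \<le> u / k - 1" using k assms by simp
  from Bernoulli_inequality[OF this, of p]
  have "k ^ p * (1 + real p * (u / k - 1)) \<le> k ^ p * (u / k) ^ p"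
    using k by (intro mult_left_mono) auto
  also have "\<dots> = u ^ p" using k by (simp add: power_divide)
  also have "k ^ p * (1 + real p * (u / k - 1)) = k ^ p + real p * k ^ (p - 1) * (u - k)"
    using k unfolding kp by (simp add: field_simps)
  finally show ?thesis .
qed

text \<open>Jensen's inequality: the tangent of the power at the mean \<open>k\<close> of the
  absolute value is integrated, and its linear part integrates to zero. The exponent 2 gives
  Cauchy-Schwarz with weight one.\<close>

lemma integral_power_le:
  fixes \<phi> :: "real \<Rightarrow> real"
  assumes c: "continuous_on {x..y} \<phi>" and xy: "x \<le> y" and p: "1 \<le> p"
  shows "\<bar>integral {x..y} \<phi>\<bar> ^ p \<le> (y - x) ^ (p - 1) * integral {x..y} (\<lambda>s. \<bar>\<phi> s\<bar> ^ p)"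
proof (cases "x = y")
  case True
  then show ?thesis using p by (simp add: zero_power)
next
  case False
  with xy have xy': "0 < y - x" by simp
  define J where "J = integral {x..y} (\<lambda>s. \<bar>\<phi> s\<bar>)"
  define k where "k = J / (y - x)"
  have i1: "(\<lambda>s. \<bar>\<phi> s\<bar>) integrable_on {x..y}" "\<phi> integrable_on {x..y}"
    and i2: "(\<lambda>s. \<bar>\<phi> s\<bar> ^ p) integrable_on {x..y}"
    by (intro integrable_continuous_real continuous_intros c)+
  have J: "\<bar>integral {x..y} \<phi>\<bar> \<le> J"
    unfolding J_def using integral_norm_bound_integral[OF i1(2) i1(1)] by simp
  then have J0: "0 \<le> J" by simp
  have k0: "0 \<le> k" using J0 xy' by (simp add: k_def)
  have kp: "k ^ p = k * k ^ (p - 1)" using p by (cases p) auto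
  have "(y - x) * k ^ p = integral {x..y} (\<lambda>s. k ^ p + real p * k ^ (p - 1) * (\<bar>\<phi> s\<bar> - k))"
  proof -
    have "integral {x..y} (\<lambda>s. k ^ p + real p * k ^ (p - 1) * (\<bar>\<phi> s\<bar> - k))
        = integral {x..y} (\<lambda>s. k ^ p) + real p * k ^ (p - 1) * (J - integral {x..y} (\<lambda>_. k))"
    proof -
      have d: "(\<lambda>s. \<bar>\<phi> s\<bar> - k) integrable_on {x..y}"
        by (intro integrable_continuous_real continuous_intros c)
      have "integral {x..y} (\<lambda>s. \<bar>\<phi> s\<bar> - k) = J - integral {x..y} (\<lambda>_. k)"
        unfolding J_def by (intro Henstock_Kurzweil_Integration.integral_diff i1 integrable_continuous_real continuous_intros)
      then show ?thesis
        by (subst Henstock_Kurzweil_Integration.integral_add)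
           (auto intro!: integrable_on_mult_right d)
    qed
    also have "\<dots> = (y - x) * k ^ p"
      using xy' by (simp add: k_def)
    finally show ?thesis by simp
  qed
  also have "\<dots> \<le> integral {x..y} (\<lambda>s. \<bar>\<phi> s\<bar> ^ p)"
    using k0 p by (intro integral_le i2 power_ge_tangent integrable_continuous_real continuous_intros c) auto
  finally have *: "(y - x) * k ^ p \<le> integral {x..y} (\<lambda>s. \<bar>\<phi> s\<bar> ^ p)" .
  have "\<bar>integral {x..y} \<phi>\<bar> ^ p \<le> J ^ p" by (intro power_mono J) auto
  also have "\<dots> = (y - x) ^ p * k ^ p" using xy' by (simp add: k_def power_divide)
  also have "\<dots> = (y - x) ^ (p - 1) * ((y - x) * k ^ p)"
    using p by (cases p) auto
  also have "\<dots> \<le> (y - x) ^ (p - 1) * integral {x..y} (\<lambda>s. \<bar>\<phi> s\<bar> ^ p)"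
    using * xy' by (intro mult_left_mono) auto
  finally show ?thesis .
qed

text \<open>The inequality \<open>ln u <= u - 1\<close> at \<open>u = sqrt (y / x)\<close> bounds
  the Kullback integrand below by the Hellinger one, \<open>(sqrt x - sqrt y)^2\<close>. Multiplying
  that by \<open>(sqrt x + sqrt y)^2 <= 4 H\<close> gives the squared difference.\<close>

lemma kullback_ge_square:
  fixes x y H :: real
  assumes "0 < x" "0 < y" "x \<le> H" "y \<le> H"
  shows "(x - y)^2 / (4 * H) \<le> x * (ln x - ln y) - x + y"
proof -
  have H: "0 < H" using assms by linarith
  have sx: "sqrt x * sqrt x = x" "sqrt y * sqrt y = y" using assms by auto
  have pos: "0 < sqrt x" "0 < sqrt y" using assms by auto
  have "ln (sqrt y / sqrt x) \<le> sqrt y / sqrt x - 1"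
    using pos by (intro ln_le_minus_one) auto
  then have "(ln y - ln x) / 2 \<le> sqrt y / sqrt x - 1"
    using assms by (simp add: ln_div ln_sqrt diff_divide_distrib)
  then have "x * ((ln y - ln x) / 2) \<le> x * (sqrt y / sqrt x - 1)"
    using assms by (intro mult_left_mono) auto
  also have "x * (sqrt y / sqrt x - 1) = sqrt x * sqrt y - x"
    using assms sx pos by (simp add: field_simps)
  finally have "(sqrt x - sqrt y)^2 \<le> x * (ln x - ln y) - x + y"
    using sx by (simp add: power2_eq_square algebra_simps diff_divide_distrib)
  moreover have "(x - y)^2 / (4 * H) \<le> (sqrt x - sqrt y)^2"
  proof -
    have "(x - y)^2 = (sqrt x - sqrt y)^2 * (sqrt x + sqrt y)^2"
    proof -
      have "x - y = (sqrt x - sqrt y) * (sqrt x + sqrt y)" using sx by (simp add: algebra_simps)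
      then show ?thesis by (simp add: power_mult_distrib)
    qed
    also have "\<dots> \<le> (sqrt x - sqrt y)^2 * (4 * H)"
    proof (intro mult_left_mono)
      have "(sqrt x + sqrt y)^2 \<le> 2 * x + 2 * y"
        using sx zero_le_power2[of "sqrt x - sqrt y"] by (simp add: power2_eq_square algebra_simps)
      then show "(sqrt x + sqrt y)^2 \<le> 4 * H" using assms by linarith
    qed auto
    finally show ?thesis using H by (simp add: field_simps)
  qed
  ultimately show ?thesis by linarith
qed

lemma power_add_le:
  fixes x y :: real
  assumes "0 \<le> x" "0 \<le> y"
  shows "(x + y) ^ p \<le> 2 ^ p * (x ^ p + y ^ p)"
proof -
  have "(x + y) ^ p \<le> (2 * max x y) ^ p" using assms by (intro power_mono) auto
  also have "\<dots> = 2 ^ p * max x y ^ p" by (simp add: power_mult_distrib)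
  also have "max x y ^ p \<le> x ^ p + y ^ p" using assms by (simp add: max_def)
  finally show ?thesis by simp
qed

text \<open>
  \<open>l\<close>, \<open>l1\<close>, \<open>l2\<close> are the signal and its derivatives, continued to the whole line by continuous bounded
  functions; the derivative relations are only required on the interval where the signal is given.
\<close>

locale detector =
  fixes T lam0 a b B :: real and l l1 l2 :: "real \<Rightarrow> real"
  assumes a_pos: "0 < a" and a_less_b: "a < b" and b_less_T: "b < T" and lam0_pos: "0 < lam0"
    and cont_l: "continuous_on UNIV l" and cont_l1: "continuous_on UNIV l1" and cont_l2: "continuous_on UNIV l2"
    and l_nonneg: "\<And>s. 0 \<le> l s"
    and l_le: "\<And>s. \<bar>l s\<bar> \<le> B" and l1_le: "\<And>s. \<bar>l1 s\<bar> \<le> B" and l2_le: "\<And>s. \<bar>l2 s\<bar> \<le> B"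
    and l_deriv: "\<And>x. x \<in> {- b..T - a} \<Longrightarrow> (l has_real_derivative l1 x) (at x within {- b..T - a})"
    and l1_deriv: "\<And>x. x \<in> {- b..T - a} \<Longrightarrow> (l1 has_real_derivative l2 x) (at x within {- b..T - a})"
    and l_zero: "\<And>x. x \<in> {- b..0} \<Longrightarrow> l x = 0"
    and l_pos: "\<And>x. x \<in> {0<..T - a} \<Longrightarrow> 0 < l x"
begin

section \<open>The log-likelihood integrand and its derivatives in the delay\<close>

definition h :: "real \<Rightarrow> real \<Rightarrow> real" where "h tau t = l (t - tau) + lam0"

definition g0 :: "real \<Rightarrow> real \<Rightarrow> real" where "g0 tau t = ln (1 + l (t - tau) / lam0)"
definition g1 :: "real \<Rightarrow> real \<Rightarrow> real" where "g1 tau t = - l1 (t - tau) / h tau t"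
definition g2 :: "real \<Rightarrow> real \<Rightarrow> real" where
  "g2 tau t = l2 (t - tau) / h tau t - (l1 (t - tau) / h tau t)^2"

text \<open>The compensator per unit of \<open>n\<close>. Integrating over the whole window agrees
  with integrating from \<open>tau\<close> on, since the signal vanishes at negative arguments, and
  it gives limits of integration that do not move with \<open>tau\<close>.\<close>

definition A :: "real \<Rightarrow> real" where "A tau = integral {0..T} (\<lambda>t. l (t - tau))"

text \<open>A common bound for \<open>g1\<close> and \<open>g2\<close>: the ratios of
  \<open>l1\<close> and \<open>l2\<close> to \<open>h\<close> are at most \<open>B / lam0\<close>,
  and \<open>g2\<close> contains one of them squared.\<close>

definition D :: real where "D = B / lam0 + (B / lam0)^2"

lemma T_pos: "0 < T" using a_pos a_less_b b_less_T by linarith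
lemma B_nonneg: "0 \<le> B" using l_le[of 0] by linarith
lemma D_nonneg: "0 \<le> D" using B_nonneg lam0_pos by (simp add: D_def)

lemma h_ge: "lam0 \<le> h tau t" using l_nonneg by (simp add: h_def)
lemma h_pos: "0 < h tau t" using h_ge lam0_pos by (rule less_le_trans[rotated])
lemma h_le: "h tau t \<le> B + lam0" using l_le[of "t - tau"] by (simp add: h_def)

lemma cont_comp:
  assumes "continuous_on S f" "continuous_on S g"
  shows "continuous_on S (\<lambda>x. l (f x - g x))" "continuous_on S (\<lambda>x. l1 (f x - g x))"
     "continuous_on S (\<lambda>x. l2 (f x - g x))"
  using assms by (auto intro!: continuous_on_compose2[OF cont_l] continuous_on_compose2[OF cont_l1]
    continuous_on_compose2[OF cont_l2] continuous_intros)

lemma cont_h [continuous_intros]: "continuous_on S f \<Longrightarrow> continuous_on S g \<Longrightarrow> continuous_on S (\<lambda>x. h (g x) (f x))"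
  unfolding h_def by (intro continuous_intros cont_comp)

lemma cont_g0 [continuous_intros]: "continuous_on S f \<Longrightarrow> continuous_on S g \<Longrightarrow> continuous_on S (\<lambda>x. g0 (g x) (f x))"
proof -
  have "1 + l s / lam0 \<noteq> 0" for s
    using l_nonneg[of s] lam0_pos by (smt (verit) divide_nonneg_pos)
  then show "continuous_on S f \<Longrightarrow> continuous_on S g \<Longrightarrow> continuous_on S (\<lambda>x. g0 (g x) (f x))"
    unfolding g0_def using lam0_pos by (intro continuous_intros cont_comp) auto
qed

lemma cont_g1 [continuous_intros]: "continuous_on S f \<Longrightarrow> continuous_on S g \<Longrightarrow> continuous_on S (\<lambda>x. g1 (g x) (f x))"
  unfolding g1_def using h_pos by (intro continuous_intros cont_comp) (auto simp: less_imp_neq[symmetric])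

lemma cont_g2 [continuous_intros]: "continuous_on S f \<Longrightarrow> continuous_on S g \<Longrightarrow> continuous_on S (\<lambda>x. g2 (g x) (f x))"
  unfolding g2_def using h_pos by (intro continuous_intros cont_comp) (auto simp: less_imp_neq[symmetric])

lemma ratio_le:
  assumes "\<bar>x\<bar> \<le> B" shows "\<bar>x / h tau t\<bar> \<le> B / lam0"
  using assms h_ge[of tau t] h_pos[of tau t] lam0_pos B_nonneg
  by (simp add: abs_mult frac_le)

lemma g1_le: "\<bar>g1 tau t\<bar> \<le> D"
  using ratio_le[of "- l1 (t - tau)" tau t] l1_le[of "t - tau"] unfolding g1_def D_def
  by (simp add: add_increasing2)

lemma g2_le: "\<bar>g2 tau t\<bar> \<le> D"
proof -
  have "\<bar>l2 (t - tau) / h tau t\<bar> \<le> B / lam0" by (rule ratio_le[OF l2_le])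
  moreover have "(l1 (t - tau) / h tau t)^2 \<le> (B / lam0)^2"
    using ratio_le[OF l1_le[of "t - tau"], of tau t] B_nonneg lam0_pos by (intro abs_le_square_iff[THEN iffD1]) auto
  ultimately show ?thesis unfolding g2_def D_def
    using zero_le_power2[of "l1 (t - tau) / h tau t"] by linarith
qed

lemma shift_deriv:
  assumes t: "t \<in> {0..T}" and tau: "tau \<in> {a..b}"
  shows "((\<lambda>tau. l (t - tau)) has_real_derivative - l1 (t - tau)) (at tau within {a..b})" (is ?th1)
    and "((\<lambda>tau. l1 (t - tau)) has_real_derivative - l2 (t - tau)) (at tau within {a..b})" (is ?th2)
    and "((\<lambda>t. l (t - tau)) has_real_derivative l1 (t - tau)) (at t within {0..T})" (is ?th3)
proof -
  have s: "t - tau \<in> {- b..T - a}" using t tau by auto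
  have d1: "((\<lambda>tau. t - tau) has_real_derivative -1) (at tau within {a..b})"
    by (auto intro!: derivative_eq_intros)
  have d2: "((\<lambda>t. t - tau) has_real_derivative 1) (at t within {0..T})"
    by (auto intro!: derivative_eq_intros)
  have sub1: "(\<lambda>tau. t - tau) ` {a..b} \<subseteq> {- b..T - a}" and sub2: "(\<lambda>t. t - tau) ` {0..T} \<subseteq> {- b..T - a}"
    using t tau by auto
  show ?th1
    using DERIV_image_chain[OF DERIV_subset[OF l_deriv[OF s] sub1] d1] by (simp add: o_def)
  show ?th2
    using DERIV_image_chain[OF DERIV_subset[OF l1_deriv[OF s] sub1] d1] by (simp add: o_def)
  show ?th3
    using DERIV_image_chain[OF DERIV_subset[OF l_deriv[OF s] sub2] d2] by (simp add: o_def)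
qed

lemma g_deriv:
  assumes t: "t \<in> {0..T}" and tau: "tau \<in> {a..b}"
  shows "((\<lambda>tau. g0 tau t) has_real_derivative g1 tau t) (at tau within {a..b})" (is ?th1)
    and "((\<lambda>tau. g1 tau t) has_real_derivative g2 tau t) (at tau within {a..b})" (is ?th2)
proof -
  have p: "0 < 1 + l (t - tau) / lam0"
    using l_nonneg[of "t - tau"] lam0_pos by (simp add: add_pos_nonneg)
  have hp: "h tau t \<noteq> 0" using h_pos[of tau t] by simp
  have "((\<lambda>tau. ln (1 + l (t - tau) / lam0)) has_real_derivative
      inverse (1 + l (t - tau) / lam0) * (- l1 (t - tau) / lam0)) (at tau within {a..b})"
    using p lam0_pos by (auto intro!: derivative_eq_intros shift_deriv[OF t tau] simp: divide_inverse)
  moreover have "inverse (1 + l (t - tau) / lam0) * (- l1 (t - tau) / lam0) = g1 tau t"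
    using lam0_pos hp unfolding g1_def h_def by (simp add: field_simps)
  ultimately show ?th1
    unfolding g0_def by simp
  have dh: "((\<lambda>tau. h tau t) has_real_derivative - l1 (t - tau)) (at tau within {a..b})"
    unfolding h_def by (auto intro!: derivative_eq_intros shift_deriv[OF t tau])
  have "((\<lambda>tau. - l1 (t - tau) / h tau t) has_real_derivative
      (l2 (t - tau) * h tau t - (- l1 (t - tau)) * (- l1 (t - tau))) / (h tau t * h tau t)) (at tau within {a..b})"
    using DERIV_divide[OF DERIV_minus[OF shift_deriv(2)[OF t tau]] dh hp] by simp
  moreover have "(l2 (t - tau) * h tau t - (- l1 (t - tau)) * (- l1 (t - tau))) / (h tau t * h tau t) = g2 tau t"
    using hp unfolding g2_def by (simp add: field_simps power2_eq_square)
  ultimately show ?th2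
    unfolding g1_def by simp
qed

text \<open>On the nondegenerate interval from \<open>- b\<close> to 0 the signal is constantly
  zero, and the derivative within that interval is unique. This includes the argument 0, where it is
  a left derivative.\<close>

lemma l1_zero: assumes "tau \<in> {a..b}" "t \<in> {0..tau}" shows "l1 (t - tau) = 0"
proof -
  let ?x = "t - tau"
  have x: "?x \<in> {- b..0}" using assms by auto
  have b0: "- b < 0" using a_pos a_less_b by linarith
  have xx: "?x \<in> {- b..T - a}" using x a_less_b b_less_T by auto
  have 1: "(l has_real_derivative l1 ?x) (at ?x within {- b..0})"
    using a_less_b b_less_T by (intro DERIV_subset[OF l_deriv[OF xx]]) auto
  have 2: "(l has_real_derivative 0) (at ?x within {- b..0})"
  proof (rule has_field_derivative_transform_within[of "\<lambda>_. 0" _ _ _ 1])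
    show "((\<lambda>_. 0) has_real_derivative 0) (at ?x within {- b..0})" by simp
  qed (use x l_zero in auto)
  have "at ?x within {- b..0} \<noteq> bot"
    using x b0 by (simp add: trivial_limit_within islimpt_Icc del: at_within_eq_bot_iff)
  then show ?thesis using has_field_derivative_unique[OF 1 2] by blast
qed

lemma lam_integral: assumes tau: "tau \<in> {a..b}" shows "integral {tau..T} (\<lambda>t. l (t - tau)) = A tau"
proof -
  have i: "(\<lambda>t. l (t - tau)) integrable_on {0..T}"
    by (intro integrable_continuous_real cont_comp continuous_intros)
  have "integral {0..tau} (\<lambda>t. l (t - tau)) = integral {0..tau} (\<lambda>t. 0)"
    using tau by (intro integral_cong l_zero) auto
  then show ?thesis
    using Henstock_Kurzweil_Integration.integral_combine[where a=0 and c=tau and b=T and f="\<lambda>t. l (t - tau)"] i tau a_pos b_less_T by (simp add: A_def)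
qed

text \<open>In this form the Fisher information is the integral of the squared score integrand
  against the intensity, that is, the variance that Campbell's formula produces.\<close>

lemma fisher_eq: assumes tau: "tau \<in> {a..b}"
  shows "fisher_delay T lam0 l l1 tau = integral {0..T} (\<lambda>t. (g1 tau t)^2 * h tau t)"
proof -
  have i: "(\<lambda>t. (g1 tau t)^2 * h tau t) integrable_on {0..T}"
    by (intro integrable_continuous_real continuous_intros)
  have "integral {0..tau} (\<lambda>t. (g1 tau t)^2 * h tau t) = integral {0..tau} (\<lambda>t. 0)"
    using tau by (intro integral_cong) (simp add: g1_def l1_zero)
  then have "integral {0..T} (\<lambda>t. (g1 tau t)^2 * h tau t) = integral {tau..T} (\<lambda>t. (g1 tau t)^2 * h tau t)"
    using Henstock_Kurzweil_Integration.integral_combine[where a=0 and c=tau and b=T and f="\<lambda>t. (g1 tau t)^2 * h tau t"] i tau a_pos b_less_T by simp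
  also have "\<dots> = fisher_delay T lam0 l l1 tau"
    unfolding fisher_delay_def using h_pos[of tau]
    by (intro integral_cong) (simp add: g1_def h_def power_divide power2_eq_square less_imp_neq[symmetric])
  finally show ?thesis by simp
qed

section \<open>Mean functions, identifiability and the drift of the score\<close>

abbreviation "fisher \<equiv> fisher_delay T lam0 l l1"

text \<open>Up to the factor \<open>n\<close>, \<open>m0\<close>, \<open>m1\<close> and
  \<open>m2\<close> are the means under the true delay \<open>ts\<close> of the path sums of
  \<open>g0\<close>, \<open>g1\<close> and \<open>g2\<close> taken at the delay
  \<open>tau\<close>.\<close>

definition m0 :: "real \<Rightarrow> real \<Rightarrow> real" where "m0 ts tau = integral {0..T} (\<lambda>t. g0 tau t * h ts t)"
definition m1 :: "real \<Rightarrow> real \<Rightarrow> real" where "m1 ts tau = integral {0..T} (\<lambda>t. g1 tau t * h ts t)"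
definition m2 :: "real \<Rightarrow> real \<Rightarrow> real" where "m2 ts tau = integral {0..T} (\<lambda>t. g2 tau t * h ts t)"

lemma m_deriv:
  assumes tau: "tau \<in> {a..b}"
  shows "(m0 ts has_real_derivative m1 ts tau) (at tau within {a..b})" (is ?th1)
    and "(m1 ts has_real_derivative m2 ts tau) (at tau within {a..b})" (is ?th2)
    and "(A has_real_derivative (- l (T - tau))) (at tau within {a..b})" (is ?th3)
proof -
  note L = leibniz_rule_field_derivative[of "{a..b}" 0 T, OF _ _ _ tau, unfolded cbox_interval]
  show ?th1
    unfolding m0_def[abs_def] m1_def
    by (rule L) (auto intro!: g_deriv DERIV_cmult_right integrable_continuous_real continuous_intros simp: split_beta)
  show ?th2
    unfolding m1_def[abs_def] m2_def
    by (rule L) (auto intro!: g_deriv DERIV_cmult_right integrable_continuous_real continuous_intros simp: split_beta)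
  have "(A has_real_derivative integral {0..T} (\<lambda>t. - l1 (t - tau))) (at tau within {a..b})"
    unfolding A_def[abs_def]
    by (rule L) (auto intro!: shift_deriv integrable_continuous_real cont_comp continuous_intros simp: split_beta)
  moreover have "((\<lambda>t. l1 (t - tau)) has_integral (l (T - tau) - l (0 - tau))) {0..T}"
    using T_pos shift_deriv(3)[OF _ tau]
    by (intro fundamental_theorem_of_calculus) (auto simp: has_real_derivative_iff_has_vector_derivative[symmetric])
  then have "integral {0..T} (\<lambda>t. - l1 (t - tau)) = - l (T - tau)"
    using l_zero[of "- tau"] tau a_pos by (simp add: integral_unique)
  ultimately show ?th3 by simp
qed

text \<open>The score has mean zero at the true delay: the fundamental theorem applied to the
  signal, which starts from zero, cancels the derivative of the compensator.\<close>

lemma l_end: assumes tau: "tau \<in> {a..b}" shows "l (T - tau) = - integral {0..T} (\<lambda>t. g1 tau t * h tau t)"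
proof -
  have "((\<lambda>t. l1 (t - tau)) has_integral (l (T - tau) - l (0 - tau))) {0..T}"
    using T_pos shift_deriv(3)[OF _ tau]
    by (intro fundamental_theorem_of_calculus) (auto simp: has_real_derivative_iff_has_vector_derivative[symmetric])
  moreover have "g1 tau t * h tau t = - l1 (t - tau)" for t
    using h_pos[of tau t] by (simp add: g1_def)
  ultimately show ?thesis
    using l_zero[of "- tau"] tau a_pos by (simp add: integral_unique)
qed

text \<open>At the end of the window the signal has been on for at least \<open>T - b > 0\<close>,
  so compactness gives a uniform bound. Both the nondegeneracy of the information and the contrast
  bound below rest on this constant.\<close>

lemma l_end_pos: "\<exists>m>0. \<forall>tau\<in>{a..b}. m \<le> l (T - tau)"
proof -
  have "continuous_on {a..b} (\<lambda>tau. l (T - tau))" by (intro cont_comp continuous_intros)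
  then obtain x where "x \<in> {a..b}" "\<forall>tau\<in>{a..b}. l (T - x) \<le> l (T - tau)"
    using continuous_attains_inf[of "{a..b}" "\<lambda>tau. l (T - tau)"] a_less_b by auto
  moreover from this(1) have "0 < l (T - x)" using l_pos[of "T - x"] b_less_T by auto
  ultimately show ?thesis by blast
qed

text \<open>By \<open>l_end\<close> the number \<open>l (T - tau)\<close> is an integral of
  \<open>g1 * h\<close>; Cauchy-Schwarz with weight one and \<open>h <= B + lam0\<close> compare its
  square with the information.\<close>

lemma fisher_ge: "\<exists>c>0. \<forall>tau\<in>{a..b}. c \<le> fisher tau"
proof -
  obtain m where m: "0 < m" "\<And>tau. tau \<in> {a..b} \<Longrightarrow> m \<le> l (T - tau)" using l_end_pos by blast
  let ?H = "B + lam0"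
  have H: "0 < ?H" using B_nonneg lam0_pos by linarith
  have "m^2 / (T * ?H) \<le> fisher tau" if tau: "tau \<in> {a..b}" for tau
  proof -
    have c: "continuous_on {0..T} (\<lambda>t. g1 tau t * h tau t)" by (intro continuous_intros)
    have "m^2 \<le> \<bar>l (T - tau)\<bar>^2" using m(2)[OF tau] m(1) by (intro power_mono) auto
    also have "\<dots> \<le> T * integral {0..T} (\<lambda>t. \<bar>g1 tau t * h tau t\<bar>^2)"
      using integral_power_le[OF c, of 2] T_pos by (simp add: l_end[OF tau])
    also have "integral {0..T} (\<lambda>t. \<bar>g1 tau t * h tau t\<bar>^2) \<le> integral {0..T} (\<lambda>t. ?H * ((g1 tau t)^2 * h tau t))"
    proof (intro integral_le integrable_continuous_real continuous_intros)
      fix t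
      have "\<bar>g1 tau t * h tau t\<bar>^2 = h tau t * ((g1 tau t)^2 * h tau t)" by (simp add: power2_eq_square)
      also have "\<dots> \<le> ?H * ((g1 tau t)^2 * h tau t)"
        using h_le[of tau t] h_pos[of tau t] by (intro mult_right_mono) auto
      finally show "\<bar>g1 tau t * h tau t\<bar>^2 \<le> ?H * ((g1 tau t)^2 * h tau t)" .
    qed
    also have "integral {0..T} (\<lambda>t. ?H * ((g1 tau t)^2 * h tau t)) = ?H * fisher tau"
      by (simp add: fisher_eq[OF tau])
    finally have "m^2 \<le> T * (?H * fisher tau)" using T_pos by simp
    then show ?thesis using mult_pos_pos[OF T_pos H] by (simp add: divide_le_eq mult_ac)
  qed
  then show ?thesis using m(1) T_pos H by (intro exI[of _ "m^2 / (T * ?H)"]) auto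
qed

lemma fisher_le: assumes "tau \<in> {a..b}" shows "fisher tau \<le> D^2 * (B + lam0) * T"
proof -
  have "fisher tau \<le> integral {0..T} (\<lambda>t. D^2 * (B + lam0))"
    unfolding fisher_eq[OF assms]
  proof (intro integral_le integrable_continuous_real continuous_intros mult_mono)
    fix t show "(g1 tau t)^2 \<le> D^2" using g1_le[of tau t] D_nonneg by (intro abs_le_square_iff[THEN iffD1]) auto
    show "h tau t \<le> B + lam0" by (rule h_le)
  qed (use h_pos[of tau] in \<open>auto intro: less_imp_le\<close>)
  then show ?thesis using T_pos by (simp add: mult_ac)
qed

lemma contrast: "\<exists>c>0. \<forall>ts\<in>{a..b}. \<forall>tau\<in>{a..b}. c * (tau - ts)^2 \<le> (m0 ts ts - A ts) - (m0 ts tau - A tau)"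
proof -
  obtain m where m: "0 < m" "\<And>tau. tau \<in> {a..b} \<Longrightarrow> m \<le> l (T - tau)" using l_end_pos by blast
  let ?H = "B + lam0"
  have H: "0 < ?H" using B_nonneg lam0_pos by linarith
  have "m^2 / (4 * ?H * T) * (tau - ts)^2 \<le> (m0 ts ts - A ts) - (m0 ts tau - A tau)"
    if ts: "ts \<in> {a..b}" and tau: "tau \<in> {a..b}" for ts tau
  proof -
    \<comment> \<open>The derivative of the total intensity in the delay is
      \<open>- l (T - z)\<close>, whose modulus is at least \<open>m\<close>: a change of delay is
      visible already in the expected number of events.\<close>
    obtain z where z: "z \<in> {a..b}" "A tau - A ts = - l (T - z) * (tau - ts)"
      using mvt_within_interval[of a b A "\<lambda>z. - l (T - z)", OF m_deriv(3) ts tau] by blast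
    let ?w = "\<lambda>t. h ts t - h tau t"
    have cw: "continuous_on {0..T} ?w" by (intro continuous_intros)
    have iw: "integral {0..T} ?w = A ts - A tau"
    proof -
      have "integral {0..T} ?w = integral {0..T} (\<lambda>t. l (t - ts) - l (t - tau))" by (simp add: h_def)
      also have "\<dots> = A ts - A tau" unfolding A_def
        by (intro Henstock_Kurzweil_Integration.integral_diff integrable_continuous_real cont_comp continuous_intros)
      finally show ?thesis .
    qed
    have "m^2 * (tau - ts)^2 \<le> (l (T - z))^2 * (tau - ts)^2"
      using m z(1) by (intro mult_right_mono power_mono) auto
    also have "\<dots> = \<bar>integral {0..T} ?w\<bar>^2"
      using z(2) unfolding iw power2_abs by (metis minus_diff_eq power2_minus power_mult_distrib)
    also have "\<dots> \<le> T * integral {0..T} (\<lambda>t. \<bar>?w t\<bar>^2)"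
      using integral_power_le[OF cw, of 2] T_pos by simp
    finally have 1: "m^2 * (tau - ts)^2 \<le> T * integral {0..T} (\<lambda>t. (?w t)^2)" by simp
    have "integral {0..T} (\<lambda>t. (?w t)^2) / (4 * ?H) = integral {0..T} (\<lambda>t. (?w t)^2 / (4 * ?H))"
      by simp
    also have "\<dots> \<le> integral {0..T} (\<lambda>t. g0 ts t * h ts t - l (t - ts) - (g0 tau t * h ts t - l (t - tau)))"
    proof (intro integral_le integrable_continuous_real continuous_intros cont_comp)
      fix t
      have g: "g0 x t = ln (h x t) - ln lam0" for x
      proof -
        have "1 + l (t - x) / lam0 = h x t / lam0" using lam0_pos by (simp add: h_def field_simps)
        then show ?thesis unfolding g0_def using h_pos[of x t] lam0_pos by (simp add: ln_div)
      qed
      have "(?w t)^2 / (4 * ?H) \<le> h ts t * (ln (h ts t) - ln (h tau t)) - h ts t + h tau t"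
        by (rule kullback_ge_square[OF h_pos h_pos h_le h_le])
      also have "\<dots> = g0 ts t * h ts t - l (t - ts) - (g0 tau t * h ts t - l (t - tau))"
        unfolding g by (simp add: h_def algebra_simps)
      finally show "(?w t)^2 / (4 * ?H) \<le> g0 ts t * h ts t - l (t - ts) - (g0 tau t * h ts t - l (t - tau))" .
    qed (use H in auto)
    also have "\<dots> = (m0 ts ts - A ts) - (m0 ts tau - A tau)"
    proof -
      have i: "(\<lambda>t. g0 x t * h ts t) integrable_on {0..T}" "(\<lambda>t. l (t - x)) integrable_on {0..T}" for x
        by (intro integrable_continuous_real continuous_intros cont_comp)+
      show ?thesis unfolding m0_def A_def
        by (simp add: Henstock_Kurzweil_Integration.integral_diff[OF integrable_diff[OF i] integrable_diff[OF i]] Henstock_Kurzweil_Integration.integral_diff[OF i])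
    qed
    finally have 2: "integral {0..T} (\<lambda>t. (?w t)^2) / (4 * ?H) \<le> (m0 ts ts - A ts) - (m0 ts tau - A tau)" .
    have "m^2 / (4 * ?H * T) * (tau - ts)^2 = m^2 * (tau - ts)^2 / T / (4 * ?H)" by simp
    also have "\<dots> \<le> integral {0..T} (\<lambda>t. (?w t)^2) / (4 * ?H)"
      using 1 T_pos H by (intro divide_right_mono) (simp_all add: field_simps)
    finally show ?thesis using 2 by simp
  qed
  then show ?thesis using m(1) T_pos H by (intro exI[of _ "m^2 / (4 * ?H * T)"]) auto
qed

text \<open>By \<open>l_end\<close> the mean of the normalised score at \<open>tau\<close> is the
  integral of \<open>g1 tau * (h ts - h tau)\<close>. Since one factor already vanishes at
  \<open>tau = ts\<close>, first-order expansion of both factors gives a quadratic error, and two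
  derivatives of the signal suffice.\<close>

lemma score_drift:
  assumes ts: "ts \<in> {a..b}" and tau: "tau \<in> {a..b}"
  shows "\<bar>m1 ts tau + l (T - tau) + (tau - ts) * fisher ts\<bar> \<le> 2 * B * D * T * (tau - ts)^2"
proof -
  let ?e = "\<lambda>t. g1 tau t * (h ts t - h tau t) + (tau - ts) * ((g1 ts t)^2 * h ts t)"
  have ptw: "\<bar>?e t\<bar> \<le> 2 * B * D * (tau - ts)^2" if t: "t \<in> {0..T}" for t
  proof -
    let ?d = "tau - ts"
    \<comment> \<open>The signal is expanded at an intermediate \<open>z\<close>, then
      \<open>l1\<close> is moved from \<open>z\<close> to \<open>ts\<close> and \<open>g1\<close>
      from \<open>tau\<close> to \<open>ts\<close>. The last two moves each cost at most
      \<open>B * D * (tau - ts)^2\<close>, which explains the constant.\<close>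
    obtain z where z: "z \<in> {a..b}" "z \<in> {min tau ts..max tau ts}" "l (t - ts) - l (t - tau) = - l1 (t - z) * (ts - tau)"
      using mvt_within_interval[OF shift_deriv(1)[OF t] tau ts] by blast
    obtain y where y: "y \<in> {a..b}" "l1 (t - z) - l1 (t - ts) = - l2 (t - y) * (z - ts)"
      using mvt_within_interval[OF shift_deriv(2)[OF t] ts z(1)] by blast
    obtain x where x: "x \<in> {a..b}" "g1 tau t - g1 ts t = g2 x t * (tau - ts)"
      using mvt_within_interval[OF g_deriv(2)[OF t] ts tau] by blast
    have zts: "\<bar>z - ts\<bar> \<le> \<bar>?d\<bar>"
      using z(2) by (auto simp: min_def max_def split: if_splits)
    have e1: "h ts t - h tau t = ?d * l1 (t - ts) + ?d * (l1 (t - z) - l1 (t - ts))"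
      using z(3) by (simp add: h_def algebra_simps)
    have e2: "l1 (t - ts) = - g1 ts t * h ts t"
      using h_pos[of ts t] by (simp add: g1_def)
    have "?e t = g1 tau t * ?d * (l1 (t - z) - l1 (t - ts)) + ?d * l1 (t - ts) * (g1 tau t - g1 ts t)"
      unfolding e1 using e2 by (simp add: power2_eq_square algebra_simps)
    also have "\<bar>\<dots>\<bar> \<le> \<bar>g1 tau t * ?d * (l1 (t - z) - l1 (t - ts))\<bar> + \<bar>?d * l1 (t - ts) * (g1 tau t - g1 ts t)\<bar>"
      by (rule abs_triangle_ineq)
    also have "\<dots> \<le> D * \<bar>?d\<bar> * (B * \<bar>?d\<bar>) + \<bar>?d\<bar> * B * (D * \<bar>?d\<bar>)"
    proof (intro add_mono)
      have "\<bar>l1 (t - z) - l1 (t - ts)\<bar> \<le> B * \<bar>?d\<bar>"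
        unfolding y(2) abs_mult abs_minus_cancel using zts l2_le B_nonneg by (intro mult_mono) auto
      then show "\<bar>g1 tau t * ?d * (l1 (t - z) - l1 (t - ts))\<bar> \<le> D * \<bar>?d\<bar> * (B * \<bar>?d\<bar>)"
        unfolding abs_mult using g1_le[of tau t] D_nonneg by (intro mult_mono) auto
      have "\<bar>g1 tau t - g1 ts t\<bar> \<le> D * \<bar>?d\<bar>"
        unfolding x(2) abs_mult using g2_le D_nonneg by (intro mult_mono) auto
      then show "\<bar>?d * l1 (t - ts) * (g1 tau t - g1 ts t)\<bar> \<le> \<bar>?d\<bar> * B * (D * \<bar>?d\<bar>)"
        unfolding abs_mult using l1_le B_nonneg by (intro mult_mono) auto
    qed
    also have "\<dots> = 2 * B * D * ?d^2"
      by (simp add: power2_eq_square)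
    finally show ?thesis .
  qed
  have ie: "?e integrable_on {0..T}" by (intro integrable_continuous_real continuous_intros)
  have e_int: "m1 ts tau + l (T - tau) + (tau - ts) * fisher ts = integral {0..T} ?e"
  proof -
    have i: "(\<lambda>t. g1 tau t * h x t) integrable_on {0..T}" for x
      by (intro integrable_continuous_real continuous_intros)
    have j: "(\<lambda>t. (g1 ts t)^2 * h ts t) integrable_on {0..T}"
      by (intro integrable_continuous_real continuous_intros)
    have "integral {0..T} ?e = integral {0..T} (\<lambda>t. (g1 tau t * h ts t - g1 tau t * h tau t) + (tau - ts) * ((g1 ts t)^2 * h ts t))"
      by (simp add: algebra_simps)
    also have "\<dots> = (m1 ts tau - integral {0..T} (\<lambda>t. g1 tau t * h tau t)) + (tau - ts) * fisher ts"
      unfolding m1_def fisher_eq[OF ts]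
      by (subst Henstock_Kurzweil_Integration.integral_add, intro integrable_diff i, intro integrable_on_mult_right j, subst Henstock_Kurzweil_Integration.integral_diff[OF i i]) simp
    finally show ?thesis using l_end[OF tau] by simp
  qed
  have "\<bar>integral {0..T} ?e\<bar> \<le> integral {0..T} (\<lambda>t. 2 * B * D * (tau - ts)^2)"
    unfolding real_norm_def[symmetric]
    using ptw by (intro integral_norm_bound_integral ie integrable_continuous_real continuous_intros) auto
  also have "integral {0..T} (\<lambda>t. 2 * B * D * (tau - ts)^2) = T * (2 * B * D * (tau - ts)^2)"
    using T_pos by simp
  finally show ?thesis unfolding e_int by (simp only: mult_ac)
qed

lemma continuous_on_fisher: "continuous_on {a..b} fisher"
proof -
  have "continuous_on {a..b} (\<lambda>tau. integral (cbox 0 T) (\<lambda>t. (g1 tau t)^2 * h tau t))"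
    by (rule integral_continuous_on_param) (auto intro!: continuous_intros simp: split_beta)
  then show ?thesis by (rule continuous_on_eq) (simp add: fisher_eq)
qed

text \<open>
  Cutting off outside \<open>[0, T]\<close> makes the likelihood formula hold for every path, and not only for
  those whose event times lie in the observation window.
\<close>

definition cut :: "(real \<Rightarrow> real) \<Rightarrow> real \<Rightarrow> real" where "cut f t = indicator {0..T} t * f t"

text \<open>The score and, below, its derivative at the delay \<open>tau\<close>, centred under the
  true delay \<open>ts\<close> and normalised. The two delays are kept apart because the process in
  \<open>tau\<close> is studied under a fixed law.\<close>

definition z1 :: "nat \<Rightarrow> real \<Rightarrow> real \<Rightarrow> path \<Rightarrow> real" where
  "z1 n ts tau X = (path_sum (cut (g1 tau)) X - real n * m1 ts tau) / sqrt (real n)"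

definition z2 :: "nat \<Rightarrow> real \<Rightarrow> real \<Rightarrow> path \<Rightarrow> real" where
  "z2 n ts tau X = (path_sum (cut (g2 tau)) X - real n * m2 ts tau) / sqrt (real n)"

text \<open>A relation instead of a function of the path: the maximiser need not be unique, and the
  selected one may depend on other detectors.\<close>

definition is_mle :: "nat \<Rightarrow> path \<Rightarrow> real \<Rightarrow> bool" where
  "is_mle n X th \<longleftrightarrow> th \<in> {a..b} \<and> (\<forall>tau\<in>{a..b}. lik n T lam0 l tau X \<le> lik n T lam0 l th X)"

text \<open>Replaces a supremum of increments of \<open>z1\<close> over the delay interval; its
  expectation is computed by exchanging integrals.\<close>

definition q :: "nat \<Rightarrow> real \<Rightarrow> nat \<Rightarrow> path \<Rightarrow> real" where
  "q n ts p X = integral {a..b} (\<lambda>s. \<bar>z2 n ts s X\<bar> ^ p)"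

section \<open>Pathwise bounds valid for every maximiser\<close>

lemma lik_eq:
  assumes tau: "tau \<in> {a..b}"
  shows "lik n T lam0 l tau X = exp (path_sum (cut (g0 tau)) X - real n * A tau)"
proof -
  \<comment> \<open>Between 0 and \<open>tau\<close> the signal is zero and the logarithm is
    \<open>ln 1\<close>, so the lower limit \<open>tau\<close> can be replaced by 0.\<close>
  have "indicator {tau..T} t * ln (1 + l (t - tau) / lam0) = cut (g0 tau) t" for t
    using l_zero[of "t - tau"] tau a_pos by (auto simp: cut_def g0_def indicator_def)
  then show ?thesis
    unfolding lik_def path_integral_def path_sum_def lam_integral[OF tau] by simp
qed

lemma path_sum_deriv:
  assumes tau: "tau \<in> {a..b}"
  shows "((\<lambda>tau. path_sum (cut (g0 tau)) X) has_real_derivative path_sum (cut (g1 tau)) X) (at tau within {a..b})" (is ?th1)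
    and "((\<lambda>tau. path_sum (cut (g1 tau)) X) has_real_derivative path_sum (cut (g2 tau)) X) (at tau within {a..b})" (is ?th2)
proof -
  have "((\<lambda>tau. cut (g0 tau) t) has_real_derivative cut (g1 tau) t) (at tau within {a..b})"
    and "((\<lambda>tau. cut (g1 tau) t) has_real_derivative cut (g2 tau) t) (at tau within {a..b})" for t
    using g_deriv[OF _ tau, of t] by (auto simp: cut_def indicator_def)
  then show ?th1
    and ?th2
    unfolding path_sum_def by (auto intro!: DERIV_sum)
qed

lemma z1_deriv:
  assumes tau: "tau \<in> {a..b}"
  shows "((\<lambda>tau. z1 n ts tau X) has_real_derivative z2 n ts tau X) (at tau within {a..b})"
  unfolding z1_def z2_def
  by (intro DERIV_cdivide DERIV_diff DERIV_cmult path_sum_deriv m_deriv tau)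

lemma cont_z2: "continuous_on {a..b} (\<lambda>tau. z2 n ts tau X)"
proof -
  have "continuous_on {a..b} (\<lambda>tau. integral (cbox 0 T) (\<lambda>t. g2 tau t * h ts t))"
    by (rule integral_continuous_on_param) (auto intro!: continuous_intros simp: split_beta)
  then have "continuous_on {a..b} (m2 ts)" by (simp add: m2_def[abs_def])
  then show ?thesis
    unfolding z2_def path_sum_def cut_def divide_inverse by (intro continuous_intros)
qed

lemma q_nonneg: "0 \<le> q n ts p X"
  unfolding q_def by (intro integral_nonneg integrable_continuous_real continuous_intros cont_z2) auto

text \<open>The fundamental theorem and \<open>integral_power_le\<close>. The power of the distance
  is kept: with \<open>p = 2\<close> it is the source of the factor \<open>1 / sqrt n\<close> in the
  linearisation.\<close>

lemma z1_increment:
  assumes ts: "ts \<in> {a..b}" and x: "x \<in> {a..b}" and p: "1 \<le> p"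
  shows "\<bar>z1 n ts x X - z1 n ts ts X\<bar> ^ p \<le> \<bar>x - ts\<bar> ^ (p - 1) * q n ts p X"
proof -
  have *: "\<bar>z1 n ts v X - z1 n ts u X\<bar> ^ p \<le> (v - u) ^ (p - 1) * q n ts p X"
    if uv: "u \<le> v" "u \<in> {a..b}" "v \<in> {a..b}" for u v
  proof -
    have sub: "{u..v} \<subseteq> {a..b}" using uv by auto
    have c: "continuous_on {u..v} (\<lambda>s. z2 n ts s X)" by (rule continuous_on_subset[OF cont_z2 sub])
    have "((\<lambda>s. z2 n ts s X) has_integral z1 n ts v X - z1 n ts u X) {u..v}"
    proof (rule fundamental_theorem_of_calculus[OF uv(1)])
      fix s assume "s \<in> {u..v}"
      then show "((\<lambda>s. z1 n ts s X) has_vector_derivative z2 n ts s X) (at s within {u..v})"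
        using z1_deriv[of s n ts X] sub unfolding has_real_derivative_iff_has_vector_derivative
        by (auto intro: has_vector_derivative_within_subset)
    qed
    then have "\<bar>z1 n ts v X - z1 n ts u X\<bar> ^ p = \<bar>integral {u..v} (\<lambda>s. z2 n ts s X)\<bar> ^ p"
      by (simp add: integral_unique)
    also have "\<dots> \<le> (v - u) ^ (p - 1) * integral {u..v} (\<lambda>s. \<bar>z2 n ts s X\<bar> ^ p)"
      by (rule integral_power_le[OF c uv(1) p])
    also have "integral {u..v} (\<lambda>s. \<bar>z2 n ts s X\<bar> ^ p) \<le> q n ts p X"
      unfolding q_def
      by (intro integral_subset_le sub integrable_continuous_real continuous_intros c cont_z2) auto
    finally show ?thesis using uv(1) by (simp add: mult_left_mono)
  qed
  show ?thesis
  proof (cases "ts \<le> x")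
    case True
    then show ?thesis using *[OF True ts x] by simp
  next
    case False
    then show ?thesis using *[of x ts] ts x by (simp add: abs_minus_commute)
  qed
qed

text \<open>Maximality says that the fluctuation of the log-likelihood between \<open>ts\<close> and
  \<open>th\<close> is at least \<open>n\<close> times the contrast. The contrast is quadratic in
  \<open>th - ts\<close>, while the fluctuation is linear in it with slope
  \<open>sqrt n * z1\<close> at some path-dependent \<open>x\<close>; one factor cancels.\<close>

lemma mle_rate:
  "\<exists>c>0. \<forall>n\<ge>1. \<forall>ts\<in>{a..b}. \<forall>X th. is_mle n X th \<longrightarrow>
     (\<exists>x\<in>{a..b}. c * (sqrt (real n) * \<bar>th - ts\<bar>) \<le> \<bar>z1 n ts x X\<bar>)"
proof -
  obtain c where c: "0 < c"
    "\<And>ts tau. ts \<in> {a..b} \<Longrightarrow> tau \<in> {a..b} \<Longrightarrow> c * (tau - ts)^2 \<le> (m0 ts ts - A ts) - (m0 ts tau - A tau)"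
    using contrast by blast
  have "\<exists>x\<in>{a..b}. c * (sqrt (real n) * \<bar>th - ts\<bar>) \<le> \<bar>z1 n ts x X\<bar>"
    if n: "1 \<le> n" and ts: "ts \<in> {a..b}" and mle: "is_mle n X th" for n ts X th
  proof (cases "th = ts")
    case True then show ?thesis using ts by (intro bexI[of _ ts]) auto
  next
    case False
    have th: "th \<in> {a..b}" using mle by (simp add: is_mle_def)
    have sn: "0 < sqrt (real n)" "sqrt (real n) * sqrt (real n) = real n" using n by auto
    let ?z0 = "\<lambda>tau. path_sum (cut (g0 tau)) X - real n * m0 ts tau"
    have d: "(?z0 has_real_derivative sqrt (real n) * z1 n ts tau X) (at tau within {a..b})" if "tau \<in> {a..b}" for tau
    proof -
      have "sqrt (real n) * z1 n ts tau X = path_sum (cut (g1 tau)) X - real n * m1 ts tau"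
        using sn(1) by (simp add: z1_def)
      then show ?thesis by (auto intro!: DERIV_diff DERIV_cmult path_sum_deriv m_deriv that)
    qed
    obtain x where x: "x \<in> {a..b}" "?z0 th - ?z0 ts = sqrt (real n) * z1 n ts x X * (th - ts)"
      using mvt_within_interval[OF d ts th] by blast
    have "lik n T lam0 l ts X \<le> lik n T lam0 l th X" using mle ts by (auto simp: is_mle_def)
    then have "path_sum (cut (g0 ts)) X - real n * A ts \<le> path_sum (cut (g0 th)) X - real n * A th"
      by (simp add: lik_eq[OF ts] lik_eq[OF th])
    then have "real n * ((m0 ts ts - A ts) - (m0 ts th - A th)) \<le> ?z0 th - ?z0 ts"
      by (simp add: algebra_simps)
    moreover have "real n * (c * (th - ts)^2) \<le> real n * ((m0 ts ts - A ts) - (m0 ts th - A th))"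
      by (intro mult_left_mono c ts th) auto
    moreover have "?z0 th - ?z0 ts \<le> sqrt (real n) * \<bar>z1 n ts x X\<bar> * \<bar>th - ts\<bar>"
      unfolding x(2) using sn(1) by (metis abs_ge_self abs_mult abs_of_pos)
    ultimately have "real n * (c * (th - ts)^2) \<le> sqrt (real n) * \<bar>z1 n ts x X\<bar> * \<bar>th - ts\<bar>"
      by linarith
    then have "(sqrt (real n) * \<bar>th - ts\<bar>) * (c * (sqrt (real n) * \<bar>th - ts\<bar>)) \<le> (sqrt (real n) * \<bar>th - ts\<bar>) * \<bar>z1 n ts x X\<bar>"
      using sn(2) by (simp add: power2_eq_square mult_ac)
    then have "c * (sqrt (real n) * \<bar>th - ts\<bar>) \<le> \<bar>z1 n ts x X\<bar>"
      using sn(1) False by (subst (asm) mult_le_cancel_left_pos) auto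
    then show ?thesis using x(1) by blast
  qed
  then show ?thesis using c(1) by blast
qed

lemma mle_moment_pathwise:
  "\<exists>c>0. \<forall>n\<ge>1. \<forall>ts\<in>{a..b}. \<forall>X th p. is_mle n X th \<longrightarrow> 1 \<le> p \<longrightarrow>
     (sqrt (real n) * \<bar>th - ts\<bar>) ^ p \<le> c ^ p * (\<bar>z1 n ts ts X\<bar> ^ p + (b - a) ^ (p - 1) * q n ts p X)"
proof -
  obtain c where c: "0 < c"
    "\<And>n ts X th. 1 \<le> n \<Longrightarrow> ts \<in> {a..b} \<Longrightarrow> is_mle n X th \<Longrightarrow>
       \<exists>x\<in>{a..b}. c * (sqrt (real n) * \<bar>th - ts\<bar>) \<le> \<bar>z1 n ts x X\<bar>"
    using mle_rate by blast
  have "(sqrt (real n) * \<bar>th - ts\<bar>) ^ p \<le> (2 / c) ^ p * (\<bar>z1 n ts ts X\<bar> ^ p + (b - a) ^ (p - 1) * q n ts p X)"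
    if n: "1 \<le> n" and ts: "ts \<in> {a..b}" and mle: "is_mle n X th" and p: "1 \<le> p" for n ts X th p
  proof -
    let ?V = "sqrt (real n) * \<bar>th - ts\<bar>"
    from c(2)[OF n ts mle] obtain x where x: "x \<in> {a..b}" "c * ?V \<le> \<bar>z1 n ts x X\<bar>" by blast
    have "c ^ p * ?V ^ p = (c * ?V) ^ p" by (simp add: power_mult_distrib)
    also have "\<dots> \<le> (\<bar>z1 n ts ts X\<bar> + \<bar>z1 n ts x X - z1 n ts ts X\<bar>) ^ p"
      using x(2) c(1) by (intro power_mono) auto
    also have "\<dots> \<le> 2 ^ p * (\<bar>z1 n ts ts X\<bar> ^ p + \<bar>z1 n ts x X - z1 n ts ts X\<bar> ^ p)"
      by (intro power_add_le) auto
    also have "\<dots> \<le> 2 ^ p * (\<bar>z1 n ts ts X\<bar> ^ p + (b - a) ^ (p - 1) * q n ts p X)"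
    proof -
      have "\<bar>z1 n ts x X - z1 n ts ts X\<bar> ^ p \<le> \<bar>x - ts\<bar> ^ (p - 1) * q n ts p X"
        by (rule z1_increment[OF ts x(1) p])
      also have "\<dots> \<le> (b - a) ^ (p - 1) * q n ts p X"
        using ts x(1) by (intro mult_right_mono power_mono q_nonneg) auto
      finally show ?thesis by simp
    qed
    finally show ?thesis using c(1) by (simp add: power_divide field_simps)
  qed
  then show ?thesis using c(1) by (intro exI[of _ "2 / c"]) auto
qed

text \<open>The derivative within the interval is two-sided only at interior points, hence the
  strict inequalities. The term \<open>n * l (T - th)\<close> is minus the derivative of the
  compensator.\<close>

lemma mle_stationary:
  assumes mle: "is_mle n X th" and th: "a < th" "th < b"
  shows "path_sum (cut (g1 th)) X + real n * l (T - th) = 0"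
proof -
  have thab: "th \<in> {a..b}" using th by auto
  let ?L = "\<lambda>tau. path_sum (cut (g0 tau)) X - real n * A tau"
  have "(?L has_real_derivative path_sum (cut (g1 th)) X - real n * (- l (T - th))) (at th within {a..b})"
    by (intro DERIV_diff DERIV_cmult path_sum_deriv m_deriv thab)
  then have "(?L has_real_derivative path_sum (cut (g1 th)) X - real n * (- l (T - th))) (at th)"
    using th by (simp add: at_within_Icc_at)
  then have "path_sum (cut (g1 th)) X - real n * (- l (T - th)) = 0"
  proof (rule DERIV_local_max)
    show "0 < min (th - a) (b - th)" using th by simp
    show "\<forall>y. \<bar>th - y\<bar> < min (th - a) (b - th) \<longrightarrow> ?L y \<le> ?L th"
    proof (intro allI impI)
      fix y assume "\<bar>th - y\<bar> < min (th - a) (b - th)"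
      then have y: "y \<in> {a..b}" by auto
      then have "lik n T lam0 l y X \<le> lik n T lam0 l th X" using mle by (auto simp: is_mle_def)
      then show "?L y \<le> ?L th" by (simp add: lik_eq[OF y] lik_eq[OF thab])
    qed
  qed
  then show ?thesis by simp
qed

text \<open>The right-hand side is the sum of what the two cases need: increment of the score and
  drift error for an interior maximiser, and the terms with \<open>2 / rho\<close> for one at an
  endpoint.\<close>

lemma mle_linearization_pathwise:
  assumes n: "1 \<le> n" and rho: "0 < rho" and ts: "ts \<in> {a + rho..b - rho}" and mle: "is_mle n X th"
  defines "V \<equiv> sqrt (real n) * \<bar>th - ts\<bar>" and "z \<equiv> z1 n ts ts X"
  shows "(fisher ts * (sqrt (real n) * (th - ts)) - z)^2
     \<le> (2 * (V * q n ts 2 X) + 2 * (2 * B * D * T)^2 * V ^ 4 + 2 / rho * ((fisher ts)^2 * V ^ 3 + z^2 * V)) / sqrt (real n)"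
proof -
  define s where "s = sqrt (real n)"
  let ?C = "2 * B * D * T" and ?d = "th - ts"
  let ?R = "fisher ts * (s * ?d) - z"
  have tsab: "ts \<in> {a..b}" using ts rho by auto
  have th: "th \<in> {a..b}" using mle by (simp add: is_mle_def)
  have s1: "1 \<le> s" using n by (simp add: s_def)
  have ns: "real n / s = s" using real_div_sqrt[of "real n"] by (simp add: s_def)
  have V: "V = s * \<bar>?d\<bar>" by (simp add: V_def s_def)
  have V0: "0 \<le> V" using s1 by (simp add: V)
  have dV: "\<bar>?d\<bar> = V / s" using s1 by (simp add: V)
  have q0: "0 \<le> q n ts 2 X" by (rule q_nonneg)
  have sq2: "(x + y)^2 \<le> 2 * x^2 + 2 * y^2" for x y :: real
    using zero_le_power2[of "x - y"] by (simp add: power2_eq_square algebra_simps)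
  have sq2': "(x - y)^2 \<le> 2 * x^2 + 2 * y^2" for x y :: real
    using zero_le_power2[of "x + y"] by (simp add: power2_eq_square algebra_simps)
  show ?thesis
  proof (cases "a < th \<and> th < b")
    case True
    define e where "e = m1 ts th + l (T - th) + ?d * fisher ts"
    have e: "\<bar>e\<bar> \<le> ?C * ?d^2" unfolding e_def by (rule score_drift[OF tsab th])
    \<comment> \<open>The likelihood equation cancels the random part at \<open>th\<close>, so the
      centred score there equals a deterministic function of \<open>th\<close>, namely minus
      \<open>sqrt n\<close> times the drift.\<close>
    have "z1 n ts th X = - s * (m1 ts th + l (T - th))"
    proof -
      have "path_sum (cut (g1 th)) X = - (real n * l (T - th))"
        using mle_stationary[OF mle] True by auto
      then have "z1 n ts th X = - (real n * (m1 ts th + l (T - th))) / s"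
        unfolding z1_def s_def by (simp add: algebra_simps)
      also have "\<dots> = - s * (m1 ts th + l (T - th))"
        using ns by (metis minus_mult_left times_divide_eq_left minus_divide_left)
      finally show ?thesis .
    qed
    then have R: "?R = (z1 n ts th X - z1 n ts ts X) + s * e"
      unfolding e_def z_def by (simp add: algebra_simps)
    have "?R^2 \<le> 2 * (z1 n ts th X - z1 n ts ts X)^2 + 2 * (s * e)^2"
      unfolding R by (rule sq2)
    also have "(z1 n ts th X - z1 n ts ts X)^2 \<le> V * q n ts 2 X / s"
      using z1_increment[OF tsab th, of 2 n X] dV by simp
    also have "(s * e)^2 \<le> ?C^2 * V ^ 4 / s"
    proof -
      have "\<bar>s * e\<bar> \<le> s * (?C * (V / s)^2)"
        using e s1 unfolding abs_mult dV[symmetric] power2_abs by (intro mult_mono) auto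
      also have "\<dots> = ?C * V^2 / s" using s1 by (simp add: power2_eq_square)
      finally have "(s * e)^2 \<le> (?C * V^2 / s)^2"
        by (metis abs_ge_zero power2_abs power_mono)
      also have "\<dots> = ?C^2 * V ^ 4 / (s * s)"
        by (simp add: power_divide power_mult_distrib power2_eq_square power4_eq_xxxx)
      also have "\<dots> \<le> ?C^2 * V ^ 4 / (s * 1)"
        using s1 by (intro divide_left_mono mult_left_mono) auto
      finally show ?thesis by simp
    qed
    finally have "?R^2 \<le> (2 * (V * q n ts 2 X) + 2 * ?C^2 * V ^ 4) / s"
      by (simp add: add_divide_distrib)
    also have "\<dots> \<le> (2 * (V * q n ts 2 X) + 2 * ?C^2 * V ^ 4 + 2 / rho * ((fisher ts)^2 * V ^ 3 + z^2 * V)) / s"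
      using V0 rho s1 by (intro divide_right_mono) auto
    finally show ?thesis unfolding s_def .
  next
    case False
    \<comment> \<open>An endpoint is at least \<open>rho\<close> away from \<open>ts\<close>, so
      \<open>V / (rho * s)\<close> is at least one. Multiplying the trivial bound by it supplies the
      missing factor \<open>1 / sqrt n\<close>.\<close>
    then have "rho \<le> \<bar>?d\<bar>" using th ts by auto
    then have "rho * s \<le> V" using s1 by (simp add: V mult.commute)
    moreover have "0 < rho * s" using rho s1 by simp
    ultimately have 1: "1 \<le> V / (rho * s)" by (simp only: le_divide_eq_1_pos)
    have "?R^2 \<le> 2 * (fisher ts * (s * ?d))^2 + 2 * z^2" by (rule sq2')
    also have "(fisher ts * (s * ?d))^2 = (fisher ts)^2 * V^2"
      by (simp add: V power_mult_distrib)
    finally have "?R^2 \<le> (2 * ((fisher ts)^2 * V^2) + 2 * z^2) * 1" by simp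
    also have "\<dots> \<le> (2 * ((fisher ts)^2 * V^2) + 2 * z^2) * (V / (rho * s))"
      using 1 by (intro mult_left_mono) auto
    also have "\<dots> = (2 / rho * ((fisher ts)^2 * V ^ 3 + z^2 * V)) / s"
      using rho s1 by (simp add: field_simps power2_eq_square power3_eq_cube)
    also have "\<dots> \<le> (2 * (V * q n ts 2 X) + 2 * ?C^2 * V ^ 4 + 2 / rho * ((fisher ts)^2 * V ^ 3 + z^2 * V)) / s"
      using V0 q0 s1 by (intro divide_right_mono) auto
    finally show ?thesis unfolding s_def .
  qed
qed

end

section \<open>Stochastic bounds for one detector\<close>

lemma borel_measurable_path_sum_param:
  fixes f :: "real \<Rightarrow> real \<Rightarrow> real"
  assumes f: "(\<lambda>(s, t). f s t) \<in> borel_measurable (borel \<Otimes>\<^sub>M borel)"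
  shows "(\<lambda>(X, s). path_sum (f s) X) \<in> borel_measurable (poisson_process T mu \<Otimes>\<^sub>M lborel)"
proof -
  let ?M = "path_space \<Otimes>\<^sub>M (borel :: real measure)"
  have 1: "(\<lambda>x. \<Sum>i<m. f (snd x) (snd (fst x) i)) \<in> borel_measurable ?M" for m
  proof (rule borel_measurable_sum)
    fix i
    have "(\<lambda>x. (snd x, snd (fst x) i)) \<in> measurable ?M (borel \<Otimes>\<^sub>M borel)" by measurable
    from measurable_compose[OF this f]
    show "(\<lambda>x. f (snd x) (snd (fst x) i)) \<in> borel_measurable ?M" by simp
  qed
  have "(\<lambda>x. \<Sum>i<fst (fst x). f (snd x) (snd (fst x) i)) \<in> borel_measurable ?M"
    by (rule measurable_compose_countable[where g="\<lambda>x. fst (fst x)" and f="\<lambda>m x. \<Sum>i<m. f (snd x) (snd (fst x) i)"])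
       (rule 1, measurable)
  then have "(\<lambda>(X, s). path_sum (f s) X) \<in> borel_measurable ?M"
    by (simp add: path_sum_def split_beta)
  also have "borel_measurable ?M = borel_measurable (poisson_process T mu \<Otimes>\<^sub>M lborel)"
    by (intro measurable_cong_sets sets_pair_measure_cong refl) (simp_all add: sets_poisson_process)
  finally show ?thesis .
qed

context detector
begin

abbreviation "N n ts \<equiv> intensity T (\<lambda>t. real n * l (t - ts) + real n * lam0)"
abbreviation "P n ts \<equiv> poisson_process T (\<lambda>t. real n * l (t - ts) + real n * lam0)"

text \<open>The constant of \<open>poisson_scaled_moment\<close> for integrands bounded by
  \<open>D\<close> and a total mass of at most \<open>n * (B + lam0) * T\<close>; it depends neither
  on \<open>n\<close> nor on the delays.\<close>

definition K :: "nat \<Rightarrow> real" where "K p = fact p * (2 * exp (D^2 * exp D * ((B + lam0) * T)))"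

lemma intensity_eq: "(\<lambda>t. real n * l (t - ts) + real n * lam0) = (\<lambda>t. real n * h ts t)"
  by (simp add: h_def distrib_left)

lemma poisson_intensity_h: "poisson_intensity T (h ts)"
  using T_pos h_pos by unfold_locales (auto intro!: continuous_intros)

lemma poisson_intensity_P:
  "1 \<le> n \<Longrightarrow> poisson_intensity T (\<lambda>t. real n * l (t - ts) + real n * lam0)"
  unfolding intensity_eq using T_pos h_pos by unfold_locales (auto intro!: continuous_intros)

lemma prob_space_P: "1 \<le> n \<Longrightarrow> prob_space (P n ts)"
  using poisson_intensity.prob_space_PP[OF poisson_intensity_P] .

lemma measurable_cut: "continuous_on UNIV f \<Longrightarrow> cut f \<in> borel_measurable borel"
  unfolding cut_def[abs_def] by (intro borel_measurable_times borel_measurable_continuous_onI[of f] borel_measurable_indicator) auto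

lemma cut_g_measurable [measurable]: "cut (g1 tau) \<in> borel_measurable borel" "cut (g2 tau) \<in> borel_measurable borel"
  by (intro measurable_cut continuous_intros)+

lemma cut_le: assumes "\<And>t. \<bar>f t\<bar> \<le> D" shows "\<bar>cut f t\<bar> \<le> D"
  using assms[of t] D_nonneg by (auto simp: cut_def indicator_def)

lemma integral_intensity_cut:
  assumes f: "continuous_on UNIV f" and "poisson_intensity T (\<lambda>t. c * h ts t)"
  shows "(\<integral>t. cut f t \<partial>intensity T (\<lambda>t. c * h ts t)) = c * integral {0..T} (\<lambda>t. f t * h ts t)"
proof -
  interpret I: poisson_intensity T "\<lambda>t. c * h ts t" by fact
  have f': "continuous_on {0..T} (\<lambda>t. f t * h ts t)"
    by (intro continuous_intros continuous_on_subset[OF f]) auto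
  have "(\<integral>t. cut f t \<partial>I.nu) = (\<integral>t. c * (indicator {0..T} t *\<^sub>R (f t * h ts t)) \<partial>lborel)"
    unfolding I.integral_nu[OF measurable_cut[OF f]]
    by (rule Bochner_Integration.integral_cong[OF refl]) (simp add: cut_def indicator_def)
  also have "\<dots> = c * integral {0..T} (\<lambda>t. f t * h ts t)"
    using set_borel_integral_eq_integral(2)[OF borel_integrable_atLeastAtMost'[OF f']]
    by (simp add: set_lebesgue_integral_def)
  finally show ?thesis .
qed

lemma mean_eq:
  assumes n: "1 \<le> n" and f: "continuous_on UNIV f"
  shows "(\<integral>t. cut f t \<partial>N n ts) = real n * integral {0..T} (\<lambda>t. f t * h ts t)"
  unfolding intensity_eq
  by (rule integral_intensity_cut[OF f poisson_intensity_P[OF n, unfolded intensity_eq]])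

lemma Lam_le: "integral {0..T} (\<lambda>t. real n * l (t - ts) + real n * lam0) \<le> real n * ((B + lam0) * T)"
proof -
  have "integral {0..T} (\<lambda>t. real n * h ts t) \<le> integral {0..T} (\<lambda>t. real n * (B + lam0))"
    using h_le by (intro integral_le integrable_continuous_real continuous_intros mult_left_mono) auto
  then show ?thesis unfolding intensity_eq using T_pos by (simp add: mult_ac)
qed

lemma z_eq:
  assumes n: "1 \<le> n"
  shows "z1 n ts tau X = (path_sum (cut (g1 tau)) X - (\<integral>t. cut (g1 tau) t \<partial>N n ts)) / sqrt (real n)" (is ?th1)
    and "z2 n ts tau X = (path_sum (cut (g2 tau)) X - (\<integral>t. cut (g2 tau) t \<partial>N n ts)) / sqrt (real n)" (is ?th2)
proof -
  have c: "continuous_on UNIV (g1 tau)" "continuous_on UNIV (g2 tau)" by (intro continuous_intros)+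
  show ?th1
    and ?th2
    unfolding mean_eq[OF n c(1)] mean_eq[OF n c(2)] z1_def z2_def m1_def m2_def by auto
qed

lemma z_moments:
  assumes n: "1 \<le> n"
  shows "integrable (P n ts) (\<lambda>X. \<bar>z1 n ts tau X\<bar> ^ p)" (is ?th1) "(\<integral>X. \<bar>z1 n ts tau X\<bar> ^ p \<partial>P n ts) \<le> K p" (is ?th2)
    and "integrable (P n ts) (\<lambda>X. \<bar>z2 n ts tau X\<bar> ^ p)" (is ?th3) "(\<integral>X. \<bar>z2 n ts tau X\<bar> ^ p \<partial>P n ts) \<le> K p" (is ?th4)
proof -
  interpret I: poisson_intensity T "\<lambda>t. real n * l (t - ts) + real n * lam0" by (rule poisson_intensity_P[OF n])
  have rn: "1 \<le> real n" using n by simp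
  note M1 = I.poisson_scaled_moment[OF cut_g_measurable(1)[of tau] cut_le[OF g1_le] rn Lam_le]
  note M2 = I.poisson_scaled_moment[OF cut_g_measurable(2)[of tau] cut_le[OF g2_le] rn Lam_le]
  show ?th1 ?th2
    unfolding z_eq[OF n] K_def by (rule M1)+
  show ?th3 ?th4
    unfolding z_eq[OF n] K_def by (rule M2)+
qed

lemma z1_measurable [measurable]: "z1 n ts tau \<in> borel_measurable (P m ts')"
proof -
  have "path_sum (cut (g1 tau)) \<in> borel_measurable (P m ts')"
    using borel_measurable_path_sum[OF cut_g_measurable(1)] by (simp add: measurable_cong_sets[OF sets_poisson_process refl])
  then show ?thesis unfolding z1_def[abs_def] by measurable
qed

lemma z1_variance:
  assumes n: "1 \<le> n" and ts: "ts \<in> {a..b}"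
  shows "(\<integral>X. (z1 n ts ts X)^2 \<partial>P n ts) = fisher ts"
proof -
  interpret I: poisson_intensity T "\<lambda>t. real n * l (t - ts) + real n * lam0" by (rule poisson_intensity_P[OF n])
  have c: "continuous_on UNIV (\<lambda>t. (g1 ts t)^2)" by (intro continuous_intros)
  have sq: "(\<lambda>t. (cut (g1 ts) t)^2) = cut (\<lambda>t. (g1 ts t)^2)"
    by (auto simp: cut_def indicator_def)
  have "(\<integral>X. (z1 n ts ts X)^2 \<partial>P n ts) = (\<integral>X. (path_sum (cut (g1 ts)) X - (\<integral>t. cut (g1 ts) t \<partial>I.nu))^2 / real n \<partial>P n ts)"
    unfolding z_eq[OF n] by (simp add: power_divide)
  also have "\<dots> = (\<integral>t. (cut (g1 ts) t)^2 \<partial>I.nu) / real n"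
    by (simp add: I.poisson_variance[OF cut_g_measurable(1) cut_le[OF g1_le]])
  also have "\<dots> = fisher ts"
    unfolding sq mean_eq[OF n c] fisher_eq[OF ts] using n by simp
  finally show ?thesis .
qed

lemma z1_char_limit:
  assumes ts: "ts \<in> {a..b}"
  shows "(\<lambda>n. \<integral>X. iexp (s * z1 n ts ts X) \<partial>P n ts) \<longlonglongrightarrow> exp (- (s^2 / 2) * fisher ts)"
proof -
  have I: "poisson_intensity T (h ts)" by (rule poisson_intensity_h)
  have I1: "poisson_intensity T (\<lambda>t. 1 * h ts t)" using I by simp
  have sq: "(\<lambda>t. (cut (g1 ts) t)^2) = cut (\<lambda>t. (g1 ts t)^2)"
    by (auto simp: cut_def indicator_def)
  have c: "continuous_on UNIV (g1 ts)" "continuous_on UNIV (\<lambda>t. (g1 ts t)^2)" by (intro continuous_intros)+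
  have e: "(\<integral>t. cut (g1 ts) t \<partial>intensity T (h ts)) = m1 ts ts"
    "(\<integral>t. (cut (g1 ts) t)^2 \<partial>intensity T (h ts)) = fisher ts"
    using integral_intensity_cut[OF c(1) I1] integral_intensity_cut[OF c(2) I1]
    by (simp_all add: sq m1_def fisher_eq[OF ts])
  show ?thesis
    using poisson_char_limit[OF I cut_g_measurable(1)[of ts] cut_le[OF g1_le], of s]
    unfolding e intensity_eq z1_def .
qed

text \<open>Joint measurability in path and delay, as required for exchanging the expectation with
  the integral over delays.\<close>

lemma z2_measurable_param: "(\<lambda>(X, s). z2 n ts s X) \<in> borel_measurable (P m ts' \<Otimes>\<^sub>M lborel)"
proof -
  have "continuous_on UNIV (\<lambda>(s, t). g2 s t)"
    unfolding split_beta by (intro continuous_intros)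
  then have "(\<lambda>(s, t). g2 s t) \<in> borel_measurable (borel \<Otimes>\<^sub>M borel)"
    unfolding borel_prod by (rule borel_measurable_continuous_onI)
  then have "(\<lambda>(s, t). cut (g2 s) t) \<in> borel_measurable (borel \<Otimes>\<^sub>M borel)"
    unfolding cut_def split_beta by measurable
  note 1 = borel_measurable_path_sum_param[OF this, of T "\<lambda>t. real m * l (t - ts') + real m * lam0"]
  have "continuous_on UNIV (\<lambda>tau. integral (cbox 0 T) (\<lambda>t. g2 tau t * h ts t))"
    by (rule integral_continuous_on_param) (auto intro!: continuous_intros simp: split_beta)
  then have "continuous_on UNIV (m2 ts)" by (simp add: m2_def[abs_def])
  then have [measurable]: "m2 ts \<in> borel_measurable borel" by (rule borel_measurable_continuous_onI)
  show ?thesis using 1 unfolding z2_def split_beta by measurable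
qed

text \<open>Tonelli reduces the expectation of \<open>q\<close> to the moments of \<open>z2\<close>
  at each fixed delay, which are bounded by \<open>K p\<close>.\<close>

lemma q_moment:
  assumes n: "1 \<le> n"
  shows "integrable (P n ts) (q n ts p)" "(\<integral>X. q n ts p X \<partial>P n ts) \<le> (b - a) * K p" (is ?th1)
proof -
  interpret I: poisson_intensity T "\<lambda>t. real n * l (t - ts) + real n * lam0" by (rule poisson_intensity_P[OF n])
  have K0: "0 \<le> K p" by (simp add: K_def)
  \<comment> \<open>Rewriting \<open>q\<close> as a nonnegative Lebesgue integral makes it
    measurable in the path, being a partial integral of a jointly measurable function.\<close>
  have q_eq: "ennreal (q n ts p X) = (\<integral>\<^sup>+s. ennreal (indicator {a..b} s * \<bar>z2 n ts s X\<bar> ^ p) \<partial>lborel)" for X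
  proof -
    have c: "continuous_on {a..b} (\<lambda>s. \<bar>z2 n ts s X\<bar> ^ p)" by (intro continuous_intros cont_z2)
    note si = borel_integrable_atLeastAtMost'[OF c]
    have "q n ts p X = (\<integral>s. indicator {a..b} s * \<bar>z2 n ts s X\<bar> ^ p \<partial>lborel)"
      unfolding q_def using set_borel_integral_eq_integral(2)[OF si] by (simp add: set_lebesgue_integral_def)
    then show ?thesis using si
      by (subst nn_integral_eq_integral) (auto simp: set_integrable_def)
  qed
  have m: "(\<lambda>(X, s). ennreal (indicator {a..b} s * \<bar>z2 n ts s X\<bar> ^ p)) \<in> borel_measurable (P n ts \<Otimes>\<^sub>M lborel)"
    using z2_measurable_param[of n ts n ts] unfolding split_beta by measurable
  have qm: "q n ts p \<in> borel_measurable (P n ts)"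
  proof -
    have "(\<lambda>X. ennreal (q n ts p X)) \<in> borel_measurable (P n ts)"
      unfolding q_eq using lborel.borel_measurable_nn_integral[OF m] by simp
    then have "(\<lambda>X. enn2real (ennreal (q n ts p X))) \<in> borel_measurable (P n ts)" by measurable
    then show ?thesis by (simp add: q_nonneg)
  qed
  interpret pair: pair_sigma_finite "P n ts" lborel ..
  have "(\<integral>\<^sup>+X. ennreal (q n ts p X) \<partial>P n ts) = (\<integral>\<^sup>+s. \<integral>\<^sup>+X. ennreal (indicator {a..b} s * \<bar>z2 n ts s X\<bar> ^ p) \<partial>P n ts \<partial>lborel)"
    unfolding q_eq using pair.Fubini'[OF m] by simp
  also have "\<dots> \<le> (\<integral>\<^sup>+s. ennreal (K p) * indicator {a..b} s \<partial>lborel)"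
  proof (rule nn_integral_mono)
    fix s
    have "(\<integral>\<^sup>+X. ennreal (\<bar>z2 n ts s X\<bar> ^ p) \<partial>P n ts) = ennreal (\<integral>X. \<bar>z2 n ts s X\<bar> ^ p \<partial>P n ts)"
      by (intro nn_integral_eq_integral z_moments n) auto
    also have "\<dots> \<le> ennreal (K p)" by (intro ennreal_leI z_moments n)
    finally show "(\<integral>\<^sup>+X. ennreal (indicator {a..b} s * \<bar>z2 n ts s X\<bar> ^ p) \<partial>P n ts) \<le> ennreal (K p) * indicator {a..b} s"
      by (auto simp: indicator_def)
  qed
  also have "\<dots> = ennreal ((b - a) * K p)"
    using a_less_b K0 by (subst nn_integral_cmult_indicator) (auto simp: ennreal_mult' mult.commute)
  finally have le: "(\<integral>\<^sup>+X. ennreal (q n ts p X) \<partial>P n ts) \<le> ennreal ((b - a) * K p)" .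
  show int: "integrable (P n ts) (q n ts p)"
    by (rule integrableI_bounded[OF qm]) (use le in \<open>auto simp: q_nonneg intro: le_less_trans\<close>)
  have "ennreal (\<integral>X. q n ts p X \<partial>P n ts) \<le> ennreal ((b - a) * K p)"
    using le by (subst nn_integral_eq_integral[symmetric, OF int]) (auto simp: q_nonneg)
  then show ?th1
    using a_less_b K0 by (subst (asm) ennreal_le_iff) auto
qed

text \<open>The majorant \<open>U\<close> is chosen before the maximiser \<open>th\<close>. It is a
  function of one path, so it stays usable when \<open>th\<close> depends on all
  observations.\<close>

lemma mle_moment_dominated:
  "\<exists>C. \<forall>n\<ge>1. \<forall>ts\<in>{a..b}. \<exists>U. integrable (P n ts) U \<and> (\<integral>X. U X \<partial>P n ts) \<le> C \<and>
     (\<forall>X th. is_mle n X th \<longrightarrow> (sqrt (real n) * \<bar>th - ts\<bar>) ^ p \<le> U X)"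
proof (cases "p = 0")
  case True
  show ?thesis
  proof (intro exI[of _ 1] allI impI ballI)
    fix n :: nat and ts assume "1 \<le> n"
    then interpret prob_space "P n ts" by (rule prob_space_P)
    show "\<exists>U. integrable (P n ts) U \<and> expectation U \<le> 1 \<and>
     (\<forall>X th. is_mle n X th \<longrightarrow> (sqrt (real n) * \<bar>th - ts\<bar>) ^ p \<le> U X)"
      using True prob_space by (intro exI[of _ "\<lambda>_. 1"]) (auto simp del: space_poisson_process)
  qed
next
  case False
  then have p: "1 \<le> p" by simp
  obtain c where c: "0 < c" "\<And>n ts X th p. 1 \<le> n \<Longrightarrow> ts \<in> {a..b} \<Longrightarrow> is_mle n X th \<Longrightarrow> 1 \<le> p \<Longrightarrow>
     (sqrt (real n) * \<bar>th - ts\<bar>) ^ p \<le> c ^ p * (\<bar>z1 n ts ts X\<bar> ^ p + (b - a) ^ (p - 1) * q n ts p X)"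
    using mle_moment_pathwise by blast
  show ?thesis
  proof (intro exI[of _ "c ^ p * (K p + (b - a) ^ (p - 1) * ((b - a) * K p))"] allI impI ballI)
    fix n :: nat and ts assume n: "1 \<le> n" and ts: "ts \<in> {a..b}"
    let ?U = "\<lambda>X. c ^ p * (\<bar>z1 n ts ts X\<bar> ^ p + (b - a) ^ (p - 1) * q n ts p X)"
    have i: "integrable (P n ts) ?U"
      by (intro integrable_mult_right Bochner_Integration.integrable_add z_moments q_moment n)
    have "(\<integral>X. ?U X \<partial>P n ts) = c ^ p * ((\<integral>X. \<bar>z1 n ts ts X\<bar> ^ p \<partial>P n ts) + (b - a) ^ (p - 1) * (\<integral>X. q n ts p X \<partial>P n ts))"
      by (simp add: Bochner_Integration.integral_add[OF z_moments(1)[OF n] integrable_mult_right[OF q_moment(1)[OF n]]])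
    also have "\<dots> \<le> c ^ p * (K p + (b - a) ^ (p - 1) * ((b - a) * K p))"
      using c(1) a_less_b by (intro mult_left_mono add_mono z_moments q_moment n) auto
    finally show "\<exists>U. integrable (P n ts) U \<and> (\<integral>X. U X \<partial>P n ts) \<le> c ^ p * (K p + (b - a) ^ (p - 1) * ((b - a) * K p)) \<and>
     (\<forall>X th. is_mle n X th \<longrightarrow> (sqrt (real n) * \<bar>th - ts\<bar>) ^ p \<le> U X)"
      using i c(2)[OF n ts _ p] by (intro exI[of _ ?U]) auto
  qed
qed

lemma mle_linearization_dominated:
  assumes rho: "0 < rho"
  shows "\<exists>C. \<forall>n\<ge>1. \<forall>ts\<in>{a + rho..b - rho}. \<exists>U. integrable (P n ts) U \<and> (\<integral>X. U X \<partial>P n ts) \<le> C / sqrt (real n) \<and>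
     (\<forall>X th. is_mle n X th \<longrightarrow> (fisher ts * (sqrt (real n) * (th - ts)) - z1 n ts ts X)^2 \<le> U X)"
proof -
  obtain C2 where C2: "\<And>n ts. 1 \<le> n \<Longrightarrow> ts \<in> {a..b} \<Longrightarrow> \<exists>U. integrable (P n ts) U \<and> (\<integral>X. U X \<partial>P n ts) \<le> C2 \<and>
     (\<forall>X th. is_mle n X th \<longrightarrow> (sqrt (real n) * \<bar>th - ts\<bar>) ^ 2 \<le> U X)"
    using mle_moment_dominated[of 2] by blast
  obtain C4 where C4: "\<And>n ts. 1 \<le> n \<Longrightarrow> ts \<in> {a..b} \<Longrightarrow> \<exists>U. integrable (P n ts) U \<and> (\<integral>X. U X \<partial>P n ts) \<le> C4 \<and>
     (\<forall>X th. is_mle n X th \<longrightarrow> (sqrt (real n) * \<bar>th - ts\<bar>) ^ 4 \<le> U X)"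
    using mle_moment_dominated[of 4] by blast
  define F where "F = D^2 * (B + lam0) * T"
  define E where "E = 2 * (2 * B * D * T)^2"
  \<comment> \<open>Collects the expectations of the terms of the majorant below, with
    \<open>F\<close> a bound for the information and \<open>C2\<close>, \<open>C4\<close> bounds for
    the second and fourth error moments.\<close>
  define C where "C = 2 * C2 + 2 * (b - a) * ((b - a) * K 4) + E * C4
    + 2 / rho * (F^2 * (C2 + C4) + K 4 + C2)"
  show ?thesis
  proof (intro exI[of _ C] allI impI ballI)
    fix n :: nat and ts assume n: "1 \<le> n" and ts: "ts \<in> {a + rho..b - rho}"
    have tsab: "ts \<in> {a..b}" using ts rho by auto
    obtain U2 where U2: "integrable (P n ts) U2" "(\<integral>X. U2 X \<partial>P n ts) \<le> C2"
      "\<And>X th. is_mle n X th \<Longrightarrow> (sqrt (real n) * \<bar>th - ts\<bar>) ^ 2 \<le> U2 X" using C2[OF n tsab] by blast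
    obtain U4 where U4: "integrable (P n ts) U4" "(\<integral>X. U4 X \<partial>P n ts) \<le> C4"
      "\<And>X th. is_mle n X th \<Longrightarrow> (sqrt (real n) * \<bar>th - ts\<bar>) ^ 4 \<le> U4 X" using C4[OF n tsab] by blast
    define s where "s = sqrt (real n)"
    have s: "0 < s" using n by (simp add: s_def)
    let ?G = "\<lambda>X. 2 * U2 X + 2 * (b - a) * q n ts 4 X + E * U4 X
      + 2 / rho * (F^2 * (U2 X + U4 X) + \<bar>z1 n ts ts X\<bar> ^ 4 + U2 X)"
    have Gi: "integrable (P n ts) ?G"
      by (intro Bochner_Integration.integrable_add integrable_mult_right U2(1) U4(1) q_moment z_moments n)
    have "(\<integral>X. ?G X \<partial>P n ts) = 2 * (\<integral>X. U2 X \<partial>P n ts) + 2 * (b - a) * (\<integral>X. q n ts 4 X \<partial>P n ts) + E * (\<integral>X. U4 X \<partial>P n ts)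
      + 2 / rho * (F^2 * ((\<integral>X. U2 X \<partial>P n ts) + (\<integral>X. U4 X \<partial>P n ts)) + (\<integral>X. \<bar>z1 n ts ts X\<bar> ^ 4 \<partial>P n ts) + (\<integral>X. U2 X \<partial>P n ts))"
      using U2(1) U4(1) q_moment(1)[OF n, of ts 4] z_moments(1)[OF n, of ts ts 4]
      by (simp add: Bochner_Integration.integral_add)
    also have "\<dots> \<le> C"
      unfolding C_def using a_less_b rho
      by (intro add_mono mult_left_mono U2(2) U4(2) q_moment z_moments n) (auto simp: E_def)
    finally have GC: "(\<integral>X. ?G X \<partial>P n ts) \<le> C" .
    let ?U = "\<lambda>X. ?G X / s"
    have "integrable (P n ts) ?U" using Gi by (rule integrable_divide_zero)
    moreover have "(\<integral>X. ?U X \<partial>P n ts) \<le> C / s"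
      unfolding integral_divide_zero using GC s by (intro divide_right_mono) auto
    moreover have "(fisher ts * (sqrt (real n) * (th - ts)) - z1 n ts ts X)^2 \<le> ?U X" if mle: "is_mle n X th" for X th
    proof -
      define V where "V = sqrt (real n) * \<bar>th - ts\<bar>"
      define z where "z = z1 n ts ts X"
      have V0: "0 \<le> V" by (simp add: V_def)
      have V2: "V^2 \<le> U2 X" and V4: "V ^ 4 \<le> U4 X" unfolding V_def using U2(3)[OF mle] U4(3)[OF mle] .
      \<comment> \<open>Splits every product of the pathwise bound into squares, so that second and
        fourth moments suffice and no independence between error and score is needed.\<close>
      have ab: "x * y \<le> x^2 + y^2" for x y :: real
        using sum_squares_bound[of x y] zero_le_power2[of x] zero_le_power2[of y] by linarith
      have Vq: "V * q n ts 2 X \<le> U2 X + (b - a) * q n ts 4 X"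
      proof -
        have "(q n ts 2 X)^2 \<le> (b - a) * q n ts 4 X"
          using integral_power_le[of a b "\<lambda>s. \<bar>z2 n ts s X\<bar> ^ 2" 2] a_less_b
          by (simp add: q_def continuous_intros cont_z2 power_abs[symmetric] flip: power_mult)
        then show ?thesis using ab[of V "q n ts 2 X"] V2 by linarith
      qed
      have zV: "z^2 * V \<le> \<bar>z\<bar> ^ 4 + U2 X"
        using ab[of "z^2" V] V2 by (simp flip: power_mult)
      have V3: "V ^ 3 \<le> U2 X + U4 X"
        using ab[of V "V^2"] V2 V4 by (simp add: power3_eq_cube power2_eq_square power4_eq_xxxx mult_ac)
      have Fs: "0 \<le> fisher ts" "fisher ts \<le> F"
        using fisher_ge tsab fisher_le[OF tsab] by (auto simp: F_def intro: order_trans[OF less_imp_le])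
      have FV: "(fisher ts)^2 * V ^ 3 \<le> F^2 * (U2 X + U4 X)"
        using Fs V3 V0 by (intro mult_mono power_mono) auto
      have "(fisher ts * (sqrt (real n) * (th - ts)) - z1 n ts ts X)^2
         \<le> (2 * (V * q n ts 2 X) + E * V ^ 4 + 2 / rho * ((fisher ts)^2 * V ^ 3 + z^2 * V)) / s"
        using mle_linearization_pathwise[OF n rho ts mle] by (simp add: V_def s_def z_def E_def)
      also have "\<dots> \<le> (2 * (U2 X + (b - a) * q n ts 4 X) + E * U4 X + 2 / rho * (F^2 * (U2 X + U4 X) + (\<bar>z\<bar> ^ 4 + U2 X))) / s"
        using s rho by (intro divide_right_mono add_mono mult_left_mono Vq zV FV V4) (auto simp: E_def)
      also have "\<dots> = ?U X"
        by (simp add: z_def algebra_simps)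
      finally show ?thesis .
    qed
    ultimately show "\<exists>U. integrable (P n ts) U \<and> (\<integral>X. U X \<partial>P n ts) \<le> C / sqrt (real n) \<and>
     (\<forall>X th. is_mle n X th \<longrightarrow> (fisher ts * (sqrt (real n) * (th - ts)) - z1 n ts ts X)^2 \<le> U X)"
      unfolding s_def[symmetric] by (intro exI[of _ ?U]) (auto simp only: s_def)
  qed
qed

end

section \<open>Weak convergence\<close>

text \<open>Functions of separate coordinates stay independent; this identifies the joint law of the
  scores with the product of their laws.\<close>

lemma distr_PiM_componentwise:
  fixes M :: "'k::finite \<Rightarrow> 'a measure" and N :: "'k \<Rightarrow> 'b measure"
  assumes M: "\<And>j. prob_space (M j)" and f [measurable]: "\<And>j. f j \<in> measurable (M j) (N j)"
  shows "distr (\<Pi>\<^sub>M j\<in>UNIV. M j) (\<Pi>\<^sub>M j\<in>UNIV. N j) (\<lambda>x j. f j (x j)) = (\<Pi>\<^sub>M j\<in>UNIV. distr (M j) (N j) (f j))"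
proof -
  interpret M: product_prob_space M by (rule product_prob_spaceI) (rule M)
  interpret D: product_prob_space "\<lambda>j. distr (M j) (N j) (f j)"
    by (rule product_prob_spaceI) (intro prob_space.prob_space_distr M f)
  have meas: "(\<lambda>x j. f j (x j)) \<in> measurable (\<Pi>\<^sub>M j\<in>UNIV. M j) (\<Pi>\<^sub>M j\<in>UNIV. N j)"
    by (rule measurable_PiM_single') (auto simp: space_PiM PiE_iff intro: measurable_space[OF f])
  show ?thesis
  proof (rule D.PiM_eqI)
    show "sets (distr (Pi\<^sub>M UNIV M) (Pi\<^sub>M UNIV N) (\<lambda>x j. f j (x j))) = sets (\<Pi>\<^sub>M j\<in>UNIV. distr (M j) (N j) (f j))"
      by (simp, intro sets_PiM_cong) auto
    fix A :: "'k \<Rightarrow> 'b set" assume "\<And>i. i \<in> UNIV \<Longrightarrow> A i \<in> sets (distr (M i) (N i) (f i))"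
    then have A: "A i \<in> sets (N i)" for i by simp
    have "(\<lambda>x j. f j (x j)) -` Pi\<^sub>E UNIV A \<inter> space (Pi\<^sub>M UNIV M) = Pi\<^sub>E UNIV (\<lambda>j. f j -` A j \<inter> space (M j))"
      by (auto simp: space_PiM PiE_iff)
    then have "emeasure (distr (Pi\<^sub>M UNIV M) (Pi\<^sub>M UNIV N) (\<lambda>x j. f j (x j))) (Pi\<^sub>E UNIV A)
        = emeasure (Pi\<^sub>M UNIV M) (Pi\<^sub>E UNIV (\<lambda>j. f j -` A j \<inter> space (M j)))"
      using A meas by (subst emeasure_distr) (auto intro!: sets_PiM_I_finite)
    also have "\<dots> = (\<Prod>j\<in>UNIV. emeasure (M j) (f j -` A j \<inter> space (M j)))"
      using A by (intro M.emeasure_PiM) (auto intro!: measurable_sets[OF f])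
    also have "\<dots> = (\<Prod>j\<in>UNIV. emeasure (distr (M j) (N j) (f j)) (A j))"
      using A by (intro prod.cong refl) (simp add: emeasure_distr)
    finally show "emeasure (distr (Pi\<^sub>M UNIV M) (Pi\<^sub>M UNIV N) (\<lambda>x j. f j (x j))) (Pi\<^sub>E UNIV A)
      = (\<Prod>j\<in>UNIV. emeasure (distr (M j) (N j) (f j)) (A j))" .
  qed simp
qed

lemma measurable_vec_lambda [measurable]:
  "(\<lambda>x. (\<chi> j. x j) :: real^'k::finite) \<in> borel_measurable (\<Pi>\<^sub>M j\<in>UNIV. (borel :: real measure))"
proof (rule borel_measurable_euclidean_space[THEN iffD2], rule ballI)
  fix i :: "real^'k" assume "i \<in> Basis"
  then obtain j where "i = axis j 1" by (auto simp: Basis_vec_def)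
  then show "(\<lambda>x. (\<chi> j. x j) \<bullet> i) \<in> borel_measurable (\<Pi>\<^sub>M j\<in>UNIV. (borel :: real measure))"
    by (simp add: inner_axis)
qed

text \<open>Links the vector space, where the Gaussian limit has its density, with the product of
  real lines, where independence is expressed. Both measures give a box the product of its side
  lengths.\<close>

lemma lborel_vec_eq:
  "(lborel :: (real^'k::finite) measure) = distr (\<Pi>\<^sub>M j\<in>UNIV. lborel) borel (\<lambda>x. \<chi> j. x j)"
proof (rule lborel_eqI)
  interpret L: product_sigma_finite "\<lambda>_::'k. lborel :: real measure" ..
  have m: "(\<lambda>x. (\<chi> j. x j) :: real^'k) \<in> borel_measurable (\<Pi>\<^sub>M j\<in>UNIV. (lborel :: real measure))"
    using measurable_vec_lambda by (simp cong: measurable_cong_sets sets_PiM_cong)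
  fix x y :: "real^'k" assume le: "\<And>b. b \<in> Basis \<Longrightarrow> x \<bullet> b \<le> y \<bullet> b"
  have le': "x $ j \<le> y $ j" for j
    using le[of "axis j 1"] by (simp add: inner_axis axis_in_Basis_iff)
  have "(\<lambda>x. (\<chi> j. x j) :: real^'k) -` box x y \<inter> space (\<Pi>\<^sub>M j\<in>(UNIV::'k set). (lborel :: real measure)) = Pi\<^sub>E UNIV (\<lambda>j. {x $ j<..<y $ j})"
    by (auto simp: space_PiM mem_box_cart PiE_iff)
  then have "emeasure (distr (\<Pi>\<^sub>M j\<in>UNIV. lborel) borel (\<lambda>x. (\<chi> j. x j) :: real^'k)) (box x y)
      = emeasure (\<Pi>\<^sub>M j\<in>(UNIV::'k set). (lborel :: real measure)) (Pi\<^sub>E UNIV (\<lambda>j. {x $ j<..<y $ j}))"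
    using m by (subst emeasure_distr) auto
  also have "\<dots> = (\<Prod>j\<in>UNIV. emeasure lborel {x $ j<..<y $ j})"
    by (intro L.emeasure_PiM) auto
  also have "\<dots> = (\<Prod>j\<in>UNIV. ennreal (y $ j - x $ j))"
    using le' by simp
  also have "\<dots> = ennreal (\<Prod>j\<in>UNIV. y $ j - x $ j)"
    using le' by (intro prod_ennreal) auto
  also have "(\<Prod>j\<in>UNIV. y $ j - x $ j) = (\<Prod>b\<in>Basis. (y - x) \<bullet> b)"
  proof -
    have B: "Basis = range (\<lambda>j. axis j (1::real) :: real^'k)" by (auto simp: Basis_vec_def)
    have inj: "inj (\<lambda>j. axis j (1::real) :: real^'k)" by (auto simp: inj_def axis_eq_axis)
    show ?thesis unfolding B prod.reindex[OF inj] by (simp add: inner_axis)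
  qed
  finally show "emeasure (distr (\<Pi>\<^sub>M j\<in>UNIV. lborel) borel (\<lambda>x. (\<chi> j. x j) :: real^'k)) (box x y) = (\<Prod>b\<in>Basis. (y - x) \<bullet> b)" .
qed simp

abbreviation "normal_law \<sigma> \<equiv> density lborel (\<lambda>x. ennreal (normal_density 0 \<sigma> x))"

lemma gaussian_diag_eq:
  fixes v :: "'k::finite \<Rightarrow> real"
  assumes v: "\<And>j. 0 < v j"
  shows "gaussian_diag v = distr (\<Pi>\<^sub>M j\<in>UNIV. normal_law (sqrt (v j))) borel (\<lambda>x. \<chi> j. x j)"
proof -
  interpret L: product_sigma_finite "\<lambda>_::'k. lborel :: real measure" ..
  have ps: "prob_space (normal_law (sqrt (v j)))" for j
    using prob_space_normal_density[of "sqrt (v j)" 0] v by simp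
  interpret N: product_prob_space "\<lambda>j. normal_law (sqrt (v j))" by (rule product_prob_spaceI) (rule ps)
  let ?L = "\<Pi>\<^sub>M j\<in>(UNIV::'k set). (lborel :: real measure)"
  let ?d = "\<lambda>x. \<Prod>j\<in>UNIV. ennreal (normal_density 0 (sqrt (v j)) (x j))"
  have m: "(\<lambda>x. (\<chi> j. x j) :: real^'k) \<in> borel_measurable ?L"
    using measurable_vec_lambda by (simp cong: measurable_cong_sets sets_PiM_cong)
  have "density ?L ?d = (\<Pi>\<^sub>M j\<in>UNIV. normal_law (sqrt (v j)))"
  proof (rule N.PiM_eqI)
    show "sets (density ?L ?d) = sets (\<Pi>\<^sub>M j\<in>UNIV. normal_law (sqrt (v j)))"
      by (simp, intro sets_PiM_cong) auto
    fix A :: "'k \<Rightarrow> real set" assume "\<And>i. i \<in> UNIV \<Longrightarrow> A i \<in> sets (normal_law (sqrt (v i)))"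
    then have A [measurable]: "A i \<in> sets borel" for i by simp
    have "emeasure (density ?L ?d) (Pi\<^sub>E UNIV A) = (\<integral>\<^sup>+x. ?d x * indicator (Pi\<^sub>E UNIV A) x \<partial>?L)"
      by (subst emeasure_density) (auto intro!: sets_PiM_I_finite)
    also have "\<dots> = (\<integral>\<^sup>+x. (\<Prod>j\<in>UNIV. ennreal (normal_density 0 (sqrt (v j)) (x j)) * indicator (A j) (x j)) \<partial>?L)"
    proof (rule nn_integral_cong)
      fix x :: "'k \<Rightarrow> real"
      have "(indicator (Pi\<^sub>E UNIV A) x :: ennreal) = (\<Prod>j\<in>UNIV. indicator (A j) (x j))"
        by (auto simp: indicator_def PiE_iff prod.neutral intro!: prod_zero)
      then show "?d x * indicator (Pi\<^sub>E UNIV A) x = (\<Prod>j\<in>UNIV. ennreal (normal_density 0 (sqrt (v j)) (x j)) * indicator (A j) (x j))"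
        by (simp add: prod.distrib)
    qed
    also have "\<dots> = (\<Prod>j\<in>UNIV. \<integral>\<^sup>+t. ennreal (normal_density 0 (sqrt (v j)) t) * indicator (A j) t \<partial>lborel)"
      by (rule L.product_nn_integral_prod) auto
    also have "\<dots> = (\<Prod>j\<in>UNIV. emeasure (normal_law (sqrt (v j))) (A j))"
      by (intro prod.cong refl) (simp add: emeasure_density)
    finally show "emeasure (density ?L ?d) (Pi\<^sub>E UNIV A) = (\<Prod>j\<in>UNIV. emeasure (normal_law (sqrt (v j))) (A j))" .
  qed simp
  moreover have "gaussian_diag v = distr (density ?L ?d) borel (\<lambda>x. \<chi> j. x j)"
  proof -
    let ?g = "\<lambda>x::real^'k. ennreal (\<Prod>j\<in>UNIV. normal_density 0 (sqrt (v j)) (x $ j))"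
    have g: "?g \<in> borel_measurable borel"
      by measurable
    have "gaussian_diag v = density (distr ?L borel (\<lambda>x. \<chi> j. x j)) ?g"
      unfolding gaussian_diag_def lborel_vec_eq[symmetric] ..
    also have "\<dots> = distr (density ?L (\<lambda>x. ?g (\<chi> j. x j))) borel (\<lambda>x. \<chi> j. x j)"
      by (rule density_distr[OF g m])
    also have "(\<lambda>x. ?g (\<chi> j. x j)) = ?d" by (simp add: prod_ennreal)
    finally show ?thesis .
  qed
  ultimately show ?thesis by simp
qed

lemma real_distribution_normal_law: "0 < \<sigma> \<Longrightarrow> real_distribution (normal_law \<sigma>)"
  using prob_space_normal_density[of \<sigma> 0]
  by (simp add: real_distribution_def real_distribution_axioms_def)

lemma char_normal_law:
  assumes "0 < \<sigma>"
  shows "char (normal_law \<sigma>) s = of_real (exp (- (s^2 / 2) * \<sigma>^2))"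
proof -
  interpret S: real_distribution std_normal_distribution by (rule real_dist_normal_dist)
  have "distributed std_normal_distribution lborel (\<lambda>x. x) (normal_density 0 1)"
    by (auto simp: distributed_def distr_id2)
  from S.normal_density_affine[OF this, of \<sigma> 0] assms
  have "distributed std_normal_distribution lborel (\<lambda>x. \<sigma> * x) (normal_density 0 \<sigma>)" by simp
  from distributed_distr_eq_density[OF this]
  have eq: "normal_law \<sigma> = distr std_normal_distribution lborel (\<lambda>x. \<sigma> * x)" by simp
  have "char (normal_law \<sigma>) s = char std_normal_distribution (s * \<sigma>)"
    unfolding char_def eq by (subst integral_distr) (auto simp: mult_ac)
  then show ?thesis by (simp add: char_std_normal_distribution power_mult_distrib)
qed

text \<open>Each marginal sequence is realised on its own space by variables that converge
  everywhere. On the product of these spaces the coordinates are independent and the vectors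
  converge pointwise, so dominated convergence finishes the argument.\<close>

lemma product_weak_convergence:
  fixes \<mu> :: "'k::finite \<Rightarrow> nat \<Rightarrow> real measure" and M :: "'k \<Rightarrow> real measure" and f :: "real^'k \<Rightarrow> real"
  assumes mu: "\<And>j n. real_distribution (\<mu> j n)" and M: "\<And>j. real_distribution (M j)"
    and conv: "\<And>j. weak_conv_m (\<mu> j) (M j)"
    and f: "continuous_on UNIV f" "\<And>x. \<bar>f x\<bar> \<le> B"
  shows "(\<lambda>n. \<integral>x. f (\<chi> j. x j) \<partial>(\<Pi>\<^sub>M j\<in>UNIV. \<mu> j n)) \<longlonglongrightarrow> (\<integral>x. f (\<chi> j. x j) \<partial>(\<Pi>\<^sub>M j\<in>UNIV. M j))"
proof -
  have fm [measurable]: "f \<in> borel_measurable borel" by (rule borel_measurable_continuous_onI[OF f(1)])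
  have "\<forall>j. \<exists>(\<Omega> :: real measure) (Yn :: nat \<Rightarrow> real \<Rightarrow> real) (Y :: real \<Rightarrow> real).
    prob_space \<Omega> \<and> (\<forall>n. Yn n \<in> measurable \<Omega> borel) \<and> (\<forall>n. distr \<Omega> borel (Yn n) = \<mu> j n) \<and>
    Y \<in> measurable \<Omega> lborel \<and> distr \<Omega> borel Y = M j \<and> (\<forall>x \<in> space \<Omega>. (\<lambda>n. Yn n x) \<longlonglongrightarrow> Y x)"
    using Skorohod[OF mu M conv] by blast
  then obtain \<Omega> Yn Y where S:
    "\<And>j. prob_space (\<Omega> j)" "\<And>j n. Yn j n \<in> measurable (\<Omega> j :: real measure) (borel :: real measure)"
    "\<And>j n. distr (\<Omega> j) borel (Yn j n) = \<mu> j n" "\<And>j. Y j \<in> measurable (\<Omega> j) (lborel :: real measure)"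
    "\<And>j. distr (\<Omega> j) borel (Y j) = M j" "\<And>j x. x \<in> space (\<Omega> j) \<Longrightarrow> (\<lambda>n. Yn j n x) \<longlonglongrightarrow> Y j x"
    by metis
  note S(2)[measurable]
  have [measurable]: "Y j \<in> borel_measurable (\<Omega> j)" for j using S(4)[of j] by simp
  interpret O: product_prob_space \<Omega> UNIV by (rule product_prob_spaceI) (rule S(1))
  let ?O = "\<Pi>\<^sub>M j\<in>UNIV. \<Omega> j"
  have comp: "(\<integral>x. f (\<chi> j. x j) \<partial>(\<Pi>\<^sub>M j\<in>UNIV. distr (\<Omega> j) borel (Z j))) = (\<integral>\<omega>. f (\<chi> j. Z j (\<omega> j)) \<partial>?O)"
    and meas: "(\<lambda>\<omega>. f (\<chi> j. Z j (\<omega> j))) \<in> borel_measurable ?O"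
    if Z [measurable]: "\<And>j. Z j \<in> borel_measurable (\<Omega> j)" for Z :: "'k \<Rightarrow> real \<Rightarrow> real"
  proof -
    have m: "(\<lambda>x j. Z j (x j)) \<in> measurable ?O (\<Pi>\<^sub>M j\<in>UNIV. borel)"
      by (rule measurable_PiM_single') (auto simp: space_PiM PiE_iff)
    have fl: "(\<lambda>x. f (\<chi> j. x j)) \<in> borel_measurable (\<Pi>\<^sub>M j\<in>UNIV. borel)" by measurable
    show "(\<lambda>\<omega>. f (\<chi> j. Z j (\<omega> j))) \<in> borel_measurable ?O"
      using measurable_compose[OF m fl] .
    show "(\<integral>x. f (\<chi> j. x j) \<partial>(\<Pi>\<^sub>M j\<in>UNIV. distr (\<Omega> j) borel (Z j))) = (\<integral>\<omega>. f (\<chi> j. Z j (\<omega> j)) \<partial>?O)"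
      unfolding distr_PiM_componentwise[OF S(1) Z, symmetric]
      by (rule integral_distr[OF m fl])
  qed
  have "(\<lambda>n. \<integral>\<omega>. f (\<chi> j. Yn j n (\<omega> j)) \<partial>?O) \<longlonglongrightarrow> (\<integral>\<omega>. f (\<chi> j. Y j (\<omega> j)) \<partial>?O)"
  proof (rule integral_dominated_convergence[where w="\<lambda>_. B"])
    show "AE \<omega> in ?O. (\<lambda>n. f (\<chi> j. Yn j n (\<omega> j))) \<longlonglongrightarrow> f (\<chi> j. Y j (\<omega> j))"
    proof (rule AE_I2)
      fix \<omega> assume "\<omega> \<in> space ?O"
      then have "(\<lambda>n. Yn j n (\<omega> j)) \<longlonglongrightarrow> Y j (\<omega> j)" for j
        using S(6) by (auto simp: space_PiM PiE_iff)
      then have "(\<lambda>n. (\<chi> j. Yn j n (\<omega> j))) \<longlonglongrightarrow> (\<chi> j. Y j (\<omega> j))"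
        by (intro vec_tendstoI) auto
      then show "(\<lambda>n. f (\<chi> j. Yn j n (\<omega> j))) \<longlonglongrightarrow> f (\<chi> j. Y j (\<omega> j))"
        using f(1) by (auto intro: continuous_on_tendsto_compose)
    qed
  qed (auto simp: f(2) intro!: meas O.P.integrable_const)
  then show ?thesis
    using comp[of "\<lambda>j. Yn j n" for n] comp[of Y] S(3,5) by simp
qed

text \<open>Shaped so that its expectation is controlled by two second moments. If \<open>v\<close>
  is large the middle term exceeds \<open>2 * B\<close>; if \<open>u - v\<close> is not small the
  last one does; otherwise both points lie in a ball on which \<open>f\<close> is uniformly
  continuous.\<close>

lemma bounded_continuous_perturbation:
  fixes f :: "'a::euclidean_space \<Rightarrow> real"
  assumes f: "continuous_on UNIV f" "\<And>x. \<bar>f x\<bar> \<le> B" and e: "0 < \<epsilon>"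
  shows "\<exists>C. \<forall>u v. \<bar>f u - f v\<bar> \<le> \<epsilon> + \<epsilon> * (norm v)^2 + C * (norm (u - v))^2"
proof -
  have B: "0 \<le> B" using f(2)[of 0] by linarith
  \<comment> \<open>Large enough that \<open>2 * B <= eps * r^2\<close>, so a trivial bound suffices
    outside radius \<open>r\<close>. The summand 1 makes \<open>r\<close> at most its
    square.\<close>
  define r where "r = 2 * B / \<epsilon> + 1"
  have r: "1 \<le> r" "2 * B \<le> \<epsilon> * r^2"
  proof -
    show "1 \<le> r" using B e by (simp add: r_def)
    then have "r \<le> r^2" by (simp add: power2_eq_square)
    then have "\<epsilon> * r \<le> \<epsilon> * r^2" using e by simp
    moreover have "2 * B \<le> \<epsilon> * r" using e by (simp add: r_def field_simps)
    ultimately show "2 * B \<le> \<epsilon> * r^2" by linarith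
  qed
  have "uniformly_continuous_on (cball 0 (r + 1)) f"
    by (intro compact_uniformly_continuous continuous_on_subset[OF f(1)]) auto
  then obtain d where d: "0 < d" "\<And>u v. u \<in> cball 0 (r + 1) \<Longrightarrow> v \<in> cball 0 (r + 1) \<Longrightarrow> dist u v < d \<Longrightarrow> dist (f u) (f v) < \<epsilon>"
    using e unfolding uniformly_continuous_on_def by metis
  define \<delta> where "\<delta> = min d 1"
  have \<delta>: "0 < \<delta>" "\<delta> \<le> d" "\<delta> \<le> 1" using d(1) by (auto simp: \<delta>_def)
  have "\<bar>f u - f v\<bar> \<le> \<epsilon> + \<epsilon> * (norm v)^2 + (2 * B / \<delta>^2) * (norm (u - v))^2" for u v
  proof -
    have le2B: "\<bar>f u - f v\<bar> \<le> 2 * B" using f(2)[of u] f(2)[of v] by linarith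
    have n1: "0 \<le> \<epsilon> * (norm v)^2" "0 \<le> (2 * B / \<delta>^2) * (norm (u - v))^2" using e B by auto
    consider "r < norm v" | "\<delta> \<le> norm (u - v)" | "norm v \<le> r" "norm (u - v) < \<delta>" by linarith
    then show ?thesis
    proof cases
      case 1
      then have "\<epsilon> * r^2 \<le> \<epsilon> * (norm v)^2" using e r(1) by (intro mult_left_mono power_mono) auto
      then show ?thesis using le2B r(2) n1 e by linarith
    next
      case 2
      then have "\<delta>^2 \<le> (norm (u - v))^2" using \<delta> by (intro power_mono) auto
      then have "2 * B * \<delta>^2 \<le> 2 * B * (norm (u - v))^2" using B by (intro mult_left_mono) auto
      then have "2 * B \<le> (2 * B / \<delta>^2) * (norm (u - v))^2" using \<delta>(1) by (simp add: field_simps)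
      then show ?thesis using le2B n1 e by linarith
    next
      case 3
      have "norm u \<le> norm v + norm (u - v)" using norm_triangle_sub[of u v] by simp
      then have "dist (f u) (f v) < \<epsilon>" using 3 \<delta> by (intro d(2)) (auto simp: dist_norm)
      then show ?thesis using n1 unfolding dist_real_def by linarith
    qed
  qed
  then show ?thesis by blast
qed

text \<open>A Slutsky argument in mean square: weak limits pass from \<open>v\<close> to
  \<open>u\<close> when second moments of \<open>v\<close> are bounded and those of the difference
  vanish. It carries the limit from the scores to the estimator.\<close>

lemma weak_limit_perturbation:
  fixes u v :: "nat \<Rightarrow> 'x \<Rightarrow> 'a::euclidean_space" and f :: "'a \<Rightarrow> real"
  assumes f: "continuous_on UNIV f" "\<And>x. \<bar>f x\<bar> \<le> B"
    and M: "\<And>n. 1 \<le> n \<Longrightarrow> prob_space (M n)"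
    and um: "\<And>n. 1 \<le> n \<Longrightarrow> u n \<in> borel_measurable (M n)" and vm: "\<And>n. 1 \<le> n \<Longrightarrow> v n \<in> borel_measurable (M n)"
    and vi: "\<And>n. 1 \<le> n \<Longrightarrow> integrable (M n) (\<lambda>x. (norm (v n x))^2)"
    and vS: "\<And>n. 1 \<le> n \<Longrightarrow> (\<integral>x. (norm (v n x))^2 \<partial>M n) \<le> S"
    and di: "\<And>n. 1 \<le> n \<Longrightarrow> integrable (M n) (\<lambda>x. (norm (u n x - v n x))^2)"
    and d0: "(\<lambda>n. \<integral>x. (norm (u n x - v n x))^2 \<partial>M n) \<longlonglongrightarrow> 0"
    and lim: "(\<lambda>n. \<integral>x. f (v n x) \<partial>M n) \<longlonglongrightarrow> L"
  shows "(\<lambda>n. \<integral>x. f (u n x) \<partial>M n) \<longlonglongrightarrow> L"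
proof -
  have fm: "f \<in> borel_measurable borel" by (rule borel_measurable_continuous_onI[OF f(1)])
  have "0 \<le> (\<integral>x. (norm (v 1 x))^2 \<partial>M 1)" by simp
  then have S0: "0 \<le> S" using vS[of 1] by linarith
  have "(\<lambda>n. (\<integral>x. f (u n x) \<partial>M n) - (\<integral>x. f (v n x) \<partial>M n)) \<longlonglongrightarrow> 0"
  proof (rule LIMSEQ_I)
    fix r :: real assume r: "0 < r"
    define \<epsilon> where "\<epsilon> = r / (2 * (1 + S))"
    have e: "0 < \<epsilon>" using r S0 by (simp add: \<epsilon>_def)
    have eS: "\<epsilon> + \<epsilon> * S = r / 2"
    proof -
      have "\<epsilon> + \<epsilon> * S = \<epsilon> * (1 + S)" by (simp add: algebra_simps)
      also have "\<dots> = r / 2" unfolding \<epsilon>_def using S0 by (simp only: times_divide_eq_left) (simp add: divide_eq_eq)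
      finally show ?thesis .
    qed
    from bounded_continuous_perturbation[OF f e] obtain C where
      C: "\<And>u v. \<bar>f u - f v\<bar> \<le> \<epsilon> + \<epsilon> * (norm v)^2 + C * (norm (u - v))^2" by blast
    have "(\<lambda>n. C * (\<integral>x. (norm (u n x - v n x))^2 \<partial>M n)) \<longlonglongrightarrow> 0"
      using tendsto_mult_left[OF d0, of C] by simp
    from LIMSEQ_D[OF this, of "r / 2"] r obtain N where
      "\<forall>n\<ge>N. norm (C * (\<integral>x. (norm (u n x - v n x))^2 \<partial>M n) - 0) < r / 2" by auto
    then have N: "\<bar>C * (\<integral>x. (norm (u n x - v n x))^2 \<partial>M n)\<bar> < r / 2" if "N \<le> n" for n
      using that by (simp only: diff_zero real_norm_def)
    show "\<exists>no. \<forall>n\<ge>no. norm ((\<integral>x. f (u n x) \<partial>M n) - (\<integral>x. f (v n x) \<partial>M n) - 0) < r"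
    proof (intro exI[of _ "max N 1"] allI impI)
      fix n assume n: "max N 1 \<le> n"
      then have n1: "1 \<le> n" and nN: "N \<le> n" by auto
      interpret prob_space "M n" by (rule M[OF n1])
      have fu: "integrable (M n) (\<lambda>x. f (u n x))" and fv: "integrable (M n) (\<lambda>x. f (v n x))"
        using measurable_compose[OF um[OF n1] fm] measurable_compose[OF vm[OF n1] fm]
        by (auto intro!: integrable_const_bound[of _ B] simp: f(2))
      have "\<bar>(\<integral>x. f (u n x) \<partial>M n) - (\<integral>x. f (v n x) \<partial>M n)\<bar> = \<bar>\<integral>x. f (u n x) - f (v n x) \<partial>M n\<bar>"
        using fu fv by simp
      also have "\<dots> \<le> (\<integral>x. \<bar>f (u n x) - f (v n x)\<bar> \<partial>M n)" by (rule integral_abs_bound)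
      also have "\<dots> \<le> (\<integral>x. \<epsilon> + \<epsilon> * (norm (v n x))^2 + C * (norm (u n x - v n x))^2 \<partial>M n)"
        using fu fv vi[OF n1] di[OF n1] by (intro integral_mono C) auto
      also have "\<dots> = \<epsilon> + \<epsilon> * (\<integral>x. (norm (v n x))^2 \<partial>M n) + C * (\<integral>x. (norm (u n x - v n x))^2 \<partial>M n)"
        using vi[OF n1] di[OF n1] by (simp add: prob_space)
      also have "\<dots> \<le> \<epsilon> + \<epsilon> * S + C * (\<integral>x. (norm (u n x - v n x))^2 \<partial>M n)"
        using e vS[OF n1] by simp
      also have "\<dots> < r" using N[OF nN] unfolding eS by linarith
      finally show "norm ((\<integral>x. f (u n x) \<partial>M n) - (\<integral>x. f (v n x) \<partial>M n) - 0) < r" by simp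
    qed
  qed
  from tendsto_add[OF this lim] show ?thesis by simp
qed

text \<open>Bounded second moments of \<open>f\<close> give uniform integrability: cutting
  \<open>f\<close> at height \<open>b\<close> costs at most \<open>C / b\<close> under every law.
  The limit law inherits the bound \<open>C\<close>, by weak convergence of truncated squares and
  Fatou's lemma.\<close>

lemma weak_conv_moment:
  fixes f :: "'a::metric_space \<Rightarrow> real"
  assumes wc: "weak_conv M M0" and M0: "prob_space M0" "sets M0 = sets borel"
    and M: "\<And>n. 1 \<le> n \<Longrightarrow> prob_space (M n)" "\<And>n. sets (M n) = sets borel"
    and f: "continuous_on UNIV f"
    and f2: "\<And>n. 1 \<le> n \<Longrightarrow> integrable (M n) (\<lambda>x. (f x)^2)" "\<And>n. 1 \<le> n \<Longrightarrow> (\<integral>x. (f x)^2 \<partial>M n) \<le> C"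
  shows "(\<lambda>n. \<integral>x. f x \<partial>M n) \<longlonglongrightarrow> (\<integral>x. f x \<partial>M0)"
proof -
  interpret M0: prob_space M0 by fact
  have fm: "f \<in> borel_measurable borel" by (rule borel_measurable_continuous_onI[OF f])
  have fm0 [measurable]: "f \<in> borel_measurable M0" using fm by (simp add: measurable_cong_sets[OF M0(2) refl])
  have fmn: "f \<in> borel_measurable (M n)" for n using fm by (simp add: measurable_cong_sets[OF M(2) refl])
  have wcD: "(\<lambda>n. \<integral>x. g x \<partial>M n) \<longlonglongrightarrow> (\<integral>x. g x \<partial>M0)" if "continuous_on UNIV g" "\<And>x. \<bar>g x\<bar> \<le> b" for g :: "'a \<Rightarrow> real" and b
  proof -
    have "bounded (range g)" unfolding bounded_iff using that(2) by auto
    then show ?thesis using wc that(1) unfolding weak_conv_def by blast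
  qed
  have "0 \<le> (\<integral>x. (f x)^2 \<partial>M 1)" by simp
  then have C0: "0 \<le> C" using f2(2)[of 1] by linarith
  have trunc: "(\<integral>x. min ((f x)^2) (real b) \<partial>M0) \<le> C" for b
  proof (rule LIMSEQ_le_const2)
    show "(\<lambda>n. \<integral>x. min ((f x)^2) (real b) \<partial>M n) \<longlonglongrightarrow> (\<integral>x. min ((f x)^2) (real b) \<partial>M0)"
      by (rule wcD[of _ "real b"]) (auto intro!: continuous_intros f)
    show "\<exists>N. \<forall>n\<ge>N. (\<integral>x. min ((f x)^2) (real b) \<partial>M n) \<le> C"
    proof (intro exI[of _ 1] allI impI)
      fix n :: nat assume n: "1 \<le> n"
      interpret prob_space "M n" by (rule M(1)[OF n])
      have "(\<integral>x. min ((f x)^2) (real b) \<partial>M n) \<le> (\<integral>x. (f x)^2 \<partial>M n)"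
        using fmn by (intro integral_mono f2(1)[OF n] integrable_const_bound[of _ "real b"]) auto
      then show "(\<integral>x. min ((f x)^2) (real b) \<partial>M n) \<le> C" using f2(2)[OF n] by linarith
    qed
  qed
  have f20: "integrable M0 (\<lambda>x. (f x)^2)" and f2C: "(\<integral>x. (f x)^2 \<partial>M0) \<le> C"
  proof -
    have "(\<integral>\<^sup>+x. ennreal ((f x)^2) \<partial>M0) = (\<integral>\<^sup>+x. liminf (\<lambda>b. ennreal (min ((f x)^2) (real b))) \<partial>M0)"
    proof (rule nn_integral_cong)
      fix x
      have "(\<lambda>b. ennreal (min ((f x)^2) (real b))) \<longlonglongrightarrow> ennreal ((f x)^2)"
      proof (rule tendsto_eventually)
        obtain N :: nat where "(f x)^2 \<le> real N" using real_arch_simple by blast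
        then show "\<forall>\<^sub>F b in sequentially. ennreal (min ((f x)^2) (real b)) = ennreal ((f x)^2)"
          by (intro eventually_sequentiallyI[of N]) (auto simp: min_def)
      qed
      then show "ennreal ((f x)^2) = liminf (\<lambda>b. ennreal (min ((f x)^2) (real b)))"
        by (intro lim_imp_Liminf[symmetric]) auto
    qed
    also have "\<dots> \<le> liminf (\<lambda>b. \<integral>\<^sup>+x. ennreal (min ((f x)^2) (real b)) \<partial>M0)"
      by (rule nn_integral_liminf) measurable
    also have "\<dots> \<le> ennreal C"
    proof -
      have "(\<integral>\<^sup>+x. ennreal (min ((f x)^2) (real b)) \<partial>M0) \<le> ennreal C" for b
      proof -
        have "integrable M0 (\<lambda>x. min ((f x)^2) (real b))"
          by (rule M0.integrable_const_bound[of _ "real b"]) auto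
        then have "(\<integral>\<^sup>+x. ennreal (min ((f x)^2) (real b)) \<partial>M0) = ennreal (\<integral>x. min ((f x)^2) (real b) \<partial>M0)"
          by (intro nn_integral_eq_integral) auto
        then show ?thesis using trunc[of b] by (simp add: ennreal_leI)
      qed
      then have "liminf (\<lambda>b. \<integral>\<^sup>+x. ennreal (min ((f x)^2) (real b)) \<partial>M0) \<le> liminf (\<lambda>b::nat. ennreal C)"
        by (intro Liminf_mono) auto
      then show ?thesis by (simp add: Liminf_const)
    qed
    finally have le: "(\<integral>\<^sup>+x. ennreal ((f x)^2) \<partial>M0) \<le> ennreal C" .
    show i: "integrable M0 (\<lambda>x. (f x)^2)"
      by (rule integrableI_bounded) (use le in \<open>auto intro: le_less_trans\<close>)
    show "(\<integral>x. (f x)^2 \<partial>M0) \<le> C"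
      using le C0 nn_integral_eq_integral[OF i] by simp
  qed
  let ?t = "\<lambda>b x. max (- b) (min b (f x))"
  have cut: "\<bar>(\<integral>x. f x \<partial>N) - (\<integral>x. ?t b x \<partial>N)\<bar> \<le> C / b"
    if N: "prob_space N" "f \<in> borel_measurable N" "integrable N (\<lambda>x. (f x)^2)" "(\<integral>x. (f x)^2 \<partial>N) \<le> C" and b: "0 < b" for N b
  proof -
    interpret N: prob_space N by fact
    have ab: "\<bar>f x\<bar> \<le> 1 + (f x)^2" for x
      using zero_le_power2[of "\<bar>f x\<bar> - 1"] zero_le_power2[of "f x"] by (simp add: power2_eq_square algebra_simps)
    have fi: "integrable N f"
      by (rule Bochner_Integration.integrable_bound[of _ "\<lambda>x. 1 + (f x)^2"]) (use N ab in auto)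
    have ti: "integrable N (?t b)"
      by (rule N.integrable_const_bound[of _ b]) (use N b in auto)
    have pt: "\<bar>f x - ?t b x\<bar> \<le> (f x)^2 / b" for x
    proof (cases "\<bar>f x\<bar> \<le> b")
      case True then show ?thesis using b by (auto simp: max_def min_def)
    next
      case False
      then have "\<bar>f x\<bar> * b \<le> \<bar>f x\<bar> * \<bar>f x\<bar>" by (intro mult_left_mono) auto
      then have "\<bar>f x\<bar> \<le> (f x)^2 / b" using b by (simp add: field_simps power2_eq_square)
      moreover have "\<bar>f x - ?t b x\<bar> \<le> \<bar>f x\<bar>" using b False by (auto simp: max_def min_def)
      ultimately show ?thesis by linarith
    qed
    have "\<bar>(\<integral>x. f x \<partial>N) - (\<integral>x. ?t b x \<partial>N)\<bar> = \<bar>\<integral>x. f x - ?t b x \<partial>N\<bar>" using fi ti by simp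
    also have "\<dots> \<le> (\<integral>x. \<bar>f x - ?t b x\<bar> \<partial>N)" by (rule integral_abs_bound)
    also have "\<dots> \<le> (\<integral>x. (f x)^2 / b \<partial>N)" using fi ti N(3) by (intro integral_mono pt) auto
    also have "\<dots> \<le> C / b" using N(4) b by (simp add: divide_right_mono)
    finally show ?thesis .
  qed
  show ?thesis
  proof (rule LIMSEQ_I)
    fix r :: real assume r: "0 < r"
    \<comment> \<open>Makes each of the two truncation errors smaller than \<open>r / 3\<close>; the
      remaining third goes to the truncated integrals.\<close>
    define b where "b = 3 * (C + 1) / r"
    have b: "0 < b" using C0 r by (simp add: b_def)
    have Cb: "C / b < r / 3" using C0 r by (simp add: b_def field_simps)
    have "(\<lambda>n. \<integral>x. ?t b x \<partial>M n) \<longlonglongrightarrow> (\<integral>x. ?t b x \<partial>M0)"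
      using b by (intro wcD[of _ b]) (auto intro!: continuous_intros f)
    then obtain N where N: "\<And>n. N \<le> n \<Longrightarrow> \<bar>(\<integral>x. ?t b x \<partial>M n) - (\<integral>x. ?t b x \<partial>M0)\<bar> < r / 3"
      using r LIMSEQ_D[of _ _ "r / 3"] by (metis real_norm_def zero_less_divide_iff zero_less_numeral)
    show "\<exists>no. \<forall>n\<ge>no. norm ((\<integral>x. f x \<partial>M n) - (\<integral>x. f x \<partial>M0)) < r"
    proof (intro exI[of _ "max N 1"] allI impI)
      fix n assume n: "max N 1 \<le> n"
      then have n1: "1 \<le> n" and nN: "N \<le> n" by auto
      show "norm ((\<integral>x. f x \<partial>M n) - (\<integral>x. f x \<partial>M0)) < r"
        using N[OF nN] Cb cut[OF M(1)[OF n1] fmn f2[OF n1] b] cut[OF M0(1) fm0 f20 f2C b]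
        unfolding real_norm_def by linarith
    qed
  qed
qed

text \<open>Suprema differ by no more than the uniform distance. Boundedness of \<open>G\<close>
  passes to \<open>F n\<close>, without which the real \<open>Sup\<close> would carry no
  information.\<close>

lemma Sup_uniform_limit:
  fixes F :: "nat \<Rightarrow> 'a \<Rightarrow> real"
  assumes S: "S \<noteq> {}" and bdd: "bdd_above (G ` S)"
    and F: "\<And>n x. 1 \<le> n \<Longrightarrow> x \<in> S \<Longrightarrow> \<bar>F n x - G x\<bar> \<le> e n" and e: "e \<longlonglongrightarrow> 0"
  shows "(\<lambda>n. Sup (F n ` S)) \<longlonglongrightarrow> Sup (G ` S)"
proof (rule Lim_null[THEN iffD2], rule Lim_null_comparison[OF _ e])
  show "\<forall>\<^sub>F n in sequentially. norm (Sup (F n ` S) - Sup (G ` S)) \<le> e n"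
    using eventually_ge_at_top[of 1]
  proof eventually_elim
    case (elim n)
    have le: "F n x \<le> G x + e n" "G x \<le> F n x + e n" if "x \<in> S" for x
      using F[OF elim that] by linarith+
    obtain c where c: "\<And>x. x \<in> S \<Longrightarrow> G x \<le> c" using bdd by (auto simp: bdd_above_def)
    have bn: "bdd_above (F n ` S)"
      by (rule bdd_aboveI2[of _ _ "c + e n"]) (use le(1) c in \<open>fastforce intro: order_trans\<close>)
    have "Sup (F n ` S) \<le> Sup (G ` S) + e n"
      using S order_trans[OF le(1) add_right_mono[OF cSUP_upper[OF _ bdd]]] by (intro cSUP_least) auto
    moreover have "Sup (G ` S) \<le> Sup (F n ` S) + e n"
      using S order_trans[OF le(2) add_right_mono[OF cSUP_upper[OF _ bn]]] by (intro cSUP_least) auto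
    ultimately show ?case by simp
  qed
qed

section \<open>Arrays of independent detectors\<close>

lemma norm_vec_power2: "(norm (x :: real^'k::finite))^2 = (\<Sum>j\<in>UNIV. (x $ j)^2)"
  unfolding power2_norm_eq_inner inner_vec_def by (simp add: power2_eq_square)

lemma max_coordinate: "\<exists>i. \<forall>j. \<bar>(x :: real^'k::finite) $ j\<bar> \<le> \<bar>x $ i\<bar>"
proof -
  have "Max (range (\<lambda>j. \<bar>x $ j\<bar>)) \<in> range (\<lambda>j. \<bar>x $ j\<bar>)" by (intro Max_in) auto
  then obtain i where i: "Max (range (\<lambda>j. \<bar>x $ j\<bar>)) = \<bar>x $ i\<bar>" by (metis imageE)
  have "\<bar>x $ j\<bar> \<le> \<bar>x $ i\<bar>" for j unfolding i[symmetric] by (intro Max_ge) auto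
  then show ?thesis by blast
qed

text \<open>Every coordinate is replaced by the largest one, which produces the total degree, and
  the largest power is at most the sum of all.\<close>

lemma monomial_square_le:
  fixes x :: "real^'k::finite"
  shows "(\<Prod>j\<in>UNIV. (x $ j) ^ p j)^2 \<le> (\<Sum>j\<in>UNIV. \<bar>x $ j\<bar> ^ (2 * (\<Sum>i\<in>UNIV. p i)))"
proof -
  obtain i where i: "\<And>j. \<bar>x $ j\<bar> \<le> \<bar>x $ i\<bar>" using max_coordinate by blast
  have "(\<Prod>j\<in>UNIV. (x $ j) ^ p j)^2 = (\<Prod>j\<in>UNIV. \<bar>x $ j\<bar> ^ (2 * p j))"
    unfolding power2_abs[of "\<Prod>j\<in>UNIV. (x $ j) ^ p j", symmetric] abs_prod
    by (simp add: prod_power_distrib power_abs power_mult[symmetric] mult.commute)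
  also have "\<dots> \<le> (\<Prod>j\<in>UNIV. \<bar>x $ i\<bar> ^ (2 * p j))"
    by (intro prod_mono conjI power_mono i) auto
  also have "\<dots> = \<bar>x $ i\<bar> ^ (2 * (\<Sum>j\<in>UNIV. p j))"
    by (simp add: power_sum[symmetric] sum_distrib_left)
  also have "\<dots> \<le> (\<Sum>j\<in>UNIV. \<bar>x $ j\<bar> ^ (2 * (\<Sum>i\<in>UNIV. p i)))"
    by (rule member_le_sum) auto
  finally show ?thesis .
qed

lemma norm_power4_le:
  fixes x :: "real^'k::finite"
  shows "((norm x)^2)^2 \<le> (real CARD('k))^2 * (\<Sum>j\<in>UNIV. \<bar>x $ j\<bar> ^ 4)"
proof -
  obtain i where i: "\<And>j. \<bar>x $ j\<bar> \<le> \<bar>x $ i\<bar>" using max_coordinate by blast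
  have "(norm x)^2 \<le> (\<Sum>j\<in>(UNIV::'k set). \<bar>x $ i\<bar>^2)"
    unfolding norm_vec_power2 using i by (intro sum_mono) (metis abs_ge_zero power2_abs power_mono)
  then have "((norm x)^2)^2 \<le> (real CARD('k) * \<bar>x $ i\<bar>^2)^2"
    by (intro power_mono) auto
  also have "\<dots> = (real CARD('k))^2 * \<bar>x $ i\<bar> ^ 4"
    by (simp add: power_mult_distrib power_mult[symmetric])
  also have "\<dots> \<le> (real CARD('k))^2 * (\<Sum>j\<in>UNIV. \<bar>x $ j\<bar> ^ 4)"
    by (intro mult_left_mono member_le_sum[of i UNIV "\<lambda>j. \<bar>x $ j\<bar> ^ 4"]) auto
  finally show ?thesis .
qed

lemma le_sum_abs: fixes f :: "'k::finite \<Rightarrow> real" shows "f j \<le> (\<Sum>i\<in>UNIV. \<bar>f i\<bar>)"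
proof -
  have "\<bar>f j\<bar> \<le> (\<Sum>i\<in>UNIV. \<bar>f i\<bar>)" by (rule member_le_sum) auto
  then show ?thesis by linarith
qed

text \<open>The sigma-algebra depends on none of the parameters, so an estimator measurable under
  the true law is measurable under all neighbouring ones.\<close>

lemma sets_obs_law:
  "sets (obs_law n T lam0 l tau) = sets (\<Pi>\<^sub>M j\<in>(UNIV::'k::finite set). path_space)"
  unfolding obs_law_def by (intro sets_PiM_cong refl) (simp add: sets_poisson_process)

locale detector_array =
  fixes T lam0 :: real and a b B :: "'k::finite \<Rightarrow> real" and l l1 l2 :: "'k \<Rightarrow> real \<Rightarrow> real"
    and est :: "nat \<Rightarrow> ('k \<Rightarrow> path) \<Rightarrow> real^'k"
  assumes det: "\<And>j. detector T lam0 (a j) (b j) (B j) (l j) (l1 j) (l2 j)"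
    and est_measurable: "\<And>n tau. est n \<in> borel_measurable (obs_law n T lam0 l tau)"
    and est_mle: "\<And>n X j. est n X $ j \<in> {a j..b j} \<and>
      (\<forall>tau\<in>{a j..b j}. lik n T lam0 (l j) tau (X j) \<le> lik n T lam0 (l j) (est n X $ j) (X j))"
begin

sublocale D: detector T lam0 "a j" "b j" "B j" "l j" "l1 j" "l2 j" for j by (rule det)

abbreviation "Q n tau \<equiv> obs_law n T lam0 l tau"

section \<open>Moments, linearisation and quadratic risk of the vector estimator\<close>

definition F :: "'k \<Rightarrow> real \<Rightarrow> real" where "F j = fisher_delay T lam0 (l j) (l1 j)"

definition err :: "nat \<Rightarrow> real^'k \<Rightarrow> ('k \<Rightarrow> path) \<Rightarrow> real^'k" where
  "err n tau X = sqrt (real n) *\<^sub>R (est n X - tau)"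

definition score :: "'k \<Rightarrow> nat \<Rightarrow> real \<Rightarrow> path \<Rightarrow> real" where
  "score j n ts X = D.z1 j n ts ts X"

abbreviation "valid tau \<equiv> \<forall>j. tau $ j \<in> {a j..b j}"
abbreviation "inset rho tau \<equiv> \<forall>j. tau $ j \<in> {a j + rho..b j - rho}"
abbreviation "risk n tau \<equiv> \<integral>X. (norm (err n tau X))^2 \<partial>Q n tau"
abbreviation "rem n tau j X \<equiv> F j (tau $ j) * err n tau X $ j - score j n (tau $ j) (X j)"

lemma inner_valid:
  assumes "0 < rho" "inset rho tau" shows "valid tau"
proof
  fix j show "tau $ j \<in> {a j..b j}" using spec[OF assms(2), of j] assms(1) by auto
qed

lemma is_mle: "D.is_mle j n (X j) (est n X $ j)"
  using est_mle[where n=n and X=X and j=j] by (simp add: D.is_mle_def)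

lemma Q_eq: "Q n tau = (\<Pi>\<^sub>M j\<in>UNIV. D.P j n (tau $ j))"
  by (simp add: obs_law_def)

lemma prob_Q: "1 \<le> n \<Longrightarrow> prob_space (Q n tau)"
  unfolding Q_eq by (intro prob_space_PiM D.prob_space_P)

lemma measurable_component_Q: "(\<lambda>X. X j) \<in> measurable (Q n tau) (D.P j n (tau $ j))"
  unfolding Q_eq by (rule measurable_component_singleton) simp

lemma distr_Q: "1 \<le> n \<Longrightarrow> distr (Q n tau) (D.P j n (tau $ j)) (\<lambda>X. X j) = D.P j n (tau $ j)"
  unfolding Q_eq by (rule distr_PiM_component) (auto intro: D.prob_space_P)

text \<open>Carries the majorants, which depend on one path, to the joint law.\<close>

lemma integral_component:
  fixes U :: "path \<Rightarrow> real"
  assumes "1 \<le> n" "integrable (D.P j n (tau $ j)) U"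
  shows "integrable (Q n tau) (\<lambda>X. U (X j))" "(\<integral>X. U (X j) \<partial>Q n tau) = (\<integral>X. U X \<partial>D.P j n (tau $ j))" (is ?th1)
proof -
  have m: "U \<in> borel_measurable (D.P j n (tau $ j))" using assms(2) by simp
  show "integrable (Q n tau) (\<lambda>X. U (X j))"
    using assms(2) integrable_distr_eq[OF measurable_component_Q m] by (simp add: distr_Q[OF assms(1)])
  show ?th1
    using integral_distr[OF measurable_component_Q m] by (simp add: distr_Q[OF assms(1)])
qed

lemma err_measurable [measurable]: "err n tau \<in> borel_measurable (Q n tau')"
  unfolding err_def[abs_def] using est_measurable by measurable

lemma err_coord_measurable [measurable]: "(\<lambda>X. err n tau X $ j) \<in> borel_measurable (Q n tau')"
proof -
  have "(\<lambda>x::real^'k. x $ j) \<in> borel_measurable borel" by measurable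
  from measurable_compose[OF err_measurable this] show ?thesis .
qed

lemma score_measurable [measurable]: "score j n ts \<in> borel_measurable (D.P j m ts')"
  unfolding score_def[abs_def] by (rule D.z1_measurable)

lemma score_Q_measurable [measurable]: "(\<lambda>X. score j n ts (X j)) \<in> borel_measurable (Q n tau)"
  by (rule measurable_compose[OF measurable_component_Q score_measurable])

lemma F_bounds: "\<exists>c>0. \<exists>C. \<forall>j. \<forall>ts\<in>{a j..b j}. c \<le> F j ts \<and> F j ts \<le> C"
proof -
  have "\<forall>j. \<exists>c>0. \<forall>ts\<in>{a j..b j}. c \<le> F j ts" unfolding F_def using D.fisher_ge by blast
  then obtain c where c: "\<And>j. 0 < c j" "\<And>j ts. ts \<in> {a j..b j} \<Longrightarrow> c j \<le> F j ts" by metis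
  have "\<forall>j. \<exists>C. \<forall>ts\<in>{a j..b j}. F j ts \<le> C" unfolding F_def using D.fisher_le by blast
  then obtain C where C: "\<And>j ts. ts \<in> {a j..b j} \<Longrightarrow> F j ts \<le> C j" by metis
  have "0 < Min (range c)" using c(1) by (subst Min_gr_iff) auto
  moreover have "Min (range c) \<le> F j ts \<and> F j ts \<le> (\<Sum>i\<in>UNIV. \<bar>C i\<bar>)" if "ts \<in> {a j..b j}" for j ts
  proof -
    have "Min (range c) \<le> c j" by (rule Min_le) auto
    then show ?thesis using c(2)[OF that] C[OF that] le_sum_abs[of C j] by linarith
  qed
  ultimately show ?thesis by blast
qed

lemma coord_moment:
  "\<exists>C. \<forall>n\<ge>1. \<forall>tau. valid tau \<longrightarrow> (\<forall>j.
     integrable (Q n tau) (\<lambda>X. \<bar>err n tau X $ j\<bar> ^ p) \<and> (\<integral>X. \<bar>err n tau X $ j\<bar> ^ p \<partial>Q n tau) \<le> C)"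
proof -
  have "\<forall>j. \<exists>C. \<forall>n\<ge>1. \<forall>ts\<in>{a j..b j}. \<exists>U. integrable (D.P j n ts) U \<and> (\<integral>X. U X \<partial>D.P j n ts) \<le> C \<and>
     (\<forall>X th. D.is_mle j n X th \<longrightarrow> (sqrt (real n) * \<bar>th - ts\<bar>) ^ p \<le> U X)"
    using D.mle_moment_dominated by blast
  then obtain C where C: "\<And>j n ts. 1 \<le> n \<Longrightarrow> ts \<in> {a j..b j} \<Longrightarrow> \<exists>U. integrable (D.P j n ts) U \<and> (\<integral>X. U X \<partial>D.P j n ts) \<le> C j \<and>
     (\<forall>X th. D.is_mle j n X th \<longrightarrow> (sqrt (real n) * \<bar>th - ts\<bar>) ^ p \<le> U X)"
    by metis
  have "integrable (Q n tau) (\<lambda>X. \<bar>err n tau X $ j\<bar> ^ p) \<and> (\<integral>X. \<bar>err n tau X $ j\<bar> ^ p \<partial>Q n tau) \<le> (\<Sum>i\<in>UNIV. \<bar>C i\<bar>)"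
    if n: "1 \<le> n" and tau: "valid tau" for n tau j
  proof -
    obtain U where U: "integrable (D.P j n (tau $ j)) U" "(\<integral>X. U X \<partial>D.P j n (tau $ j)) \<le> C j"
      "\<And>X th. D.is_mle j n X th \<Longrightarrow> (sqrt (real n) * \<bar>th - tau $ j\<bar>) ^ p \<le> U X"
      using C[OF n, of "tau $ j" j] tau by blast
    note UQ = integral_component[OF n U(1)]
    have le: "\<bar>err n tau X $ j\<bar> ^ p \<le> U (X j)" for X
      using U(3)[OF is_mle] by (simp add: err_def abs_mult)
    have i: "integrable (Q n tau) (\<lambda>X. \<bar>err n tau X $ j\<bar> ^ p)"
      by (rule Bochner_Integration.integrable_bound[OF UQ(1)]) (auto intro!: AE_I2 order_trans[OF le abs_ge_self])
    moreover have "(\<integral>X. \<bar>err n tau X $ j\<bar> ^ p \<partial>Q n tau) \<le> (\<integral>X. U (X j) \<partial>Q n tau)"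
      by (rule integral_mono[OF i UQ(1) le])
    ultimately show ?thesis using UQ(2) U(2) le_sum_abs[of C j] by simp
  qed
  then show ?thesis by blast
qed

lemma coord_linearization:
  assumes rho: "0 < rho"
  shows "\<exists>C\<ge>0. \<forall>n\<ge>1. \<forall>tau. inset rho tau \<longrightarrow> (\<forall>j.
     integrable (Q n tau) (\<lambda>X. (rem n tau j X)^2) \<and>
     (\<integral>X. (rem n tau j X)^2 \<partial>Q n tau) \<le> C / sqrt (real n))"
proof -
  have "\<forall>j. \<exists>C. \<forall>n\<ge>1. \<forall>ts\<in>{a j + rho..b j - rho}. \<exists>U. integrable (D.P j n ts) U \<and> (\<integral>X. U X \<partial>D.P j n ts) \<le> C / sqrt (real n) \<and>
     (\<forall>X th. D.is_mle j n X th \<longrightarrow> (F j ts * (sqrt (real n) * (th - ts)) - score j n ts X)^2 \<le> U X)"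
    unfolding F_def score_def using D.mle_linearization_dominated[OF rho] by blast
  then obtain C where C: "\<And>j n ts. 1 \<le> n \<Longrightarrow> ts \<in> {a j + rho..b j - rho} \<Longrightarrow> \<exists>U. integrable (D.P j n ts) U \<and> (\<integral>X. U X \<partial>D.P j n ts) \<le> C j / sqrt (real n) \<and>
     (\<forall>X th. D.is_mle j n X th \<longrightarrow> (F j ts * (sqrt (real n) * (th - ts)) - score j n ts X)^2 \<le> U X)"
    by metis
  have "integrable (Q n tau) (\<lambda>X. (rem n tau j X)^2) \<and>
     (\<integral>X. (rem n tau j X)^2 \<partial>Q n tau) \<le> (\<Sum>i\<in>UNIV. \<bar>C i\<bar>) / sqrt (real n)"
    if n: "1 \<le> n" and tau: "inset rho tau" for n tau j
  proof -
    obtain U where U: "integrable (D.P j n (tau $ j)) U" "(\<integral>X. U X \<partial>D.P j n (tau $ j)) \<le> C j / sqrt (real n)"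
      "\<And>X th. D.is_mle j n X th \<Longrightarrow> (F j (tau $ j) * (sqrt (real n) * (th - tau $ j)) - score j n (tau $ j) X)^2 \<le> U X"
      using C[OF n, of "tau $ j" j] tau by blast
    note UQ = integral_component[OF n U(1)]
    let ?R = "\<lambda>X. (rem n tau j X)^2"
    have le: "?R X \<le> U (X j)" for X
      using U(3)[OF is_mle] by (simp add: err_def)
    have i: "integrable (Q n tau) ?R"
      by (rule Bochner_Integration.integrable_bound[OF UQ(1)]) (auto intro!: AE_I2 order_trans[OF le abs_ge_self])
    have "(\<integral>X. ?R X \<partial>Q n tau) \<le> (\<integral>X. U (X j) \<partial>Q n tau)"
      by (rule integral_mono[OF i UQ(1) le])
    also have "\<dots> \<le> C j / sqrt (real n)" using UQ(2) U(2) by simp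
    also have "\<dots> \<le> (\<Sum>i\<in>UNIV. \<bar>C i\<bar>) / sqrt (real n)"
      using le_sum_abs[of C j] by (intro divide_right_mono) auto
    finally show ?thesis using i by blast
  qed
  moreover have "0 \<le> (\<Sum>i\<in>UNIV. \<bar>C i\<bar>)" by (intro sum_nonneg) auto
  ultimately show ?thesis by blast
qed

lemma score_second_moment:
  assumes n: "1 \<le> n" and tau: "tau $ j \<in> {a j..b j}"
  shows "integrable (Q n tau) (\<lambda>X. (score j n (tau $ j) (X j))^2)" (is ?th1)
    "(\<integral>X. (score j n (tau $ j) (X j))^2 \<partial>Q n tau) = F j (tau $ j)" (is ?th2)
proof -
  have i: "integrable (D.P j n (tau $ j)) (\<lambda>X. (score j n (tau $ j) X)^2)"
    using D.z_moments(1)[OF n, of j "tau $ j" "tau $ j" 2] by (simp add: score_def)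
  show ?th1
    by (rule integral_component(1)[OF n i])
  show ?th2
    using integral_component(2)[OF n i] D.z1_variance[OF n tau] by (simp add: score_def F_def)
qed

text \<open>With \<open>f\<close> the information, \<open>u\<close> the error, \<open>z\<close> the
  score and \<open>r = f u - z\<close>, one has \<open>f^2 u^2 - z^2 = r^2 + 2 z r\<close>. The
  score has mean square exactly \<open>f\<close>, so the limit of the mean square of
  \<open>u\<close> is \<open>1 / f\<close>.\<close>

lemma coord_risk:
  assumes rho: "0 < rho"
  shows "\<exists>C. \<forall>n\<ge>1. \<forall>tau. inset rho tau \<longrightarrow> (\<forall>j.
     \<bar>(\<integral>X. (err n tau X $ j)^2 \<partial>Q n tau) - 1 / F j (tau $ j)\<bar> \<le> C / sqrt (sqrt (real n)))"
proof -
  obtain c Fm where c: "0 < c" "\<And>j ts. ts \<in> {a j..b j} \<Longrightarrow> c \<le> F j ts" "\<And>j ts. ts \<in> {a j..b j} \<Longrightarrow> F j ts \<le> Fm"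
    using F_bounds by metis
  obtain C where C0: "0 \<le> C" and C: "\<And>n tau j. 1 \<le> n \<Longrightarrow> inset rho tau \<Longrightarrow>
     integrable (Q n tau) (\<lambda>X. (rem n tau j X)^2) \<and>
     (\<integral>X. (rem n tau j X)^2 \<partial>Q n tau) \<le> C / sqrt (real n)"
    using coord_linearization[OF rho] by blast
  have "\<bar>(\<integral>X. (err n tau X $ j)^2 \<partial>Q n tau) - 1 / F j (tau $ j)\<bar> \<le> (2 * C + Fm) / c^2 / sqrt (sqrt (real n))"
    if n: "1 \<le> n" and tau: "inset rho tau" for n tau j
  proof -
    have valid: "valid tau" using inner_valid[OF rho tau] .
    define f where "f = F j (tau $ j)"
    have f: "0 < f" "c \<le> f" "f \<le> Fm" using c valid unfolding f_def by (auto intro: less_le_trans)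
    \<comment> \<open>The weight of the arithmetic-geometric inequality for the cross term: the
      remainder has mean square of order \<open>eta^2\<close>, so both resulting terms are of order
      \<open>eta\<close>, that is, of order \<open>n\<close> to the power
      \<open>-1/4\<close>.\<close>
    define \<eta> where "\<eta> = 1 / sqrt (sqrt (real n))"
    have \<eta>: "0 < \<eta>" "\<eta> \<le> 1" "\<eta> * \<eta> = 1 / sqrt (real n)" using n by (auto simp: \<eta>_def)
    let ?u = "\<lambda>X. err n tau X $ j" and ?z = "\<lambda>X. score j n (tau $ j) (X j)"
    let ?R = "\<lambda>X. (f * ?u X - ?z X)^2"
    have Ri: "integrable (Q n tau) ?R" and RC: "(\<integral>X. ?R X \<partial>Q n tau) \<le> C * (\<eta> * \<eta>)"
      using C[OF n tau, of j] by (auto simp: f_def \<eta>(3))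
    have R0: "0 \<le> (\<integral>X. ?R X \<partial>Q n tau)" by simp
    have zi: "integrable (Q n tau) (\<lambda>X. (?z X)^2)" and zf: "(\<integral>X. (?z X)^2 \<partial>Q n tau) = f"
      using score_second_moment[OF n, of tau j] valid by (auto simp: f_def)
    have ui: "integrable (Q n tau) (\<lambda>X. (?u X)^2)"
      using coord_moment[of 2] n valid by auto
    have pt: "\<bar>f^2 * (?u X)^2 - (?z X)^2\<bar> \<le> ?R X + (\<eta> * (?z X)^2 + ?R X / \<eta>)" for X
    proof -
      have *: "2 * \<bar>x * y\<bar> \<le> \<eta> * x^2 + y^2 / \<eta>" for x y :: real
      proof -
        have "0 \<le> (\<eta> * \<bar>x\<bar> - \<bar>y\<bar>)^2 / \<eta>" using \<eta>(1) by simp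
        also have "\<dots> = \<eta> * x^2 + y^2 / \<eta> - 2 * (\<bar>x\<bar> * \<bar>y\<bar>)"
          using \<eta>(1) by (simp add: power2_diff power_mult_distrib power2_eq_square field_simps)
        finally show ?thesis by (simp add: abs_mult)
      qed
      have "f^2 * (?u X)^2 - (?z X)^2 = ?R X + 2 * (?z X * (f * ?u X - ?z X))"
        by (simp add: power2_eq_square algebra_simps)
      then have "\<bar>f^2 * (?u X)^2 - (?z X)^2\<bar> \<le> ?R X + 2 * \<bar>?z X * (f * ?u X - ?z X)\<bar>"
        using abs_triangle_ineq[of "?R X" "2 * (?z X * (f * ?u X - ?z X))"] by (simp add: abs_mult)
      then show ?thesis using *[of "?z X" "f * ?u X - ?z X"] by linarith
    qed
    have "\<bar>f^2 * (\<integral>X. (?u X)^2 \<partial>Q n tau) - f\<bar> = \<bar>\<integral>X. f^2 * (?u X)^2 - (?z X)^2 \<partial>Q n tau\<bar>"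
      using ui zi zf by simp
    also have "\<dots> \<le> (\<integral>X. \<bar>f^2 * (?u X)^2 - (?z X)^2\<bar> \<partial>Q n tau)" by (rule integral_abs_bound)
    also have "\<dots> \<le> (\<integral>X. ?R X + (\<eta> * (?z X)^2 + ?R X / \<eta>) \<partial>Q n tau)"
      using ui zi Ri by (intro integral_mono pt) auto
    also have "\<dots> = (\<integral>X. ?R X \<partial>Q n tau) + (\<eta> * f + (\<integral>X. ?R X \<partial>Q n tau) / \<eta>)"
      using zi Ri zf by simp
    also have "\<dots> \<le> C * \<eta> + (\<eta> * Fm + C * \<eta>)"
    proof (intro add_mono)
      have "C * (\<eta> * \<eta>) \<le> C * (\<eta> * 1)" using \<eta> C0 by (intro mult_left_mono) auto
      then show "(\<integral>X. ?R X \<partial>Q n tau) \<le> C * \<eta>" using RC by simp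
      show "\<eta> * f \<le> \<eta> * Fm" using \<eta> f by simp
      have "(\<integral>X. ?R X \<partial>Q n tau) / \<eta> \<le> (C * (\<eta> * \<eta>)) / \<eta>" using RC \<eta> by (intro divide_right_mono) auto
      then show "(\<integral>X. ?R X \<partial>Q n tau) / \<eta> \<le> C * \<eta>" using \<eta>(1) by simp
    qed
    finally have 1: "\<bar>f^2 * (\<integral>X. (?u X)^2 \<partial>Q n tau) - f\<bar> \<le> (2 * C + Fm) * \<eta>" by (simp add: algebra_simps)
    have "(\<integral>X. (?u X)^2 \<partial>Q n tau) - 1 / f = (f^2 * (\<integral>X. (?u X)^2 \<partial>Q n tau) - f) / f^2"
      using f(1) by (simp add: diff_divide_distrib power2_eq_square)
    then have "\<bar>(\<integral>X. (?u X)^2 \<partial>Q n tau) - 1 / f\<bar> = \<bar>f^2 * (\<integral>X. (?u X)^2 \<partial>Q n tau) - f\<bar> / f^2"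
      by simp
    also have "\<dots> \<le> ((2 * C + Fm) * \<eta>) / c^2"
      using 1 f c(1) C0 \<eta> by (intro frac_le power_mono) auto
    finally show ?thesis by (simp add: f_def \<eta>_def mult.commute)
  qed
  then show ?thesis by blast
qed

text \<open>The trace of the inverse of the diagonal information matrix.\<close>

definition V :: "real^'k \<Rightarrow> real" where "V tau = (\<Sum>j\<in>UNIV. 1 / F j (tau $ j))"

lemma err_norm_integrable:
  assumes "1 \<le> n" "valid tau"
  shows "integrable (Q n tau) (\<lambda>X. (err n tau X $ j)^2)" "integrable (Q n tau) (\<lambda>X. (norm (err n tau X))^2)" (is ?th1)
    "risk n tau = (\<Sum>j\<in>UNIV. \<integral>X. (err n tau X $ j)^2 \<partial>Q n tau)" (is ?th2)
proof -
  show i: "integrable (Q n tau) (\<lambda>X. (err n tau X $ j)^2)" for j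
    using coord_moment[of 2] assms by auto
  show ?th1
    unfolding norm_vec_power2 by (intro Bochner_Integration.integrable_sum i)
  show ?th2
    unfolding norm_vec_power2 by (intro Bochner_Integration.integral_sum i)
qed

lemma risk_uniform:
  assumes rho: "0 < rho"
  shows "\<exists>e. e \<longlonglongrightarrow> 0 \<and> (\<forall>n\<ge>1. \<forall>tau. inset rho tau \<longrightarrow>
     \<bar>risk n tau - V tau\<bar> \<le> e n)"
proof -
  obtain C where C: "\<And>n tau j. 1 \<le> n \<Longrightarrow> inset rho tau \<Longrightarrow>
     \<bar>(\<integral>X. (err n tau X $ j)^2 \<partial>Q n tau) - 1 / F j (tau $ j)\<bar> \<le> C / sqrt (sqrt (real n))"
    using coord_risk[OF rho] by blast
  show ?thesis
  proof (intro exI[of _ "\<lambda>n. real CARD('k) * (C / sqrt (sqrt (real n)))"] conjI allI impI)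
    show "(\<lambda>n. real CARD('k) * (C / sqrt (sqrt (real n)))) \<longlonglongrightarrow> 0"
      by (intro tendsto_mult_right_zero tendsto_divide_0[OF tendsto_const] filterlim_at_top_imp_at_infinity
            filterlim_compose[OF sqrt_at_top] filterlim_real_sequentially)
    fix n :: nat and tau :: "real^'k" assume n: "1 \<le> n" and tau: "inset rho tau"
    have valid: "valid tau" using inner_valid[OF rho tau] .
    have "\<bar>risk n tau - V tau\<bar>
       = \<bar>\<Sum>j\<in>UNIV. (\<integral>X. (err n tau X $ j)^2 \<partial>Q n tau) - 1 / F j (tau $ j)\<bar>"
      by (simp add: err_norm_integrable(3)[OF n valid] V_def sum_subtractf)
    also have "\<dots> \<le> (\<Sum>j\<in>UNIV. \<bar>(\<integral>X. (err n tau X $ j)^2 \<partial>Q n tau) - 1 / F j (tau $ j)\<bar>)"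
      by (rule sum_abs)
    also have "\<dots> \<le> (\<Sum>j\<in>(UNIV::'k set). C / sqrt (sqrt (real n)))"
      by (intro sum_mono C n tau)
    finally show "\<bar>risk n tau - V tau\<bar> \<le> real CARD('k) * (C / sqrt (sqrt (real n)))"
      by simp
  qed
qed

lemma V_le: "\<exists>C. \<forall>tau. valid tau \<longrightarrow> V tau \<le> C"
proof -
  obtain c where c: "0 < c" "\<And>j ts. ts \<in> {a j..b j} \<Longrightarrow> c \<le> F j ts" using F_bounds by metis
  have "V tau \<le> (\<Sum>j\<in>(UNIV::'k set). 1 / c)" if "valid tau" for tau
    unfolding V_def using c that by (intro sum_mono divide_left_mono) (auto intro: mult_pos_pos less_le_trans)
  then show ?thesis by blast
qed

lemma F_pos: "ts \<in> {a j..b j} \<Longrightarrow> 0 < F j ts"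
  using F_bounds by (meson less_le_trans)

lemma continuous_on_V: "continuous_on (Collect valid) V"
  unfolding V_def
proof (intro continuous_intros)
  fix j
  show "continuous_on (Collect valid) (\<lambda>tau. F j (tau $ j))"
    using D.continuous_on_fisher[of j] unfolding F_def
    by (rule continuous_on_compose2) (auto intro!: continuous_intros)
  show "\<forall>tau\<in>(Collect valid). F j (tau $ j) \<noteq> 0"
    using F_pos[of _ j] by fastforce
qed

section \<open>Asymptotic normality, convergence of moments, consistency and efficiency\<close>

definition law :: "real^'k \<Rightarrow> 'k \<Rightarrow> nat \<Rightarrow> real measure" where
  "law tau j n = distr (D.P j n (tau $ j)) borel (\<lambda>X. score j n (tau $ j) X / F j (tau $ j))"

text \<open>Levy's continuity theorem applied to the characteristic function of the score at the
  rescaled argument \<open>s / F\<close>. Dividing the score by its variance \<open>F\<close> leaves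
  the variance \<open>1 / F\<close>.\<close>

lemma score_weak_limit:
  assumes tau: "valid tau"
  shows "real_distribution (law tau j (Suc n))"
    and "weak_conv_m (\<lambda>n. law tau j (Suc n)) (normal_law (sqrt (1 / F j (tau $ j))))"
proof -
  let ?f = "F j (tau $ j)"
  have f: "0 < ?f" using F_pos tau by blast
  have m: "(\<lambda>X. score j n (tau $ j) X / ?f) \<in> borel_measurable (D.P j n (tau $ j))" for n by measurable
  show rd: "real_distribution (law tau j (Suc n))" for n
    unfolding law_def using m D.prob_space_P[of "Suc n" j "tau $ j"]
    by (intro prob_space.real_distribution_distr) auto
  have "(\<lambda>n. char (law tau j (Suc n)) s) \<longlonglongrightarrow> char (normal_law (sqrt (1 / ?f))) s" for s
  proof -
    have "(\<lambda>n. \<integral>X. iexp ((s / ?f) * score j n (tau $ j) X) \<partial>D.P j n (tau $ j)) \<longlonglongrightarrow> exp (- ((s / ?f)^2 / 2) * ?f)"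
      unfolding score_def F_def using D.z1_char_limit[of "tau $ j" j "s / F j (tau $ j)"] tau by (simp add: F_def)
    from LIMSEQ_Suc[OF this]
    have "(\<lambda>n. \<integral>X. iexp ((s / ?f) * score j (Suc n) (tau $ j) X) \<partial>D.P j (Suc n) (tau $ j)) \<longlonglongrightarrow> exp (- ((s / ?f)^2 / 2) * ?f)" .
    moreover have "char (law tau j (Suc n)) s = (\<integral>X. iexp ((s / ?f) * score j (Suc n) (tau $ j) X) \<partial>D.P j (Suc n) (tau $ j))" for n
      unfolding char_def law_def using m[of "Suc n"] by (subst integral_distr) auto
    moreover have "char (normal_law (sqrt (1 / ?f))) s = exp (- ((s / ?f)^2 / 2) * ?f)"
    proof -
      have "- (s^2 / 2) * (sqrt (1 / ?f))^2 = - ((s / ?f)^2 / 2) * ?f"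
        using f by (simp add: power2_eq_square field_simps)
      then show ?thesis using f by (subst char_normal_law) (auto simp only: real_sqrt_gt_0_iff zero_less_divide_1_iff)
    qed
    ultimately show ?thesis by simp
  qed
  then show "weak_conv_m (\<lambda>n. law tau j (Suc n)) (normal_law (sqrt (1 / ?f)))"
    using f by (intro levy_continuity rd real_distribution_normal_law) auto
qed

abbreviation "G tau \<equiv> gaussian_diag (\<lambda>j. 1 / F j (tau $ j))"

lemma score_vector_weak_limit:
  fixes f :: "real^'k \<Rightarrow> real"
  assumes tau: "valid tau" and f: "continuous_on UNIV f" "\<And>x. \<bar>f x\<bar> \<le> C"
  shows "(\<lambda>n. \<integral>X. f (\<chi> j. score j n (tau $ j) (X j) / F j (tau $ j)) \<partial>Q n tau) \<longlonglongrightarrow> (\<integral>x. f x \<partial>G tau)"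
\<comment> \<open>At \<open>n = 0\<close> the intensity vanishes and the density of an event time
  degenerates to \<open>0 / 0 = 0\<close>, whereas the product theorem asks for probability laws at
  every index. Hence the shift.\<close>
proof (rule LIMSEQ_imp_Suc)
  have fm [measurable]: "f \<in> borel_measurable borel" by (rule borel_measurable_continuous_onI[OF f(1)])
  have fpos: "0 < 1 / F j (tau $ j)" for j using F_pos tau by simp
  let ?N = "\<Pi>\<^sub>M j\<in>UNIV. normal_law (sqrt (1 / F j (tau $ j)))"
  have vl: "(\<lambda>x. (\<chi> j. x j) :: real^'k) \<in> borel_measurable ?N"
    using measurable_vec_lambda by (simp cong: measurable_cong_sets sets_PiM_cong)
  have "(\<integral>x. f x \<partial>G tau) = (\<integral>x. f (\<chi> j. x j) \<partial>?N)"
    unfolding gaussian_diag_eq[OF fpos] by (rule integral_distr[OF vl fm])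
  moreover have "(\<integral>X. f (\<chi> j. score j (Suc n) (tau $ j) (X j) / F j (tau $ j)) \<partial>Q (Suc n) tau)
      = (\<integral>x. f (\<chi> j. x j) \<partial>(\<Pi>\<^sub>M j\<in>UNIV. law tau j (Suc n)))" for n
  proof -
    let ?s = "\<lambda>j X. score j (Suc n) (tau $ j) X / F j (tau $ j)"
    have sm: "?s j \<in> borel_measurable (D.P j (Suc n) (tau $ j))" for j by measurable
    have p: "prob_space (D.P j (Suc n) (tau $ j))" for j by (rule D.prob_space_P) simp
    have m: "(\<lambda>X j. ?s j (X j)) \<in> measurable (Q (Suc n) tau) (\<Pi>\<^sub>M j\<in>UNIV. borel)"
      by (rule measurable_PiM_single') (auto intro!: borel_measurable_divide score_Q_measurable)
    have fl: "(\<lambda>x. f (\<chi> j. x j)) \<in> borel_measurable (\<Pi>\<^sub>M j\<in>UNIV. borel)" by measurable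
    show ?thesis
      unfolding law_def distr_PiM_componentwise[OF p sm, symmetric] Q_eq[symmetric]
      by (rule integral_distr[OF m fl, symmetric])
  qed
  moreover have "(\<lambda>n. \<integral>x. f (\<chi> j. x j) \<partial>(\<Pi>\<^sub>M j\<in>UNIV. law tau j (Suc n))) \<longlonglongrightarrow> (\<integral>x. f (\<chi> j. x j) \<partial>?N)"
  proof (rule product_weak_convergence[where \<mu>="\<lambda>j n. law tau j (Suc n)", OF _ _ _ f])
    show "real_distribution (normal_law (sqrt (1 / F j (tau $ j))))" for j
      using fpos by (intro real_distribution_normal_law) simp
  qed (rule score_weak_limit[OF tau])+
  ultimately show "(\<lambda>n. \<integral>X. f (\<chi> j. score j (Suc n) (tau $ j) (X j) / F j (tau $ j)) \<partial>Q (Suc n) tau) \<longlonglongrightarrow> (\<integral>x. f x \<partial>G tau)"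
    by simp
qed

lemma err_weak_limit:
  assumes rho: "0 < rho" and tau: "inset rho tau"
  shows "weak_conv (\<lambda>n. distr (Q n tau) borel (err n tau)) (G tau)"
  unfolding weak_conv_def
proof (intro allI impI, elim conjE)
  fix f :: "real^'k \<Rightarrow> real" assume f: "continuous_on UNIV f" "bounded (range f)"
  have valid: "valid tau" using inner_valid[OF rho tau] .
  have fm: "f \<in> borel_measurable borel" by (rule borel_measurable_continuous_onI[OF f(1)])
  obtain C where C: "\<And>x. \<bar>f x\<bar> \<le> C" using f(2) by (auto simp: bounded_iff)
  obtain C' where C': "\<And>n j. 1 \<le> n \<Longrightarrow>
     integrable (Q n tau) (\<lambda>X. (rem n tau j X)^2) \<and>
     (\<integral>X. (rem n tau j X)^2 \<partial>Q n tau) \<le> C' / sqrt (real n)"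
    using coord_linearization[OF rho] tau by blast
  have fp: "0 < F j (tau $ j)" for j using F_pos valid by blast
  let ?v = "\<lambda>n X. \<chi> j. score j n (tau $ j) (X j) / F j (tau $ j)"
  have vm: "?v n \<in> borel_measurable (Q n tau)" for n
  proof -
    have "(\<lambda>X j. score j n (tau $ j) (X j) / F j (tau $ j)) \<in> measurable (Q n tau) (\<Pi>\<^sub>M j\<in>UNIV. borel)"
      by (rule measurable_PiM_single') (auto intro!: borel_measurable_divide score_Q_measurable)
    from measurable_compose[OF this measurable_vec_lambda] show ?thesis .
  qed
  have vn: "(norm (?v n X))^2 = (\<Sum>j\<in>UNIV. (score j n (tau $ j) (X j))^2 / (F j (tau $ j))^2)" for n X
    by (simp add: norm_vec_power2 power_divide)
  have dn: "(norm (err n tau X - ?v n X))^2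
     = (\<Sum>j\<in>UNIV. (rem n tau j X)^2 / (F j (tau $ j))^2)" for n X
    unfolding norm_vec_power2
  proof (intro sum.cong refl)
    fix j
    have "(err n tau X - ?v n X) $ j = (rem n tau j X) / F j (tau $ j)"
      using fp[of j] by (simp add: field_simps)
    then show "((err n tau X - ?v n X) $ j)^2 = (rem n tau j X)^2 / (F j (tau $ j))^2"
      by (simp only: power_divide)
  qed
  have "(\<lambda>n. \<integral>X. f (err n tau X) \<partial>Q n tau) \<longlonglongrightarrow> (\<integral>x. f x \<partial>G tau)"
  \<comment> \<open>\<open>V tau\<close> is the exact second moment of the normalised score vector:
    coordinate \<open>j\<close> contributes \<open>F / F^2\<close>.\<close>
  proof (rule weak_limit_perturbation[where v="?v" and S="V tau", OF f(1) C])
    show "(\<lambda>n. \<integral>X. f (?v n X) \<partial>Q n tau) \<longlonglongrightarrow> (\<integral>x. f x \<partial>G tau)"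
      by (rule score_vector_weak_limit[OF valid f(1) C])
    fix n :: nat assume n: "1 \<le> n"
    show "prob_space (Q n tau)" by (rule prob_Q[OF n])
    show "err n tau \<in> borel_measurable (Q n tau)" by measurable
    show "?v n \<in> borel_measurable (Q n tau)" by (rule vm)
    have si: "integrable (Q n tau) (\<lambda>X. (score j n (tau $ j) (X j))^2)" "(\<integral>X. (score j n (tau $ j) (X j))^2 \<partial>Q n tau) = F j (tau $ j)" for j
      using score_second_moment[OF n, of tau j] valid by blast+
    show "integrable (Q n tau) (\<lambda>X. (norm (?v n X))^2)"
      unfolding vn using si by auto
    have "(\<integral>X. (norm (?v n X))^2 \<partial>Q n tau) = V tau"
      unfolding vn V_def using si less_imp_neq[OF fp, symmetric] by (simp add: power2_eq_square[of "F _ _"])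
    then show "(\<integral>X. (norm (?v n X))^2 \<partial>Q n tau) \<le> V tau" by simp
    show "integrable (Q n tau) (\<lambda>X. (norm (err n tau X - ?v n X))^2)"
      unfolding dn using C'[OF n] by auto
  next
    show "(\<lambda>n. \<integral>X. (norm (err n tau X - ?v n X))^2 \<partial>Q n tau) \<longlonglongrightarrow> 0"
    proof (rule Lim_null_comparison)
      show "(\<lambda>n. (\<Sum>j\<in>UNIV. C' / (F j (tau $ j))^2) / sqrt (real n)) \<longlonglongrightarrow> 0"
        by (intro tendsto_divide_0[OF tendsto_const] filterlim_at_top_imp_at_infinity
            filterlim_compose[OF sqrt_at_top] filterlim_real_sequentially)
      show "\<forall>\<^sub>F n in sequentially. norm (\<integral>X. (norm (err n tau X - ?v n X))^2 \<partial>Q n tau) \<le> (\<Sum>j\<in>UNIV. C' / (F j (tau $ j))^2) / sqrt (real n)"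
        using eventually_ge_at_top[of 1]
      proof eventually_elim
        case (elim n)
        have "(\<integral>X. (norm (err n tau X - ?v n X))^2 \<partial>Q n tau)
           = (\<Sum>j\<in>UNIV. (\<integral>X. (rem n tau j X)^2 \<partial>Q n tau) / (F j (tau $ j))^2)"
          unfolding dn using C'[OF elim] by (subst Bochner_Integration.integral_sum) auto
        also have "\<dots> \<le> (\<Sum>j\<in>UNIV. (C' / sqrt (real n)) / (F j (tau $ j))^2)"
          using C'[OF elim] by (intro sum_mono divide_right_mono) auto
        also have "\<dots> = (\<Sum>j\<in>UNIV. C' / (F j (tau $ j))^2) / sqrt (real n)"
          by (simp add: sum_divide_distrib mult.commute)
        finally show ?case by simp
      qed
    qed
  qed
  then show "(\<lambda>n. \<integral>x. f x \<partial>distr (Q n tau) borel (err n tau)) \<longlonglongrightarrow> (\<integral>x. f x \<partial>G tau)"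
    by (subst integral_distr[OF err_measurable fm]) simp
qed

lemma prob_space_G: assumes tau: "valid tau" shows "prob_space (G tau)"
proof -
  have fpos: "0 < 1 / F j (tau $ j)" for j using F_pos tau by simp
  have "prob_space (\<Pi>\<^sub>M j\<in>UNIV. normal_law (sqrt (1 / F j (tau $ j))))"
    using fpos by (intro prob_space_PiM prob_space_normal_density) simp
  moreover have "(\<lambda>x. (\<chi> j. x j) :: real^'k) \<in> borel_measurable (\<Pi>\<^sub>M j\<in>UNIV. normal_law (sqrt (1 / F j (tau $ j))))"
    using measurable_vec_lambda by (simp cong: measurable_cong_sets sets_PiM_cong)
  ultimately show ?thesis
    unfolding gaussian_diag_eq[OF fpos] by (rule prob_space.prob_space_distr)
qed

text \<open>The growth condition on the square of \<open>f\<close> is what uniform integrability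
  needs, and the coordinate moments deliver it. It covers all monomials as well as the squared
  norm.\<close>

lemma err_moment_limit:
  fixes f :: "real^'k \<Rightarrow> real"
  assumes rho: "0 < rho" and tau: "inset rho tau"
    and f: "continuous_on UNIV f" and le: "\<And>x. (f x)^2 \<le> c * (\<Sum>j\<in>UNIV. \<bar>x $ j\<bar> ^ p)" and c: "0 \<le> c"
  shows "(\<lambda>n. \<integral>X. f (err n tau X) \<partial>Q n tau) \<longlonglongrightarrow> (\<integral>x. f x \<partial>G tau)"
proof -
  have valid: "valid tau" using inner_valid[OF rho tau] .
  have fm [measurable]: "f \<in> borel_measurable borel" by (rule borel_measurable_continuous_onI[OF f])
  have f2m: "(\<lambda>x. (f x)^2) \<in> borel_measurable borel" by measurable
  obtain C where C: "\<And>n j. 1 \<le> n \<Longrightarrow> integrable (Q n tau) (\<lambda>X. \<bar>err n tau X $ j\<bar> ^ p) \<and> (\<integral>X. \<bar>err n tau X $ j\<bar> ^ p \<partial>Q n tau) \<le> C"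
    using coord_moment[of p] valid by blast
  have "(\<lambda>n. \<integral>x. f x \<partial>distr (Q n tau) borel (err n tau)) \<longlonglongrightarrow> (\<integral>x. f x \<partial>G tau)"
  proof (rule weak_conv_moment[OF err_weak_limit[OF rho tau] prob_space_G[OF valid], where C="c * (\<Sum>j\<in>(UNIV::'k set). C)"])
    show "sets (G tau) = sets borel" by (simp add: gaussian_diag_def)
    show "sets (distr (Q n tau) borel (err n tau)) = sets borel" for n by simp
    fix n :: nat assume n: "1 \<le> n"
    show "prob_space (distr (Q n tau) borel (err n tau))"
      by (rule prob_space.prob_space_distr[OF prob_Q[OF n] err_measurable])
    have si: "integrable (Q n tau) (\<lambda>X. c * (\<Sum>j\<in>UNIV. \<bar>err n tau X $ j\<bar> ^ p))"
      using C[OF n] by auto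
    have i: "integrable (Q n tau) (\<lambda>X. (f (err n tau X))^2)"
      using measurable_compose[OF err_measurable f2m]
      by (intro Bochner_Integration.integrable_bound[OF si]) (auto intro!: AE_I2 order_trans[OF le abs_ge_self])
    then show "integrable (distr (Q n tau) borel (err n tau)) (\<lambda>x. (f x)^2)"
      by (subst integrable_distr_eq[OF err_measurable f2m])
    have "(\<integral>x. (f x)^2 \<partial>distr (Q n tau) borel (err n tau)) = (\<integral>X. (f (err n tau X))^2 \<partial>Q n tau)"
      by (rule integral_distr[OF err_measurable f2m])
    also have "\<dots> \<le> (\<integral>X. c * (\<Sum>j\<in>UNIV. \<bar>err n tau X $ j\<bar> ^ p) \<partial>Q n tau)"
      by (rule integral_mono[OF i si le])
    also have "\<dots> = c * (\<Sum>j\<in>UNIV. \<integral>X. \<bar>err n tau X $ j\<bar> ^ p \<partial>Q n tau)"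
      using C[OF n] by (subst integral_mult_right_zero, subst Bochner_Integration.integral_sum) auto
    also have "\<dots> \<le> c * (\<Sum>j\<in>(UNIV::'k set). C)"
      using C[OF n] c by (intro mult_left_mono sum_mono) auto
    finally show "(\<integral>x. (f x)^2 \<partial>distr (Q n tau) borel (err n tau)) \<le> c * (\<Sum>j\<in>(UNIV::'k set). C)" .
  qed (rule f)
  then show ?thesis by (subst (asm) integral_distr[OF err_measurable fm]) simp
qed

text \<open>The Gaussian integral is not computed: the risk converges to \<open>V tau\<close> by
  linearisation and to the Gaussian second moment by convergence of moments, and limits are
  unique.\<close>

lemma gaussian_second_moment:
  assumes rho: "0 < rho" and tau: "inset rho tau"
  shows "(\<lambda>n. risk n tau) \<longlonglongrightarrow> V tau" (is ?th1) "(\<integral>x. (norm x)^2 \<partial>G tau) = V tau" (is ?th2)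
proof -
  obtain e where e: "e \<longlonglongrightarrow> 0" "\<And>n. 1 \<le> n \<Longrightarrow> \<bar>risk n tau - V tau\<bar> \<le> e n"
    using risk_uniform[OF rho] tau by blast
  show 1: ?th1
    by (rule Lim_null[THEN iffD2], rule Lim_null_comparison[OF _ e(1)])
       (use e(2) in \<open>auto intro!: eventually_sequentiallyI[of 1]\<close>)
  have "(\<lambda>n. risk n tau) \<longlonglongrightarrow> (\<integral>x. (norm x)^2 \<partial>G tau)"
    by (rule err_moment_limit[OF rho tau _ norm_power4_le]) (auto intro!: continuous_intros)
  from LIMSEQ_unique[OF this 1] show ?th2 .
qed

text \<open>Chebyshev's inequality: the risk is normalised by \<open>n\<close>, so its boundedness
  makes the probability of order \<open>1 / n\<close>.\<close>

lemma consistency: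
  assumes rho: "0 < rho" and tau: "inset rho tau" and eps: "0 < eps"
  shows "(\<lambda>n. measure (Q n tau) {X \<in> space (Q n tau). norm (est n X - tau) > eps}) \<longlonglongrightarrow> 0"
proof -
  have valid: "valid tau" using inner_valid[OF rho tau] .
  show ?thesis
  proof (rule Lim_null_comparison)
    have "(\<lambda>n. risk n tau / eps^2 * inverse (real n)) \<longlonglongrightarrow> V tau / eps^2 * 0"
      by (intro tendsto_intros gaussian_second_moment[OF rho tau] lim_inverse_n) (use eps in auto)
    then show "(\<lambda>n. risk n tau / eps^2 * inverse (real n)) \<longlonglongrightarrow> 0" by simp
    show "\<forall>\<^sub>F n in sequentially. norm (measure (Q n tau) {X \<in> space (Q n tau). norm (est n X - tau) > eps}) \<le> risk n tau / eps^2 * inverse (real n)"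
      using eventually_ge_at_top[of 1]
    proof eventually_elim
      case (elim n)
      interpret prob_space "Q n tau" by (rule prob_Q[OF elim])
      have rn: "0 < real n" using elim by simp
      let ?A = "{X \<in> space (Q n tau). norm (est n X - tau) > eps}"
      have [measurable]: "est n \<in> borel_measurable (Q n tau)" by (rule est_measurable)
      have A: "?A \<in> sets (Q n tau)" by measurable
      have pt: "real n * eps^2 * indicator ?A X \<le> (norm (err n tau X))^2" for X
      proof (cases "X \<in> ?A")
        case True
        then have "eps^2 \<le> (norm (est n X - tau))^2" using eps by (intro power_mono) auto
        then show ?thesis using True rn by (simp add: err_def power_mult_distrib)
      qed simp
      have "real n * eps^2 * measure (Q n tau) ?A = (\<integral>X. real n * eps^2 * indicator ?A X \<partial>Q n tau)"
        using A by simp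
      also have "\<dots> \<le> risk n tau"
        using A by (intro integral_mono pt err_norm_integrable elim valid) (auto simp: emeasure_eq_measure)
      finally show ?case using rn eps by (simp add: field_simps)
    qed
  qed
qed

text \<open>The margin \<open>2 * rho\<close> leaves a margin \<open>rho\<close> for every delay
  vector within distance \<open>rho\<close> of \<open>tau0\<close>, where the risk converges
  uniformly. The inner limit is then the supremum of \<open>V\<close> over the ball, and continuity
  of \<open>V\<close> shrinks it to the value at the centre.\<close>

lemma minimax:
  assumes rho: "0 < rho" and tau0: "\<forall>j. tau0 $ j \<in> {a j + 2 * rho..b j - 2 * rho}"
  defines "R \<equiv> \<lambda>delta n. Sup {real n * (\<integral>X. (norm (est n X - tau)) ^ 2 \<partial>Q n tau)
                            | tau. valid tau \<and> norm (tau - tau0) \<le> delta}"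
  shows "\<forall>\<^sub>F delta in at_right 0. convergent (R delta)" (is ?th1)
    "((\<lambda>delta. lim (R delta)) \<longlongrightarrow> V tau0) (at_right 0)" (is ?th2)
proof -
  have inner0: "inset rho tau0"
  proof
    fix j show "tau0 $ j \<in> {a j + rho..b j - rho}" using spec[OF tau0, of j] rho by auto
  qed
  have valid0: "valid tau0" using inner_valid[OF rho inner0] .
  define S where "S delta = {tau. valid tau \<and> norm (tau - tau0) \<le> delta}" for delta
  have R: "R delta n = Sup ((\<lambda>tau. risk n tau) ` S delta)" for delta n
  proof -
    have "risk n tau = real n * (\<integral>X. (norm (est n X - tau)) ^ 2 \<partial>Q n tau)" for tau
      by (simp add: err_def power_mult_distrib)
    then show ?thesis unfolding R_def S_def setcompr_eq_image by simp
  qed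
  have in0: "tau0 \<in> S delta" if "0 \<le> delta" for delta using that valid0 by (auto simp: S_def)
  have inner: "inset rho tau" if "tau \<in> S delta" "delta \<le> rho" for tau delta
  proof
    fix j
    have "\<bar>(tau - tau0) $ j\<bar> \<le> norm (tau - tau0)" by (rule component_le_norm_cart)
    then have "\<bar>tau $ j - tau0 $ j\<bar> \<le> rho" using that by (simp add: S_def)
    then show "tau $ j \<in> {a j + rho..b j - rho}" using spec[OF tau0, of j] by auto
  qed
  obtain C where C: "\<And>tau. valid tau \<Longrightarrow> V tau \<le> C" using V_le by blast
  have bdd: "bdd_above (V ` S delta)" for delta
    by (rule bdd_aboveI2[of _ _ C]) (auto simp: S_def intro: C)
  obtain e where e: "e \<longlonglongrightarrow> 0" "\<And>n tau. 1 \<le> n \<Longrightarrow> inset rho tau \<Longrightarrow>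
     \<bar>risk n tau - V tau\<bar> \<le> e n"
    using risk_uniform[OF rho] by blast
  \<comment> \<open>Existence of this limit is part of the claim, and it also gives
    \<open>lim (R delta)\<close> its value.\<close>
  have lim: "R delta \<longlonglongrightarrow> Sup (V ` S delta)" if "0 < delta" "delta \<le> rho" for delta
    unfolding R[abs_def]
    using in0[of delta] that by (intro Sup_uniform_limit[OF _ bdd _ e(1)] e(2) inner) auto
  have ev: "\<forall>\<^sub>F delta in at_right (0::real). 0 < delta \<and> delta \<le> rho"
    using rho by (auto simp: eventually_at_right intro!: exI[of _ rho])
  show ?th1
    using ev by eventually_elim (use lim in \<open>auto simp: convergent_def\<close>)
  have "((\<lambda>delta. Sup (V ` S delta)) \<longlongrightarrow> V tau0) (at_right 0)"
  proof (rule tendstoI)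
    fix r :: real assume r: "0 < r"
    obtain d where d: "0 < d" "\<And>tau. valid tau \<Longrightarrow> dist tau tau0 < d \<Longrightarrow> dist (V tau) (V tau0) < r / 2"
    proof -
      have "tau0 \<in> (Collect valid)" using valid0 by simp
      from continuous_on_V[unfolded continuous_on_iff, rule_format, OF this half_gt_zero[OF r]]
      show thesis using that by blast
    qed
    have "\<forall>\<^sub>F delta in at_right (0::real). 0 < delta \<and> delta < d"
      using d(1) by (auto simp: eventually_at_right intro!: exI[of _ d])
    then show "\<forall>\<^sub>F delta in at_right 0. dist (Sup (V ` S delta)) (V tau0) < r"
    proof eventually_elim
      case (elim delta)
      have "V tau0 \<le> Sup (V ` S delta)" using elim in0 by (intro cSUP_upper bdd) auto
      moreover have "Sup (V ` S delta) \<le> V tau0 + r / 2"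
      proof (rule cSUP_least)
        show "S delta \<noteq> {}" using in0[of delta] elim by auto
        fix tau assume "tau \<in> S delta"
        then have "dist (V tau) (V tau0) < r / 2"
          using elim by (intro d(2)) (auto simp: S_def dist_norm)
        then show "V tau \<le> V tau0 + r / 2" unfolding dist_real_def by linarith
      qed
      ultimately show ?case using r unfolding dist_real_def by linarith
    qed
  qed
  then show ?th2
    by (rule Lim_transform_eventually) (use ev in eventually_elim, use lim limI in \<open>metis\<close>)
qed

end

section \<open>Delays of a source in the plane\<close>

lemma poisson_process_cong:
  assumes "\<And>t. t \<in> {0..T} \<Longrightarrow> mu t = mu' t"
  shows "poisson_process T mu = poisson_process T mu'"
proof -
  have "integral {0..T} mu = integral {0..T} mu'" by (intro integral_cong assms)
  moreover have "indicator {0..T} t * mu t = indicator {0..T} t * mu' t" for t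
    using assms[of t] by (auto simp: indicator_def)
  ultimately show ?thesis unfolding poisson_process_def by (simp only:)
qed

text \<open>Composition with the clamp continues a function constantly beyond the endpoints, which
  preserves continuity and bounds.\<close>

definition clamp_to :: "real \<Rightarrow> real \<Rightarrow> real \<Rightarrow> real" where
  "clamp_to u v s = max u (min v s)"

lemma clamp_to_id [simp]: "s \<in> {u..v} \<Longrightarrow> clamp_to u v s = s"
  by (auto simp: clamp_to_def)

lemma clamp_to_in: "u \<le> v \<Longrightarrow> clamp_to u v s \<in> {u..v}"
  by (auto simp: clamp_to_def)

lemma detector_clamp:
  fixes lam lam' lam'' :: "real \<Rightarrow> real"
  assumes ab: "0 < a" "a < b" "b < T" and lam0: "0 < lam0"
    and zero: "\<And>t. t \<in> {- b..0} \<Longrightarrow> lam t = 0" and pos: "\<And>t. t \<in> {0<..T - a} \<Longrightarrow> 0 < lam t"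
    and d1: "\<And>x. x \<in> {- b..T - a} \<Longrightarrow> (lam has_real_derivative lam' x) (at x within {- b..T - a})"
    and d2: "\<And>x. x \<in> {- b..T - a} \<Longrightarrow> (lam' has_real_derivative lam'' x) (at x within {- b..T - a})"
    and c2: "continuous_on {- b..T - a} lam''"
  shows "\<exists>B. detector T lam0 a b B (\<lambda>s. lam (clamp_to (- b) (T - a) s)) (\<lambda>s. lam' (clamp_to (- b) (T - a) s))
     (\<lambda>s. lam'' (clamp_to (- b) (T - a) s))"
proof -
  let ?I = "{- b..T - a}" and ?c = "clamp_to (- b) (T - a)"
  have uv: "- b \<le> T - a" using ab by linarith
  have cl: "?c s \<in> ?I" for s by (rule clamp_to_in[OF uv])
  have cc: "continuous_on UNIV ?c" unfolding clamp_to_def by (intro continuous_intros)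
  have c0: "continuous_on ?I lam" and c1: "continuous_on ?I lam'"
    using d1 d2 by (blast intro: DERIV_continuous_on)+
  have ext: "continuous_on UNIV (\<lambda>s. f (?c s))" if "continuous_on ?I f" for f :: "real \<Rightarrow> real"
    by (rule continuous_on_compose2[OF that cc]) (use cl in auto)
  have bd: "\<exists>B. \<forall>x\<in>?I. \<bar>f x\<bar> \<le> B" if "continuous_on ?I f" for f :: "real \<Rightarrow> real"
    using compact_imp_bounded[OF compact_continuous_image[OF that compact_Icc]] by (auto simp: bounded_iff)
  obtain B0 B1 B2 where B: "\<And>x. x \<in> ?I \<Longrightarrow> \<bar>lam x\<bar> \<le> B0" "\<And>x. x \<in> ?I \<Longrightarrow> \<bar>lam' x\<bar> \<le> B1" "\<And>x. x \<in> ?I \<Longrightarrow> \<bar>lam'' x\<bar> \<le> B2"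
    using bd[OF c0] bd[OF c1] bd[OF c2] by metis
  have der: "((\<lambda>s. f (?c s)) has_real_derivative f' (?c x)) (at x within ?I)"
    if "(f has_real_derivative f' x) (at x within ?I)" "x \<in> ?I" for f f' :: "real \<Rightarrow> real" and x
    using that by (subst clamp_to_id[OF that(2)]) (auto intro: has_field_derivative_transform_within[of f _ _ _ 1])
  have nonneg: "0 \<le> lam x" if "x \<in> ?I" for x
    using zero[of x] pos[of x] that by (cases "x \<le> 0") (auto intro: less_imp_le)
  have "detector T lam0 a b (max B0 (max B1 B2)) (\<lambda>s. lam (?c s)) (\<lambda>s. lam' (?c s)) (\<lambda>s. lam'' (?c s))"
  \<comment> \<open>Goals 9 to 11 are the bounds on the signal and its derivatives, goals 14 and 15
    its vanishing and positivity, where the clamp acts as the identity.\<close>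
  proof (unfold_locales, goal_cases)
    case (9 s) show ?case using B(1)[OF cl] by (simp add: le_max_iff_disj)
  next
    case (10 s) show ?case using B(2)[OF cl] by (simp add: le_max_iff_disj)
  next
    case (11 s) show ?case using B(3)[OF cl] by (simp add: le_max_iff_disj)
  next
    case (14 x) then show ?case using zero[of x] ab by auto
  next
    case (15 x) then show ?case using pos[of x] ab by auto
  qed (use ab lam0 ext[OF c0] ext[OF c1] ext[OF c2] nonneg[OF cl] der d1 d2 in auto)
  then show ?thesis by blast
qed

text \<open>Moving the source along the ray through the detector multiplies its delay by
  \<open>1 - e\<close> or \<open>1 + e\<close>. The positive infimum makes the delay nonzero, so
  both changes are strict, and openness keeps the moved source in the region.\<close>

lemma open_delay_interior:
  fixes Theta :: "(real^2) set"
  assumes op: "open Theta" and bd: "bounded Theta" and th: "th \<in> Theta" and nu: "0 < nu"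
    and pos: "0 < Inf (delay nu p ` Theta)"
  shows "Inf (delay nu p ` Theta) < delay nu p th" "delay nu p th < Sup (delay nu p ` Theta)"
proof -
  have nonneg: "0 \<le> delay nu p x" for x using nu by (simp add: delay_def)
  have below: "bdd_below (delay nu p ` Theta)" using nonneg by (intro bdd_belowI2[of _ 0])
  obtain K where K: "\<And>x. x \<in> Theta \<Longrightarrow> norm x \<le> K" using bd by (auto simp: bounded_iff)
  have above: "bdd_above (delay nu p ` Theta)"
  proof (rule bdd_aboveI2[of _ _ "(norm p + K) / nu"])
    fix x assume "x \<in> Theta"
    then show "delay nu p x \<le> (norm p + K) / nu"
      using K[of x] norm_triangle_ineq4[of p x] nu by (auto simp: delay_def intro!: divide_right_mono)
  qed
  have d0: "0 < delay nu p th" using cInf_lower[OF imageI[OF th] below] pos by linarith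
  have "((\<lambda>e. th + e *\<^sub>R (p - th)) \<longlongrightarrow> th + 0 *\<^sub>R (p - th)) (at (0::real))" by (intro tendsto_intros)
  then have "\<forall>\<^sub>F e in at (0::real). th + e *\<^sub>R (p - th) \<in> Theta"
    using topological_tendstoD[OF _ op] th by simp
  then obtain d where d: "0 < d" "\<And>e. e \<noteq> 0 \<Longrightarrow> \<bar>e\<bar> < d \<Longrightarrow> th + e *\<^sub>R (p - th) \<in> Theta"
    unfolding eventually_at by (auto simp: dist_real_def)
  define e where "e = min (d / 2) (1 / 2)"
  have e: "0 < e" "e < d" "e < 1" using d(1) by (auto simp: e_def)
  have shift: "delay nu p (th + x *\<^sub>R (p - th)) = (1 - x) * delay nu p th" if "x < 1" for x
  proof -
    have "p - (th + x *\<^sub>R (p - th)) = (1 - x) *\<^sub>R (p - th)" by (simp add: algebra_simps)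
    then show ?thesis using that by (simp add: delay_def)
  qed
  have "Inf (delay nu p ` Theta) \<le> (1 - e) * delay nu p th"
    using cInf_lower[OF imageI[OF d(2)[of e]] below] shift[of e] e by simp
  then show "Inf (delay nu p ` Theta) < delay nu p th"
    using mult_pos_pos[OF e(1) d0] by (simp add: algebra_simps)
  have "(1 + e) * delay nu p th \<le> Sup (delay nu p ` Theta)"
    using cSup_upper[OF imageI[OF d(2)[of "- e"]] above] shift[of "- e"] e by simp
  then show "delay nu p th < Sup (delay nu p ` Theta)"
    using mult_pos_pos[OF e(1) d0] by (simp add: algebra_simps)
qed

theorem theorem2:
  fixes Theta_set :: "(real^2) set"
    and T nu lam0 :: real
    and dpos :: "'k::finite \<Rightarrow> real^2"
    and lam lam' lam'' :: "'k \<Rightarrow> real \<Rightarrow> real"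
    and th0 :: "real^2"
    and tauhat :: "nat \<Rightarrow> ('k \<Rightarrow> path) \<Rightarrow> real^'k"
    and alpha beta :: "'k \<Rightarrow> real"
    and tau0 :: "real^'k"
    and Itau :: "'k \<Rightarrow> real"
  defines "alpha \<equiv> \<lambda>j. Inf (delay nu (dpos j) ` Theta_set)"
    and "beta \<equiv> \<lambda>j. Sup (delay nu (dpos j) ` Theta_set)"
    and "tau0 \<equiv> \<chi> j. delay nu (dpos j) th0"
    and "Itau \<equiv> \<lambda>j. fisher_delay T lam0 (lam j) (lam' j) (tau0 $ j)"
  assumes k3: "CARD('k) \<ge> 3"
    and Theta: "open Theta_set" "bounded Theta_set" "convex Theta_set"
    and pos: "T > 0" "nu > 0" "lam0 > 0"
    and alpha_beta: "\<forall>j. 0 < alpha j \<and> beta j < T"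
    and R1: "\<forall>j. (\<forall>t\<in>{- beta j..0}. lam j t = 0) \<and> (\<forall>t\<in>{0<..T - alpha j}. lam j t > 0)"
    and R2: "\<forall>j. (\<forall>x\<in>{- beta j..T - alpha j}.
                   (lam j has_real_derivative lam' j x) (at x within {- beta j..T - alpha j})
                 \<and> (lam' j has_real_derivative lam'' j x) (at x within {- beta j..T - alpha j}))
               \<and> continuous_on {- beta j..T - alpha j} (lam'' j)"
    and R3: "\<exists>c>0. \<forall>th\<in>Theta_set. \<forall>e::real^2. norm e = 1 \<longrightarrow>
               c \<le> e \<bullet> (fisher_pos T nu lam0 dpos lam lam' th *v e)"
    and R4: "\<exists>a b c. \<not> collinear {dpos a, dpos b, dpos c}"
    and true_pos: "th0 \<in> Theta_set"
    and est_meas: "\<forall>n. tauhat n \<in> borel_measurable (obs_law n T lam0 lam tau0)"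
    and est_max: "\<forall>n X j. tauhat n X $ j \<in> {alpha j..beta j} \<and>
                    (\<forall>tau\<in>{alpha j..beta j}. lik n T lam0 (lam j) tau (X j)
                                      \<le> lik n T lam0 (lam j) (tauhat n X $ j) (X j))"
  shows
    "(\<forall>eps>0. (\<lambda>n. measure (obs_law n T lam0 lam tau0)
                  {X \<in> space (obs_law n T lam0 lam tau0). norm (tauhat n X - tau0) > eps})
              \<longlonglongrightarrow> 0)
  \<and> weak_conv (\<lambda>n. distr (obs_law n T lam0 lam tau0) borel
                         (\<lambda>X. sqrt (real n) *\<^sub>R (tauhat n X - tau0)))
                 (gaussian_diag (\<lambda>j. 1 / Itau j))
  \<and> (\<forall>p :: 'k \<Rightarrow> nat.
         (\<lambda>n. \<integral>X. (\<Prod>j\<in>UNIV. ((sqrt (real n) *\<^sub>R (tauhat n X - tau0)) $ j) ^ p j)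
                 \<partial>obs_law n T lam0 lam tau0)
         \<longlonglongrightarrow> (\<integral>x. (\<Prod>j\<in>UNIV. (x $ j) ^ p j) \<partial>gaussian_diag (\<lambda>j. 1 / Itau j)))
  \<and> (let R = (\<lambda>delta n. Sup {real n * (\<integral>X. (norm (tauhat n X - tau)) ^ 2 \<partial>obs_law n T lam0 lam tau)
                            | tau. (\<forall>j. tau $ j \<in> {alpha j..beta j}) \<and> norm (tau - tau0) \<le> delta})
       in (\<forall>\<^sub>F delta in at_right 0. convergent (R delta))
          \<and> ((\<lambda>delta. lim (R delta)) \<longlongrightarrow> (\<integral>x. (norm x) ^ 2 \<partial>gaussian_diag (\<lambda>j. 1 / Itau j)))
              (at_right 0))"
proof -
  have int0: "alpha j < tau0 $ j" "tau0 $ j < beta j" for j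
    using open_delay_interior[OF Theta(1,2) true_pos pos(2), of "dpos j"] alpha_beta
    unfolding alpha_def beta_def tau0_def by auto
  have ab: "0 < alpha j" "alpha j < beta j" "beta j < T" for j
    using alpha_beta int0[of j] by (auto intro: less_trans)
  let ?c = "\<lambda>j. clamp_to (- beta j) (T - alpha j)"
  define l where "l j s = lam j (?c j s)" for j s
  define l1 where "l1 j s = lam' j (?c j s)" for j s
  define l2 where "l2 j s = lam'' j (?c j s)" for j s
  have "\<exists>B. detector T lam0 (alpha j) (beta j) B (l j) (l1 j) (l2 j)" for j
    unfolding l_def l1_def l2_def
    using R1 R2 by (intro detector_clamp ab pos(3)) auto
  then obtain B where det: "\<And>j. detector T lam0 (alpha j) (beta j) (B j) (l j) (l1 j) (l2 j)" by metis
  \<comment> \<open>For \<open>t\<close> in the window and an admissible delay,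
    \<open>t - tau\<close> lies where the signal is given. Laws and likelihoods therefore do not see
    the continuation.\<close>
  have l_eq: "l j (t - tau) = lam j (t - tau)" "l1 j (t - tau) = lam' j (t - tau)"
    if "tau \<in> {alpha j..beta j}" "t \<in> {0..T}" for j tau t
    using that by (auto simp: l_def l1_def)
  have obs_eq: "obs_law n T lam0 lam tau = obs_law n T lam0 l tau" if "\<forall>j. tau $ j \<in> {alpha j..beta j}" for n tau
    unfolding obs_law_def using that l_eq by (intro PiM_cong refl poisson_process_cong) auto
  have lik_eq: "lik n T lam0 (lam j) tau X = lik n T lam0 (l j) tau X" if tau: "tau \<in> {alpha j..beta j}" for n j tau X
  proof -
    have e: "l j (t - tau) = lam j (t - tau)" if "t \<in> {tau..T}" for t
      using that tau ab[of j] by (intro l_eq(1)) auto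
    have "integral {tau..T} (\<lambda>t. lam j (t - tau)) = integral {tau..T} (\<lambda>t. l j (t - tau))"
      by (intro integral_cong) (simp add: e)
    moreover have "indicator {tau..T} t * ln (1 + lam j (t - tau) / lam0) = indicator {tau..T} t * ln (1 + l j (t - tau) / lam0)" for t
      using e[of t] by (auto simp: indicator_def)
    ultimately show ?thesis unfolding lik_def path_integral_def by (simp only:)
  qed
  interpret A: detector_array T lam0 alpha beta B l l1 l2 tauhat
  proof (rule detector_array.intro)
    show "detector T lam0 (alpha j) (beta j) (B j) (l j) (l1 j) (l2 j)" for j by (rule det)
    show "tauhat n \<in> borel_measurable (obs_law n T lam0 l tau)" for n tau
      \<comment> \<open>Measurability is assumed at the true delays only and holds for all delays
        because the sigma-algebra is the same.\<close>
      using est_meas by (simp add: measurable_cong_sets[OF sets_obs_law refl])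
    show "tauhat n X $ j \<in> {alpha j..beta j} \<and>
      (\<forall>tau\<in>{alpha j..beta j}. lik n T lam0 (l j) tau (X j) \<le> lik n T lam0 (l j) (tauhat n X $ j) (X j))" for n X j
      using est_max lik_eq by metis
  qed
  \<comment> \<open>Half of the smallest distance of a true delay to the ends of its interval, so
    that the margin \<open>2 * rho\<close> required by \<open>A.minimax\<close> is
    available.\<close>
  define rho where "rho = Min (range (\<lambda>j. min (tau0 $ j - alpha j) (beta j - tau0 $ j))) / 2"
  have rho: "0 < rho" unfolding rho_def using int0 by (simp add: Min_gr_iff)
  have inner2: "\<forall>j. tau0 $ j \<in> {alpha j + 2 * rho..beta j - 2 * rho}"
  proof
    fix j
    have "Min (range (\<lambda>j. min (tau0 $ j - alpha j) (beta j - tau0 $ j))) \<le> min (tau0 $ j - alpha j) (beta j - tau0 $ j)"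
      by (rule Min_le) auto
    then have "2 * rho \<le> min (tau0 $ j - alpha j) (beta j - tau0 $ j)"
      unfolding rho_def by linarith
    then show "tau0 $ j \<in> {alpha j + 2 * rho..beta j - 2 * rho}" by auto
  qed
  have inner: "\<forall>j. tau0 $ j \<in> {alpha j + rho..beta j - rho}"
  proof
    fix j show "tau0 $ j \<in> {alpha j + rho..beta j - rho}" using spec[OF inner2, of j] rho by auto
  qed
  have valid: "\<forall>j. tau0 $ j \<in> {alpha j..beta j}" using A.inner_valid[OF rho inner] .
  have I_eq: "Itau j = A.F j (tau0 $ j)" for j
    unfolding Itau_def A.F_def fisher_delay_def
  proof (rule integral_cong)
    fix t assume t: "t \<in> {tau0 $ j..T}"
    have v: "tau0 $ j \<in> {alpha j..beta j}" using valid by blast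
    then have "t \<in> {0..T}" using t ab(1)[of j] by auto
    from l_eq[OF v this]
    show "(lam' j (t - tau0 $ j))^2 / (lam j (t - tau0 $ j) + lam0) = (l1 j (t - tau0 $ j))^2 / (l j (t - tau0 $ j) + lam0)"
      by simp
  qed
  have err: "A.err n tau0 = (\<lambda>X. sqrt (real n) *\<^sub>R (tauhat n X - tau0))" for n
    by (simp add: A.err_def fun_eq_iff)
  \<comment> \<open>The supremum runs over admissible delays, which is exactly where the two
    observation laws agree.\<close>
  have set_eq: "{real n * (\<integral>X. (norm (tauhat n X - tau)) ^ 2 \<partial>obs_law n T lam0 lam tau)
        | tau. (\<forall>j. tau $ j \<in> {alpha j..beta j}) \<and> norm (tau - tau0) \<le> delta}
     = {real n * (\<integral>X. (norm (tauhat n X - tau)) ^ 2 \<partial>obs_law n T lam0 l tau)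
        | tau. (\<forall>j. tau $ j \<in> {alpha j..beta j}) \<and> norm (tau - tau0) \<le> delta}" for n delta
    using obs_eq by (intro Collect_cong ex_cong1) (auto simp del: atLeastAtMost_iff)
  have mono: "(\<lambda>n. \<integral>X. (\<Prod>j\<in>UNIV. (A.err n tau0 X $ j) ^ p j) \<partial>obs_law n T lam0 l tau0)
         \<longlonglongrightarrow> (\<integral>x. (\<Prod>j\<in>UNIV. (x $ j) ^ p j) \<partial>gaussian_diag (\<lambda>j. 1 / A.F j (tau0 $ j)))" for p :: "'k \<Rightarrow> nat"
    by (rule A.err_moment_limit[OF rho inner, where c=1])
       (use monomial_square_le in \<open>auto intro!: continuous_intros\<close>)
  show ?thesis
    unfolding Let_def set_eq obs_eq[OF valid] I_eq
    using A.consistency[OF rho inner] A.err_weak_limit[OF rho inner] mono A.minimax[OF rho inner2]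
      A.gaussian_second_moment(2)[OF rho inner]
    unfolding err by (intro conjI allI impI) auto
qed

end
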